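(* Assume the setting described in the context ($\xi$ in the domain of attraction of the normal law, $\alpha=2$, with normalising sequence $(a_n)_{n\ge1}$ and centering $b_n=n\mu$), and assume that $\lim_{n\to\infty}\frac{x_n}{a_n}=\infty$; let $r_n=r(n/x_n)$. Then: 1. If $\lim_{n\to\infty}\frac{x_n}{n}=0$, then conditionally on having no big jump ($M_n\le r_n$), $$\mathscr L\Big(\frac{S_n-b_n-x_n}{\sqrt{x_n/r_n}}\ \Big|\ S_n-b_n\ge x_n,\ M_n\le r_n\Big)\xrightarrow[n\to\infty]{w}\mathrm{Exp}(1),$$ where $\xrightarrow{w}$ denotes weak convergence and $\mathrm{Exp}(1)$ is the exponential law with parameter $1$. 2. If $\overline F$ is intermediate regularly varying, then conditionally on having a big jump ($M_n>r_n$), for any sequence $x_n'\ge x_n$ we have, as $n\to\infty$, $$\mathbb P\big(S_n-b_n\ge x_n'\ \big|\ S_n-b_n\ge x_n,\ M_n>r_n\big)\sim\frac{\overline F(x_n')}{\overline F(x_n)} .$$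
   Context: $\xi$ is a real random variable, $\xi_1,\xi_2,\dots$ are i.i.d. copies, $F(x)=\mathbb P(\xi\le x)$, $\overline F=1-F$, $S_n=\sum_{i=1}^n\xi_i$, $M_n=\max\{\xi_1,\dots,\xi_n\}$. Setting "$\alpha=2$": $\xi$ has a finite expectation $\mu=\mathbb E[\xi]$, and the truncated variance $\sigma^2(x)=\mathbb E[(\xi-\mu)^2\mathbf 1_{\{|\xi-\mu|\le x\}}]$ is slowly varying as $x\to\infty$ (the variance may be finite or infinite). $(a_n)$ is a normalising sequence, i.e. $\sigma^2(a_n)a_n^{-2}\sim n^{-1}$; $b_n=n\mu$. $(x_n)$ is a positive sequence. Threshold: $r:(0,\infty)\to\mathbb R_+$ is a function satisfying $\frac{r(t)}{\sigma^2(r(t))}\sim t$ as $t\to\infty$ (so that $r(t)\to\infty$), and $r_n=r(n/x_n)$. Thus if $x_n/n\to0$ then $r_n\to\infty$ and $\frac{r_n}{\sigma^2(r_n)}\sim\frac n{x_n}$. A function $f$ is intermediate regularly varying if $\lim_{\lambda\downarrow1}\liminf_{x\to\infty}\frac{f(\lambda x)}{f(x)}=\lim_{\lambda\downarrow1}\limsup_{x\to\infty}\frac{f(\lambda x)}{f(x)}=1$.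
   Formalization: In item 1 the normaliser is r_n instead of sqrt(x_n/r_n) (the latter fails for Gaussian ξ, a_n = sqrt(n), x_n = n^(2/3)); item 2 additionally assumes that r_n stays bounded along those n for which n/x_n stays bounded, since r is otherwise arbitrary near 0. *)

theory Defs
  imports "HOL-Probability.Probability" "HOL-Library.Landau_Symbols"
begin

(* The totalised quotient 0/0 = 0 is harmless here and in inter_reg_varying: a limit equal
   to 1 forces f to be eventually nonzero. *)
definition slowly_varying :: "(real \<Rightarrow> real) \<Rightarrow> bool" where
  "slowly_varying f \<longleftrightarrow> (\<forall>c>0. ((\<lambda>x. f (c * x) / f x) \<longlongrightarrow> 1) at_top)"

definition inter_reg_varying :: "(real \<Rightarrow> real) \<Rightarrow> bool" where
  "inter_reg_varying f \<longleftrightarrow>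
     ((\<lambda>c. Liminf at_top (\<lambda>x. ereal (f (c * x) / f x))) \<longlongrightarrow> 1) (at_right 1) \<and>
     ((\<lambda>c. Limsup at_top (\<lambda>x. ereal (f (c * x) / f x))) \<longlongrightarrow> 1) (at_right 1)"

definition mean :: "'a measure \<Rightarrow> ('a \<Rightarrow> real) \<Rightarrow> real" where
  "mean M Y = (LINT \<omega>|M. Y \<omega>)"

definition trunc_var :: "'a measure \<Rightarrow> ('a \<Rightarrow> real) \<Rightarrow> real \<Rightarrow> real" where
  "trunc_var M Y x =
     (LINT \<omega>|M. (Y \<omega> - mean M Y)\<^sup>2 * indicator {\<omega>'. \<bar>Y \<omega>' - mean M Y\<bar> \<le> x} \<omega>)"

definition tail :: "'a measure \<Rightarrow> ('a \<Rightarrow> real) \<Rightarrow> real \<Rightarrow> real" where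
  "tail M Y x = 1 - cdf (distr M borel Y) x"

definition iid_copies :: "'a measure \<Rightarrow> ('a \<Rightarrow> real) \<Rightarrow> (nat \<Rightarrow> 'a \<Rightarrow> real) \<Rightarrow> bool" where
  "iid_copies M Y X \<longleftrightarrow>
     prob_space.indep_vars M (\<lambda>_. borel) X {1..} \<and>
     (\<forall>i\<ge>1. distr M borel (X i) = distr M borel Y)"

definition psum :: "(nat \<Rightarrow> 'a \<Rightarrow> real) \<Rightarrow> nat \<Rightarrow> 'a \<Rightarrow> real" where
  "psum X n \<omega> = (\<Sum>i=1..n. X i \<omega>)"

definition pmax :: "(nat \<Rightarrow> 'a \<Rightarrow> real) \<Rightarrow> nat \<Rightarrow> 'a \<Rightarrow> real" where
  "pmax X n \<omega> = Max ((\<lambda>i. X i \<omega>) ` {1..n})"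

(* The defining relation alone does not force a n to infinity: it can also have solutions
   tending to 0, e.g. when Y has a continuous positive density near its mean. Divergence is
   therefore part of being normalising; the same remark applies to threshold_fun. *)
definition normalising_seq :: "'a measure \<Rightarrow> ('a \<Rightarrow> real) \<Rightarrow> (nat \<Rightarrow> real) \<Rightarrow> bool" where
  "normalising_seq M Y a \<longleftrightarrow>
     filterlim a at_top sequentially \<and>
     (\<lambda>n. trunc_var M Y (a n) / (a n)\<^sup>2) \<sim>[sequentially] (\<lambda>n. 1 / real n)"

definition threshold_fun :: "'a measure \<Rightarrow> ('a \<Rightarrow> real) \<Rightarrow> (real \<Rightarrow> real) \<Rightarrow> bool" where
  "threshold_fun M Y r \<longleftrightarrow>
     (\<forall>t>0. r t \<ge> 0) \<and> filterlim r at_top at_top \<and>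
     (\<lambda>t. r t / trunc_var M Y (r t)) \<sim>[at_top] (\<lambda>t. t)"

definition cond_law :: "'a measure \<Rightarrow> ('a \<Rightarrow> real) \<Rightarrow> ('a \<Rightarrow> bool) \<Rightarrow> real measure" where
  "cond_law M Y P = distr (uniform_measure M {\<omega> \<in> space M. P \<omega>}) borel Y"

definition exp_law :: "real \<Rightarrow> real measure" where
  "exp_law l = density lborel (exponential_density l)"

end

(*
  Write h for the threshold, Y for the centred variable, V for its truncated variance and S for the
  centred sum.

  No big jump: tilting the law of each summand, truncated at h, by exp(t Y / h) with t close to 1
  moves the mean of the sum to x exactly. Slow variation of V makes the tilted third moments
  negligible, so under the tilted law (S - x) / h, whose variance is of order x / h and tends to
  infinity, is locally close to a multiple of Lebesgue measure. Removing the tilt multiplies by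
  exp(-t z), which leaves the exponential law.

  One big jump: P(S >= z, max > h) is shown to be equivalent to n times the tail at z. Chernoff
  bounds for the sum truncated at a level y >= h are of the form exp(-z / (32 y)); summed over
  dyadic levels y = z / 2^j they beat the polynomial growth of the tail under halving, so jumps
  much smaller than z are negligible. A jump of order z that stays below z would need a
  macroscopic deviation of the remaining summands, which a weak law excludes.
*)

theory Submission
  imports Defs
begin

section \<open>A local limit theorem\<close>

text \<open>The relation h / V(h) ~ n / x fixes the scale: the tilt exp(t Y / h) moves the mean of
  the sum to about t n V(h) / h, close to t x. The untilting factor varies on the scale h, while the
  tilted standard deviation is much larger, so a central limit theorem is too coarse and a local one
  is required. Division by h leaves no lattice effect, as only bounded frequencies matter. The
  normalising factors are common to all events and cancel in the conditional law. For a big jump, x'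
  >= x turns the conditional probability into a quotient of two probabilities of the same kind, so
  one asymptotic formula suffices. The obstacle is uniformity: z is tied to n only by z >= x, and
  the Chernoff bound must hold at all large levels y >= h at once. This rests on V(y) / y being
  decreasing up to a factor 2. The constants fit together: n V(y) <= 4 x y and exponential moments
  at 1 / 16 spend at most half of the gain z / (16 y), leaving z / (32 y). Where n / x stays
  bounded, the asymptotic relation does not control the threshold, and its boundedness there takes
  over.\<close>

text \<open>The Fourier transform of the squared tent is strictly positive and of exact order $z^{-2}$ at
  infinity, so it dominates an exponential on the half line. Its compactly supported
  preimage means that only characteristic functions on bounded sets enter.\<close>

definition sq_tent :: "real \<Rightarrow> real" where
  "sq_tent t = (max 0 (1 - \<bar>t\<bar>))\<^sup>2"

definition sq_tent_ft :: "real \<Rightarrow> real" where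
  "sq_tent_ft z = (LBINT t. sq_tent t * cos (t * z))"

lemma continuous_sq_tent [continuous_intros]: "continuous_on A sq_tent"
  unfolding sq_tent_def by (intro continuous_intros)

lemma borel_measurable_sq_tent [measurable]: "sq_tent \<in> borel_measurable borel"
  by (intro borel_measurable_continuous_onI continuous_sq_tent)

lemma sq_tent_nonneg [simp]: "0 \<le> sq_tent t"
  by (simp add: sq_tent_def)

lemma sq_tent_le_1 [simp]: "sq_tent t \<le> 1"
  by (simp add: sq_tent_def power_le_one)

lemma sq_tent_0 [simp]: "sq_tent 0 = 1"
  by (simp add: sq_tent_def)

lemma sq_tent_minus [simp]: "sq_tent (- t) = sq_tent t"
  by (simp add: sq_tent_def)

lemma sq_tent_eq_0: "1 \<le> \<bar>t\<bar> \<Longrightarrow> sq_tent t = 0"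
  by (simp add: sq_tent_def)

lemma sq_tent_neq_0D: "sq_tent t \<noteq> 0 \<Longrightarrow> - 1 \<le> t \<and> t \<le> 1"
  using sq_tent_eq_0[of t] by linarith

lemma integrable_sq_tent_mult:
  fixes f :: "real \<Rightarrow> 'b::{banach, second_countable_topology, real_normed_algebra_1}"
  assumes [measurable]: "f \<in> borel_measurable borel" and "\<And>t. norm (f t) \<le> B"
  shows "integrable lborel (\<lambda>t. of_real (sq_tent t) * f t)"
proof (rule integrableI_bounded_set[where A = "{-1..1}" and B = B])
  show "AE t in lborel. t \<in> {-1..1} \<longrightarrow> norm (of_real (sq_tent t) * f t) \<le> B"
  proof (intro AE_I2 impI)
    fix t :: real
    have "norm (of_real (sq_tent t) * f t) \<le> norm (of_real (sq_tent t) :: 'b) * norm (f t)"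
      by (rule norm_mult_ineq)
    also have "\<dots> \<le> 1 * B"
      by (intro mult_mono) (use assms in auto)
    finally show "norm (of_real (sq_tent t) * f t) \<le> B" by simp
  qed
qed (auto simp: sq_tent_eq_0)

lemma integrable_sq_tent_cos: "integrable lborel (\<lambda>t. sq_tent t * cos (t * z))"
  using integrable_sq_tent_mult[of "\<lambda>t. cos (t * z)" 1] by simp

lemma integrable_sq_tent_sin: "integrable lborel (\<lambda>t. sq_tent t * sin (t * z))"
  using integrable_sq_tent_mult[of "\<lambda>t. sin (t * z)" 1] by simp

text \<open>The tent is even, so the sine part equals its own negative and vanishes.\<close>

lemma sq_tent_ft_iexp: "(CLBINT t. sq_tent t * iexp (t * z)) = sq_tent_ft z"
proof -
  have "(LBINT t. sq_tent t * sin (t * z)) = (LBINT t. sq_tent (-t) * sin ((-t) * z))"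
    by (subst lborel_integral_real_affine[where c = "-1" and t = 0]) auto
  also have "\<dots> = - (LBINT t. sq_tent t * sin (t * z))"
    by simp
  finally have odd: "(LBINT t. sq_tent t * sin (t * z)) = 0" by simp
  have "(CLBINT t. sq_tent t * iexp (t * z)) =
      (CLBINT t. of_real (sq_tent t * cos (t * z)) + \<i> * of_real (sq_tent t * sin (t * z)))"
    by (intro Bochner_Integration.integral_cong) (auto simp: exp_Euler cos_of_real sin_of_real algebra_simps simp flip: of_real_mult)
  also have "\<dots> = of_real (LBINT t. sq_tent t * cos (t * z)) + \<i> * of_real (LBINT t. sq_tent t * sin (t * z))"
    using integrable_sq_tent_cos[of z] integrable_sq_tent_sin[of z]
    by (subst Bochner_Integration.integral_add)
       (auto simp del: of_real_mult simp: integral_complex_of_real)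
  finally show ?thesis by (simp add: sq_tent_ft_def odd)
qed

lemma sq_tent_ft_eq_half: "sq_tent_ft z = 2 * (LBINT t. indicator {0..1} t * ((1 - t)\<^sup>2 * cos (t * z)))"
proof -
  let ?f = "\<lambda>t. indicator {0..1} t * ((1 - t)\<^sup>2 * cos (t * z)) :: real"
  have int: "integrable lborel ?f"
    using borel_integrable_atLeastAtMost'[of 0 1 "\<lambda>t. (1 - t)\<^sup>2 * cos (t * z)"]
    by (simp add: set_integrable_def continuous_intros)
  have int': "integrable lborel (\<lambda>t. ?f (- t))"
    using lborel_integrable_real_affine_iff[of "-1" ?f 0] int by simp
  have "sq_tent_ft z = (LBINT t. ?f t + ?f (- t))"
    unfolding sq_tent_ft_def
  proof (rule integral_cong_AE)
    \<comment> \<open>Both halves contain the origin, so the pointwise identity fails there, on a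
      null set.\<close>
    have "AE t in lborel. t \<noteq> (0::real)" by (rule AE_lborel_singleton)
    then show "AE t in lborel. sq_tent t * cos (t * z) = ?f t + ?f (- t)"
      by eventually_elim (auto simp: sq_tent_def indicator_def max_def)
  qed auto
  also have "\<dots> = (LBINT t. ?f t) + (LBINT t. ?f (- t))"
    using int int' by (rule Bochner_Integration.integral_add)
  also have "(LBINT t. ?f (- t)) = (LBINT t. ?f t)"
    by (subst (2) lborel_integral_real_affine[where c = "-1" and t = 0]) auto
  finally show ?thesis by simp
qed

lemma sq_tent_ft_0: "sq_tent_ft 0 = 2 / 3"
proof -
  have "(\<integral>t. (1 - t)\<^sup>2 * indicator {0..1} t \<partial>lborel) = - ((1 - 1) ^ 3) / 3 - (- ((1 - 0) ^ 3) / 3 :: real)"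
    by (rule integral_FTC_Icc_real)
       (auto intro!: derivative_eq_intros continuous_intros simp: power2_eq_square field_simps)
  then show ?thesis by (simp add: sq_tent_ft_eq_half mult.commute)
qed

lemma sq_tent_ft_eq:
  assumes z: "z \<noteq> 0"
  shows "sq_tent_ft z = 4 * (z - sin z) / z ^ 3"
proof -
  \<comment> \<open>The antiderivative found by two integrations by parts.\<close>
  let ?F = "\<lambda>t. (1 - t)\<^sup>2 * sin (t * z) / z - 2 * (1 - t) * cos (t * z) / z\<^sup>2 - 2 * sin (t * z) / z ^ 3"
  have "(\<integral>t. ((1 - t)\<^sup>2 * cos (t * z)) * indicator {0..1} t \<partial>lborel) = ?F 1 - ?F 0"
  proof (rule integral_FTC_Icc_real)
    fix t :: real
    have "DERIV ?F t :> ((1 - t)\<^sup>2 * (cos (t * z) * z) + (2 * (1 - t) * (-1)) * sin (t * z)) / z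
        - (2 * (1 - t) * (- sin (t * z) * z) + (2 * (-1)) * cos (t * z)) / z\<^sup>2 - 2 * (cos (t * z) * z) / z ^ 3"
      using z by (intro DERIV_diff DERIV_cdivide DERIV_cmult DERIV_mult DERIV_fun_sin) (auto intro!: derivative_eq_intros)
    then show "DERIV ?F t :> (1 - t)\<^sup>2 * cos (t * z)"
      by (rule DERIV_cong) (use z in \<open>simp add: divide_simps, simp add: algebra_simps power2_eq_square power3_eq_cube\<close>)
  qed (auto intro!: continuous_intros)
  also have "\<dots> = 2 * (z - sin z) / z ^ 3"
    using z by (simp add: field_simps power2_eq_square power3_eq_cube)
  finally show ?thesis by (simp add: sq_tent_ft_eq_half mult.commute)
qed

lemma isCont_sq_tent_ft [continuous_intros]: "isCont sq_tent_ft z"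
  unfolding continuous_at_sequentially comp_def
proof (intro allI impI)
  fix u :: "nat \<Rightarrow> real" assume u: "u \<longlonglongrightarrow> z"
  show "(\<lambda>n. sq_tent_ft (u n)) \<longlonglongrightarrow> sq_tent_ft z"
    unfolding sq_tent_ft_def
  proof (rule integral_dominated_convergence[where w = sq_tent])
    show "integrable lborel sq_tent"
      using integrable_sq_tent_cos[of 0] by simp
    show "AE t in lborel. (\<lambda>n. sq_tent t * cos (t * u n)) \<longlonglongrightarrow> sq_tent t * cos (t * z)"
      by (intro AE_I2 tendsto_intros u)
    show "AE t in lborel. norm (sq_tent t * cos (t * u n)) \<le> sq_tent t" for n
      by (auto simp: abs_mult intro!: mult_left_le)
  qed auto
qed

lemma continuous_on_sq_tent_ft [continuous_intros]: "continuous_on A sq_tent_ft"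
  by (intro continuous_at_imp_continuous_on ballI isCont_sq_tent_ft)

lemma borel_measurable_sq_tent_ft [measurable]: "sq_tent_ft \<in> borel_measurable borel"
  by (intro borel_measurable_continuous_onI continuous_on_sq_tent_ft)

lemma sq_tent_ft_minus: "sq_tent_ft (- z) = sq_tent_ft z"
  by (simp add: sq_tent_ft_def)

text \<open>Strictness at every positive z keeps the transform away from zero everywhere, so that
  test functions can later be divided by it. Up to 1 it comes from the duplication formula and cos
  (z / 2) < 1.\<close>

lemma sin_less_self: "0 < z \<Longrightarrow> sin z < (z::real)"
proof -
  assume z: "0 < z"
  show "sin z < z"
  proof (cases "z \<le> 1")
    case True
    have "0 < sin (z / 2)" "cos (z / 2) < 1" using z True sin_gt_zero_02[of "z / 2"] cos_monotone_0_pi[of 0 "z / 2"] pi_gt3 by auto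
    then have "sin (z / 2) * cos (z / 2) < sin (z / 2)" by simp
    also have "sin (z / 2) \<le> z / 2" using z by (intro sin_x_le_x) auto
    finally show ?thesis using sin_double[of "z / 2"] by simp
  qed (use sin_le_one[of z] in linarith)
qed

lemma sq_tent_ft_pos: "0 < sq_tent_ft z"
proof -
  have pos: "0 < sq_tent_ft z" if "0 < z" for z
    using that sin_less_self[of z] by (simp add: sq_tent_ft_eq)
  consider "z < 0" | "z = 0" | "z > 0" by linarith
  then show ?thesis
    using pos[of z] pos[of "- z"] by cases (auto simp: sq_tent_ft_minus sq_tent_ft_0)
qed

lemma sq_tent_ft_nonneg [simp]: "0 \<le> sq_tent_ft z"
  using sq_tent_ft_pos[of z] by simp

text \<open>Near the origin the value 2 / 3 at zero is the maximum; elsewhere z^2 > 1 gives 1 + z^2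
  <= 2 z^2, which turns 8 / z^2 into 16 / (1 + z^2).\<close>

lemma sq_tent_ft_le: "sq_tent_ft z \<le> 16 / (1 + z\<^sup>2)"
proof -
  have le1: "sq_tent_ft z \<le> 2 / 3"
  proof -
    have "sq_tent_ft z \<le> (LBINT t. sq_tent t * cos (t * 0))"
      unfolding sq_tent_ft_def by (intro integral_mono integrable_sq_tent_cos) (simp add: mult_left_le)
    then show ?thesis using sq_tent_ft_0 by (simp add: sq_tent_ft_def)
  qed
  have le2: "sq_tent_ft z \<le> 8 / z\<^sup>2" if "z > 0" for z
  proof -
    have "4 * (z - sin z) / z ^ 3 \<le> 4 * (2 * z) / z ^ 3"
      using that abs_sin_x_le_abs_x[of z] by (intro divide_right_mono) auto
    also have "\<dots> = 8 / z\<^sup>2" using that by (simp add: power2_eq_square power3_eq_cube)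
    finally show ?thesis using that by (simp add: sq_tent_ft_eq)
  qed
  have le3: "sq_tent_ft z \<le> 8 / z\<^sup>2" if "z \<noteq> 0"
    using le2[of z] le2[of "-z"] that by (cases "z > 0") (auto simp: sq_tent_ft_minus)
  show ?thesis
  proof (cases "z\<^sup>2 \<le> 1")
    case True
    then have "16 / 2 \<le> 16 / (1 + z\<^sup>2)" by (intro divide_left_mono) (auto simp: add_pos_nonneg)
    with le1 show ?thesis by simp
  next
    case False
    then have nz: "z \<noteq> 0" by auto
    have "8 / z\<^sup>2 = 16 / (2 * z\<^sup>2)" by simp
    also have "\<dots> \<le> 16 / (1 + z\<^sup>2)" using False by (intro divide_left_mono mult_pos_pos) (auto simp: add_pos_nonneg)
    finally have "8 / z\<^sup>2 \<le> 16 / (1 + z\<^sup>2)" .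
    with le3[OF nz] show ?thesis by simp
  qed
qed

text \<open>Beyond 2, sin z <= 1 <= z / 2 leaves at least half of z; on [0, 2] compactness and
  positivity suffice. This bound is what admits test functions of decay z^-2 on the half
  line.\<close>

lemma sq_tent_ft_ge: "\<exists>c>0. \<forall>z\<ge>0. c \<le> sq_tent_ft z * (1 + z\<^sup>2)"
proof -
  have "\<exists>z0\<in>{0..2}. \<forall>z\<in>{0..2}. sq_tent_ft z0 \<le> sq_tent_ft z"
    by (intro continuous_attains_inf continuous_intros) auto
  then obtain z0 where z0: "\<And>z. 0 \<le> z \<Longrightarrow> z \<le> 2 \<Longrightarrow> sq_tent_ft z0 \<le> sq_tent_ft z" by (metis atLeastAtMost_iff)
  have "min (sq_tent_ft z0) 2 \<le> sq_tent_ft z * (1 + z\<^sup>2)" if "0 \<le> z" for z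
  proof (cases "z \<le> 2")
    case True
    have "sq_tent_ft z0 \<le> sq_tent_ft z * 1" using z0[of z] True that by simp
    also have "\<dots> \<le> sq_tent_ft z * (1 + z\<^sup>2)" by (intro mult_left_mono) auto
    finally show ?thesis by simp
  next
    case False
    then have "2 * z \<le> 4 * (z - sin z)" using sin_le_one[of z] by argo
    then have "2 * z ^ 3 \<le> 4 * (z - sin z) * z\<^sup>2"
      using mult_right_mono[of "2*z" "4 * (z - sin z)" "z\<^sup>2"] sin_le_one[of z]
      by (simp add: power2_eq_square power3_eq_cube)
    then have "2 \<le> sq_tent_ft z * z\<^sup>2" using False by (simp add: sq_tent_ft_eq field_simps)
    also have "\<dots> \<le> sq_tent_ft z * (1 + z\<^sup>2)" by (intro mult_left_mono) auto
    finally show ?thesis by simp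
  qed
  then show ?thesis using sq_tent_ft_pos[of z0] by (intro exI[of _ "min (sq_tent_ft z0) 2"]) auto
qed

lemma integrable_sq_tent_ft: "integrable lborel sq_tent_ft"
proof (rule Bochner_Integration.integrable_bound)
  have "set_integrable lborel (einterval (-\<infinity>) \<infinity>) (\<lambda>x::real. inverse (1 + x\<^sup>2))"
    by (rule integrable_inverse_1_plus_square)
  then show "integrable lborel (\<lambda>x::real. 16 * inverse (1 + x\<^sup>2))"
    by (simp add: set_integrable_def)
  show "AE z in lborel. norm (sq_tent_ft z) \<le> norm (16 * inverse (1 + z\<^sup>2))"
    using sq_tent_ft_le by (auto simp: divide_inverse intro: order_trans)
qed auto

lemma sq_tent_ft_le_16: "sq_tent_ft z \<le> 16"
proof -
  have "16 / (1 + z\<^sup>2) \<le> 16 / 1" by (intro divide_left_mono) (auto simp: add_pos_nonneg)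
  with sq_tent_ft_le[of z] show ?thesis by linarith
qed

text \<open>By Fubini, weighting a law with the transform amounts to averaging its characteristic
  function over the window [s - 1, s + 1].\<close>

lemma integral_sq_tent_ft_iexp_char:
  assumes "real_distribution N"
  shows "(CLINT z|N. sq_tent_ft z * iexp (s * z)) = (CLBINT t. sq_tent t * char N (s + t))"
proof -
  interpret N: real_distribution N by fact
  interpret P: pair_sigma_finite N lborel ..
  have [measurable_cong]: "sets N = sets borel" by simp
  have int: "integrable (N \<Otimes>\<^sub>M lborel) (\<lambda>(z, t). complex_of_real (sq_tent t) * iexp ((s + t) * z))"
  proof (rule integrableI_bounded_set[where A = "space N \<times> {-1..1::real}" and B = 1])
    show "emeasure (N \<Otimes>\<^sub>M lborel) (space N \<times> {- 1..1::real}) < \<infinity>"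
      using N.emeasure_space_1 by (subst lborel.emeasure_pair_measure_Times) (auto simp: less_top[symmetric])
    show "space N \<times> {-1..1::real} \<in> sets (N \<Otimes>\<^sub>M lborel)"
      by (intro pair_measureI) auto
  qed (auto simp: norm_mult intro!: AE_I2 dest: sq_tent_neq_0D)
  have "(CLINT z|N. sq_tent_ft z * iexp (s * z)) = (CLINT z|N. (CLBINT t. sq_tent t * iexp ((s + t) * z)))"
  proof (intro Bochner_Integration.integral_cong refl)
    fix z
    have "complex_of_real (sq_tent_ft z) * iexp (s * z) = (CLBINT t. sq_tent t * iexp (t * z)) * iexp (s * z)"
      by (simp only: sq_tent_ft_iexp)
    also have "\<dots> = (CLBINT t. sq_tent t * iexp (t * z) * iexp (s * z))"
      by (subst integral_mult_left_zero) simp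
    also have "\<dots> = (CLBINT t. sq_tent t * iexp ((s + t) * z))"
      by (intro Bochner_Integration.integral_cong) (auto simp: exp_add[symmetric] algebra_simps)
    finally show "sq_tent_ft z * iexp (s * z) = (CLBINT t. sq_tent t * iexp ((s + t) * z))" .
  qed
  also have "\<dots> = (CLBINT t. (CLINT z|N. sq_tent t * iexp ((s + t) * z)))"
    using P.Fubini_integral[OF int] by simp
  finally show ?thesis by (simp add: char_def)
qed

section \<open>Gaussian limits, Fourier inversion and the local limit\<close>

lemma integral_exp_neg_sq: "(LBINT u. exp (- (u\<^sup>2) / 2)) = sqrt (2 * pi)"
proof -
  have "(LBINT u. std_normal_density u) = 1"
    using integral_normal_moment_even[of 1 0 0] by simp
  then have "(LBINT u. 1 / sqrt (2 * pi) * exp (- (u\<^sup>2) / 2)) = 1"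
    by (simp only: std_normal_density_def)
  then have "1 / sqrt (2 * pi) * (LBINT u. exp (- (u\<^sup>2) / 2)) = 1"
    by (simp only: integral_mult_right_zero)
  then show ?thesis by (simp add: divide_simps)
qed

lemma integrable_exp_neg_sq: "0 < c \<Longrightarrow> integrable lborel (\<lambda>u::real. exp (- (c * u\<^sup>2)))"
proof -
  assume c: "0 < c"
  have "integrable lborel (normal_density 0 (sqrt (1 / (2 * c))))"
    using c by (intro integrable_normal_density) auto
  then have "integrable lborel (\<lambda>u. sqrt (2 * pi * (1 / (2 * c))) * normal_density 0 (sqrt (1 / (2 * c))) u)"
    by simp
  moreover have "sqrt (2 * pi * (1 / (2 * c))) * normal_density 0 (sqrt (1 / (2 * c))) u = exp (- (c * u\<^sup>2))" for u
    using c by (simp add: normal_density_def)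
  ultimately show ?thesis by (simp only:)
qed

text \<open>Substituting t = u / sqrt (m n) - s absorbs the factor sqrt (m n). The tent then
  flattens to its value at s, and \<open>bound\<close> with T = |s| + 1 supplies the Gaussian
  majorant exp (- u^2 / 4), since frequencies outside that range meet a zero of the tent.\<close>

lemma smoothed_char_limit:
  fixes \<phi> :: "nat \<Rightarrow> real \<Rightarrow> complex" and m :: "nat \<Rightarrow> real"
  assumes [measurable]: "\<And>n. \<phi> n \<in> borel_measurable borel"
    and m: "filterlim m at_top sequentially"
    and lim: "\<And>u. (\<lambda>n. \<phi> n (u / sqrt (m n))) \<longlonglongrightarrow> complex_of_real (exp (- (u\<^sup>2) / 2))"
    and bound: "\<And>T. \<forall>\<^sub>F n in sequentially. \<forall>t. \<bar>t\<bar> \<le> T \<longrightarrow> cmod (\<phi> n t) \<le> exp (- (m n * t\<^sup>2 / 4))"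
  shows "(\<lambda>n. sqrt (m n) * (CLBINT t. sq_tent t * \<phi> n (s + t))) \<longlonglongrightarrow> complex_of_real (sqrt (2 * pi) * sq_tent s)"
proof -
  let ?g = "\<lambda>n u. complex_of_real (sq_tent (u / sqrt (m n) - s)) * \<phi> n (u / sqrt (m n))"
  have "\<forall>\<^sub>F n in sequentially. m n > 0" using m by (simp add: filterlim_at_top_dense)
  with bound[of "\<bar>s\<bar> + 1"]
  have ev: "\<forall>\<^sub>F n in sequentially. m n > 0 \<and> (\<forall>t. \<bar>t\<bar> \<le> \<bar>s\<bar> + 1 \<longrightarrow> cmod (\<phi> n t) \<le> exp (- (m n * t\<^sup>2 / 4)))"
    by eventually_elim simp
  then obtain n0 where n0: "\<And>n. n \<ge> n0 \<Longrightarrow> m n > 0"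
    "\<And>n t. n \<ge> n0 \<Longrightarrow> \<bar>t\<bar> \<le> \<bar>s\<bar> + 1 \<Longrightarrow> cmod (\<phi> n t) \<le> exp (- (m n * t\<^sup>2 / 4))"
    by (auto simp: eventually_sequentially)
  have "(\<lambda>n. CLBINT u. ?g (n + n0) u) \<longlonglongrightarrow> (CLBINT u. complex_of_real (sq_tent (- s)) * of_real (exp (- (u\<^sup>2) / 2)))"
  proof (rule integral_dominated_convergence[where w = "\<lambda>u. exp (- ((1/4) * u\<^sup>2))"])
    show "integrable lborel (\<lambda>u::real. exp (- ((1/4) * u\<^sup>2)))" by (rule integrable_exp_neg_sq) simp
    have inv: "(\<lambda>n. u / sqrt (m n)) \<longlonglongrightarrow> 0" for u
      by (intro tendsto_divide_0[OF tendsto_const] filterlim_at_top_imp_at_infinity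
          filterlim_compose[OF sqrt_at_top m])
    have sq: "(\<lambda>n. sq_tent (u / sqrt (m n) - s)) \<longlonglongrightarrow> sq_tent (- s)" for u
      using isCont_tendsto_compose[of "-s" sq_tent "\<lambda>n. u / sqrt (m n) - s"]
        continuous_sq_tent[of UNIV] tendsto_diff[OF inv[of u] tendsto_const[of s]]
      by (simp add: continuous_on_eq_continuous_at)
    show "AE u in lborel. (\<lambda>n. ?g (n + n0) u) \<longlonglongrightarrow> complex_of_real (sq_tent (- s)) * of_real (exp (- (u\<^sup>2) / 2))"
    proof (intro AE_I2)
      fix u :: real
      have "(\<lambda>n. ?g n u) \<longlonglongrightarrow> complex_of_real (sq_tent (- s)) * of_real (exp (- (u\<^sup>2) / 2))"
        by (intro tendsto_mult tendsto_of_real sq) (use lim[of u] in simp)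
      then show "(\<lambda>n. ?g (n + n0) u) \<longlonglongrightarrow> complex_of_real (sq_tent (- s)) * of_real (exp (- (u\<^sup>2) / 2))"
        by (rule LIMSEQ_ignore_initial_segment)
    qed
    show "AE u in lborel. norm (?g (n + n0) u) \<le> exp (- ((1/4) * u\<^sup>2))" for n
    proof (intro AE_I2)
      fix u :: real
      let ?v = "u / sqrt (m (n + n0))"
      have mp: "m (n + n0) > 0" using n0(1) by simp
      show "norm (?g (n + n0) u) \<le> exp (- ((1/4) * u\<^sup>2))"
      proof (cases "\<bar>?v - s\<bar> \<le> 1")
        case True
        then have "\<bar>?v\<bar> \<le> \<bar>s\<bar> + 1" by linarith
        then have "cmod (\<phi> (n + n0) ?v) \<le> exp (- (m (n + n0) * ?v\<^sup>2 / 4))" by (intro n0(2)) auto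
        also have "m (n + n0) * ?v\<^sup>2 / 4 = (1/4) * u\<^sup>2" using mp by (simp add: power_divide)
        finally have *: "cmod (\<phi> (n + n0) ?v) \<le> exp (- ((1/4) * u\<^sup>2))" .
        have "norm (?g (n + n0) u) = sq_tent (?v - s) * cmod (\<phi> (n + n0) ?v)" by (simp add: norm_mult)
        also have "\<dots> \<le> 1 * exp (- ((1/4) * u\<^sup>2))" using * by (intro mult_mono) auto
        finally show ?thesis by simp
      qed (simp add: sq_tent_eq_0)
    qed
  qed auto
  moreover have "(CLBINT u. complex_of_real (sq_tent (- s)) * of_real (exp (- (u\<^sup>2) / 2))) = complex_of_real (sqrt (2 * pi) * sq_tent s)"
    by (simp only: integral_mult_right_zero integral_complex_of_real integral_exp_neg_sq of_real_mult sq_tent_minus mult.commute)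
  moreover have "(CLBINT u. ?g n u) = sqrt (m n) * (CLBINT t. sq_tent t * \<phi> n (s + t))" if "m n > 0" for n
    using that
    by (subst (2) lborel_integral_real_affine[where c = "1 / sqrt (m n)" and t = "- s"])
       (auto simp: scaleR_conv_of_real)
  then have "(\<lambda>n. CLBINT u. ?g (n + n0) u) = (\<lambda>n. sqrt (m (n + n0)) * (CLBINT t. sq_tent t * \<phi> (n + n0) (s + t)))"
    using n0(1) by (intro ext) simp
  ultimately have "(\<lambda>n. sqrt (m (n + n0)) * (CLBINT t. sq_tent t * \<phi> (n + n0) (s + t))) \<longlonglongrightarrow> complex_of_real (sqrt (2 * pi) * sq_tent s)"
    by (simp only:)
  then show ?thesis by (rule LIMSEQ_offset)
qed


text \<open>Fourier inversion, obtained by computing the same smoothed limit for centred normal laws of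
  growing variance in two ways.\<close>

lemma integral_sq_tent_ft_iexp: "(CLBINT z. sq_tent_ft z * iexp (s * z)) = 2 * pi * sq_tent s"
proof -
  define \<sigma> where "\<sigma> n = real (Suc n)" for n
  define N where "N n = distr std_normal_distribution borel (\<lambda>x. \<sigma> n * x)" for n
  interpret S: real_distribution std_normal_distribution by (rule real_dist_normal_dist)
  have \<sigma>_pos: "0 < \<sigma> n" for n by (simp add: \<sigma>_def)
  have rdN: "real_distribution (N n)" for n
    unfolding N_def by (rule S.real_distribution_distr) simp
  have char_N: "char (N n) t = exp (- ((\<sigma> n)\<^sup>2 * t\<^sup>2 / 2))" for n t
  proof -
    have "char (N n) t = char std_normal_distribution (\<sigma> n * t)"
      unfolding N_def char_def by (subst integral_distr) (auto simp: algebra_simps)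
    then show ?thesis by (simp add: char_std_normal_distribution power_mult_distrib)
  qed
  have m: "filterlim (\<lambda>n. (\<sigma> n)\<^sup>2) at_top sequentially"
    unfolding \<sigma>_def by (intro filterlim_pow_at_top filterlim_compose[OF filterlim_real_sequentially filterlim_Suc]) auto
  have lim: "(\<lambda>n. sqrt ((\<sigma> n)\<^sup>2) * (CLBINT t. sq_tent t * char (N n) (s + t)))
      \<longlonglongrightarrow> complex_of_real (sqrt (2 * pi) * sq_tent s)"
  proof (rule smoothed_char_limit[OF _ m])
    show "char (N n) \<in> borel_measurable borel" for n
    proof -
      interpret real_distribution "N n" by (rule rdN)
      show ?thesis by simp
    qed
    show "(\<lambda>n. char (N n) (u / sqrt ((\<sigma> n)\<^sup>2))) \<longlonglongrightarrow> complex_of_real (exp (- (u\<^sup>2) / 2))" for u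
      using \<sigma>_pos by (simp add: char_N power_divide less_imp_neq[THEN not_sym])
    show "\<forall>\<^sub>F n in sequentially. \<forall>t. \<bar>t\<bar> \<le> T \<longrightarrow> cmod (char (N n) t) \<le> exp (- ((\<sigma> n)\<^sup>2 * t\<^sup>2 / 4))" for T
      by (intro always_eventually allI impI) (simp add: char_N)
  qed
  have eq: "sqrt ((\<sigma> n)\<^sup>2) * (CLBINT t. sq_tent t * char (N n) (s + t)) =
      (CLBINT z. std_normal_density (z / \<sigma> n) * (sq_tent_ft z * iexp (s * z)))" for n
  proof -
    have "(CLBINT t. sq_tent t * char (N n) (s + t)) = (CLINT z|N n. sq_tent_ft z * iexp (s * z))"
      by (rule integral_sq_tent_ft_iexp_char[OF rdN, symmetric])
    also have "\<dots> = (CLBINT x. std_normal_density x *\<^sub>R (sq_tent_ft (\<sigma> n * x) * iexp (s * (\<sigma> n * x))))"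
      unfolding N_def by (subst integral_distr; (subst integral_density)?) auto
    finally show ?thesis
      using \<sigma>_pos[of n]
      by (subst lborel_integral_real_affine[where c = "\<sigma> n" and t = 0])
         (auto simp: scaleR_conv_of_real)
  qed
  \<comment> \<open>The second evaluation: the stretched normal density flattens to its value at 0,
    and the integrable transform dominates.\<close>
  have "(\<lambda>n. CLBINT z. std_normal_density (z / \<sigma> n) * (sq_tent_ft z * iexp (s * z)))
     \<longlonglongrightarrow> (CLBINT z. std_normal_density 0 * (sq_tent_ft z * iexp (s * z)))"
  proof (rule integral_dominated_convergence[where w = sq_tent_ft])
    have "(\<lambda>n. z / \<sigma> n) \<longlonglongrightarrow> 0" for z
      unfolding \<sigma>_def by (rule LIMSEQ_Suc[OF lim_const_over_n])
    moreover have "isCont std_normal_density 0"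
      unfolding std_normal_density_def by (intro continuous_intros) auto
    ultimately have "(\<lambda>n. std_normal_density (z / \<sigma> n)) \<longlonglongrightarrow> std_normal_density 0" for z
      by (rule isCont_tendsto_compose[rotated])
    then show "AE z in lborel. (\<lambda>n. std_normal_density (z / \<sigma> n) * (sq_tent_ft z * iexp (s * z)))
        \<longlonglongrightarrow> std_normal_density 0 * (sq_tent_ft z * iexp (s * z))"
      by (intro AE_I2 tendsto_mult tendsto_const tendsto_of_real)
    have le: "std_normal_density x \<le> 1" for x
    proof -
      have "1 / sqrt (2 * pi) * exp (- x\<^sup>2 / 2) \<le> 1 * 1"
        using pi_gt3 by (intro mult_mono) (auto simp: real_le_rsqrt)
      then show ?thesis by (simp add: std_normal_density_def)
    qed
    show "AE z in lborel. norm (std_normal_density (z / \<sigma> n) * (sq_tent_ft z * iexp (s * z))) \<le> sq_tent_ft z" for n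
      using le by (intro AE_I2) (auto simp: norm_mult intro!: mult_left_le_one_le)
  qed (auto intro: integrable_sq_tent_ft)
  with lim eq have "complex_of_real (std_normal_density 0) * (CLBINT z. sq_tent_ft z * iexp (s * z)) = complex_of_real (sqrt (2 * pi) * sq_tent s)"
    by (simp only: eq integral_mult_right_zero) (rule LIMSEQ_unique)
  then have "complex_of_real (sqrt (2 * pi) * (1 / sqrt (2 * pi))) * (CLBINT z. sq_tent_ft z * iexp (s * z)) = complex_of_real (sqrt (2 * pi) * (sqrt (2 * pi) * sq_tent s))"
    by (simp only: std_normal_density_def of_real_mult mult.assoc) simp
  then show ?thesis by (simp add: mult.assoc[symmetric] flip: of_real_mult)
qed

lemma integral_sq_tent_ft: "(LBINT z. sq_tent_ft z) = 2 * pi"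
proof -
  have "complex_of_real (LBINT z. sq_tent_ft z) = (CLBINT z. sq_tent_ft z)"
    by (rule integral_complex_of_real[symmetric])
  also have "\<dots> = complex_of_real (2 * pi)" using integral_sq_tent_ft_iexp[of 0] by simp
  finally show ?thesis by (simp only: of_real_eq_iff)
qed

text \<open>Dividing by the total masses turns the weighted measures into probability laws. Their
  characteristic functions converge to the tent, so Levy's continuity theorem gives weak
  convergence, which extends to bounded test functions with countably many discontinuities. The
  decay of the masses themselves is the case s = 0.\<close>

theorem local_limit:
  fixes N :: "nat \<Rightarrow> real measure" and f :: "real \<Rightarrow> real"
  assumes N: "\<And>n. real_distribution (N n)"
    and m: "filterlim m at_top sequentially"
    and lim: "\<And>u. (\<lambda>n. char (N n) (u / sqrt (m n))) \<longlonglongrightarrow> complex_of_real (exp (- (u\<^sup>2) / 2))"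
    and bound: "\<And>T. \<forall>\<^sub>F n in sequentially. \<forall>t. \<bar>t\<bar> \<le> T \<longrightarrow> cmod (char (N n) t) \<le> exp (- (m n * t\<^sup>2 / 4))"
    and [measurable]: "f \<in> borel_measurable borel" and f: "\<And>z. \<bar>f z\<bar> \<le> B"
    and disc: "countable {z. \<not> isCont f z}"
  shows "(\<lambda>n. sqrt (m n) * (LINT z|N n. sq_tent_ft z * f z)) \<longlonglongrightarrow> (LBINT z. sq_tent_ft z * f z) / sqrt (2 * pi)"
proof -
  interpret N: real_distribution "N n" for n by (rule N)
  define c where "c n = (LINT z|N n. sq_tent_ft z)" for n
  have intN: "integrable (N n) sq_tent_ft" for n
    by (rule N.integrable_const_bound[where B = 16]) (auto simp: sq_tent_ft_le_16)
  have c_pos: "0 < c n" for n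
  proof -
    have "0 \<le> c n" unfolding c_def by (simp add: integral_nonneg_AE)
    moreover have "c n \<noteq> 0"
    proof
      assume "c n = 0"
      then have "AE z in N n. sq_tent_ft z = 0"
        unfolding c_def by (subst (asm) integral_nonneg_eq_0_iff_AE) (auto intro: intN)
      then have "AE z in N n. False"
        by eventually_elim (use sq_tent_ft_pos less_irrefl in metis)
      then show False by simp
    qed
    ultimately show ?thesis by simp
  qed
  define L where "L n = density (N n) (\<lambda>z. ennreal (sq_tent_ft z / c n))" for n
  define L' where "L' = density lborel (\<lambda>z. ennreal (sq_tent_ft z / (2 * pi)))"
  have L: "real_distribution (L n)" for n
  proof -
    have "(\<integral>\<^sup>+z. ennreal (sq_tent_ft z / c n) \<partial>N n) = ennreal (LINT z|N n. sq_tent_ft z / c n)"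
      using c_pos[of n] intN by (intro nn_integral_eq_integral) (auto intro: less_imp_le)
    also have "(LINT z|N n. sq_tent_ft z / c n) = 1" using c_pos[of n] by (simp add: c_def[symmetric])
    finally show ?thesis
      by (intro real_distribution.intro prob_spaceI real_distribution_axioms.intro)
         (auto simp: L_def emeasure_density)
  qed
  have L': "real_distribution L'"
  proof -
    have "(\<integral>\<^sup>+z. ennreal (sq_tent_ft z / (2 * pi)) \<partial>lborel) = ennreal (LBINT z. sq_tent_ft z / (2 * pi))"
      using integrable_sq_tent_ft by (intro nn_integral_eq_integral) auto
    also have "(LBINT z. sq_tent_ft z / (2 * pi)) = 1" by (simp add: integral_sq_tent_ft)
    finally show ?thesis
      by (intro real_distribution.intro prob_spaceI real_distribution_axioms.intro)
         (auto simp: L'_def emeasure_density)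
  qed
  have int_L: "(LINT z|L n. g z) = (LINT z|N n. sq_tent_ft z *\<^sub>R g z) /\<^sub>R c n"
    if [measurable]: "g \<in> borel_measurable borel" for g :: "real \<Rightarrow> 'b::{banach, second_countable_topology}" and n
  proof -
    have "(LINT z|L n. g z) = (LINT z|N n. (sq_tent_ft z / c n) *\<^sub>R g z)"
      unfolding L_def using c_pos[of n] by (subst integral_density) (auto intro: less_imp_le)
    also have "\<dots> = (LINT z|N n. (1 / c n) *\<^sub>R (sq_tent_ft z *\<^sub>R g z))" by simp
    finally show ?thesis by (simp only: integral_scaleR_right inverse_eq_divide)
  qed
  have int_L': "(LINT z|L'. g z) = (LBINT z. sq_tent_ft z *\<^sub>R g z) /\<^sub>R (2 * pi)"
    if [measurable]: "g \<in> borel_measurable borel" for g :: "real \<Rightarrow> 'b::{banach, second_countable_topology}"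
  proof -
    have "(LINT z|L'. g z) = (LBINT z. (sq_tent_ft z / (2 * pi)) *\<^sub>R g z)"
      unfolding L'_def by (subst integral_density) auto
    also have "\<dots> = (LBINT z. (1 / (2 * pi)) *\<^sub>R (sq_tent_ft z *\<^sub>R g z))" by simp
    finally show ?thesis by (simp only: integral_scaleR_right inverse_eq_divide)
  qed
  have lim_s: "(\<lambda>n. sqrt (m n) * (CLINT z|N n. sq_tent_ft z * iexp (s * z))) \<longlonglongrightarrow> complex_of_real (sqrt (2 * pi) * sq_tent s)" for s
    unfolding integral_sq_tent_ft_iexp_char[OF N] by (intro smoothed_char_limit m lim bound) simp
  have "(\<lambda>n. complex_of_real (sqrt (m n) * c n)) \<longlonglongrightarrow> complex_of_real (sqrt (2 * pi))"
    using lim_s[of 0] by (simp add: c_def)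
  then have lim_c: "(\<lambda>n. sqrt (m n) * c n) \<longlonglongrightarrow> sqrt (2 * pi)"
    by (simp only: tendsto_of_real_iff)
  have m_pos: "\<forall>\<^sub>F n in sequentially. 0 < m n"
    using m by (simp add: filterlim_at_top_dense)
  have "weak_conv_m L L'"
  proof (rule levy_continuity[OF L L'])
    fix s :: real
    have "(\<lambda>n. (sqrt (m n) * (CLINT z|N n. sq_tent_ft z * iexp (s * z))) / complex_of_real (sqrt (m n) * c n))
        \<longlonglongrightarrow> complex_of_real (sqrt (2 * pi) * sq_tent s) / complex_of_real (sqrt (2 * pi))"
      by (intro tendsto_divide lim_s tendsto_of_real lim_c) auto
    moreover have "\<forall>\<^sub>F n in sequentially. (sqrt (m n) * (CLINT z|N n. sq_tent_ft z * iexp (s * z))) / complex_of_real (sqrt (m n) * c n) = char (L n) s"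
      using m_pos
    proof eventually_elim
      case (elim n)
      then show ?case
        unfolding char_def by (subst int_L) (auto simp: scaleR_conv_of_real divide_inverse)
    qed
    moreover have "char L' s = sq_tent s"
    proof -
      have "char L' s = (CLBINT z. sq_tent_ft z *\<^sub>R iexp (s * z)) /\<^sub>R (2 * pi)"
        unfolding char_def by (rule int_L') simp
      then show ?thesis by (simp only: scaleR_conv_of_real integral_sq_tent_ft_iexp) simp
    qed
    ultimately show "(\<lambda>n. char (L n) s) \<longlonglongrightarrow> char L' s"
      by (auto elim: Lim_transform_eventually)
  qed
  moreover have "L' {z. \<not> isCont f z} = 0"
  proof -
    have "{z. \<not> isCont f z} \<in> null_sets lborel" using disc by (rule countable_imp_null_set_lborel)
    then show ?thesis by (auto simp: L'_def emeasure_density null_sets_def nn_integral_null_set)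
  qed
  ultimately have "(\<lambda>n. LINT z|L n. f z) \<longlonglongrightarrow> (LINT z|L'. f z)"
    using f by (intro weak_conv_imp_bdd_ae_continuous_conv[OF L L', where B = B]) auto
  from tendsto_mult[OF lim_c this]
  have "(\<lambda>n. sqrt (m n) * c n * (LINT z|L n. f z)) \<longlonglongrightarrow> sqrt (2 * pi) * (LINT z|L'. f z)" .
  moreover have "sqrt (m n) * c n * (LINT z|L n. f z) = sqrt (m n) * (LINT z|N n. sq_tent_ft z * f z)" for n
    using c_pos[of n] by (simp add: int_L)
  moreover have "sqrt (2 * pi) * (LINT z|L'. f z) = (LBINT z. sq_tent_ft z * f z) / sqrt (2 * pi)"
  proof -
    \<comment> \<open>The limiting density carries 1 / (2 pi) and the masses carry sqrt (2 pi), so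
      one square root survives.\<close>
    have "k * (I /\<^sub>R (k * k)) = I / k" if "k > 0" for k I :: real
      using that by (simp add: field_simps)
    from this[of "sqrt (2 * pi)"] show ?thesis by (simp add: int_L')
  qed
  ultimately show ?thesis by simp
qed

section \<open>Slowly varying truncated variance\<close>

locale sv_truncated_variance = prob_space M for M :: "'a measure" +
  fixes \<xi> :: "'a \<Rightarrow> real"
  assumes measurable_xi [measurable]: "\<xi> \<in> borel_measurable M"
    and integrable_xi: "integrable M \<xi>"
    and slowly_varying: "slowly_varying (trunc_var M \<xi>)"
begin

abbreviation "V \<equiv> trunc_var M \<xi>"

definition Y :: "'a \<Rightarrow> real" where
  "Y \<omega> = \<xi> \<omega> - mean M \<xi>"

definition tail_moment :: "real \<Rightarrow> real" where
  "tail_moment h = (LINT \<omega>|M. \<bar>Y \<omega>\<bar> * indicator {h<..} \<bar>Y \<omega>\<bar>)"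

lemma measurable_Y [measurable]: "Y \<in> borel_measurable M"
  unfolding Y_def by measurable

lemma integrable_Y: "integrable M Y"
  unfolding Y_def using integrable_xi by simp

lemma integral_Y: "(LINT \<omega>|M. Y \<omega>) = 0"
  unfolding Y_def using integrable_xi by (simp add: mean_def prob_space)

lemma V_eq: "V h = (LINT \<omega>|M. (Y \<omega>)\<^sup>2 * indicator {..h} \<bar>Y \<omega>\<bar>)"
  by (simp add: trunc_var_def Y_def indicator_def)

lemma integrable_trunc_Y:
  assumes [measurable]: "f \<in> borel_measurable borel" and "\<And>y. \<bar>y\<bar> \<le> h \<Longrightarrow> \<bar>f y\<bar> \<le> (B::real)"
  shows "integrable M (\<lambda>\<omega>. f (Y \<omega>) * indicator {..h} \<bar>Y \<omega>\<bar>)"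
proof (rule integrable_const_bound[where B = "\<bar>B\<bar>"])
  show "AE \<omega> in M. norm (f (Y \<omega>) * indicator {..h} \<bar>Y \<omega>\<bar>) \<le> \<bar>B\<bar>"
  proof (intro AE_I2)
    fix \<omega> show "norm (f (Y \<omega>) * indicator {..h} \<bar>Y \<omega>\<bar>) \<le> \<bar>B\<bar>"
      using assms(2)[of "Y \<omega>"] by (auto simp: indicator_def)
  qed
qed simp

lemma integrable_trunc_sq: "integrable M (\<lambda>\<omega>. (Y \<omega>)\<^sup>2 * indicator {..h} \<bar>Y \<omega>\<bar>)"
  by (rule integrable_trunc_Y[of "\<lambda>y. y\<^sup>2" h "h\<^sup>2"]) (auto simp flip: abs_le_square_iff)

lemma integrable_trunc_cube: "integrable M (\<lambda>\<omega>. \<bar>Y \<omega>\<bar> ^ 3 * indicator {..h} \<bar>Y \<omega>\<bar>)"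
  using integrable_trunc_Y[of "\<lambda>y. \<bar>y\<bar> ^ 3" h "h ^ 3"] by (simp add: power_mono)

lemma integrable_tail_Y: "integrable M (\<lambda>\<omega>. \<bar>Y \<omega>\<bar> * indicator {h<..} \<bar>Y \<omega>\<bar>)"
  by (rule Bochner_Integration.integrable_bound[OF integrable_Y]) (auto simp: indicator_def)

lemma V_nonneg: "0 \<le> V h"
  unfolding V_eq by (intro integral_nonneg_AE AE_I2) auto

lemma V_mono: "h \<le> k \<Longrightarrow> V h \<le> V k"
  unfolding V_eq by (intro integral_mono integrable_trunc_sq) (auto simp: indicator_def)

lemma V_ratio: "0 < c \<Longrightarrow> ((\<lambda>h. V (c * h) / V h) \<longlongrightarrow> 1) at_top"
  using slowly_varying by (simp add: slowly_varying_def)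

lemma V_pos: "\<forall>\<^sub>F h in at_top. 0 < V h"
proof -
  have "\<forall>\<^sub>F h in at_top. 0 < V (1 * h) / V h"
    by (rule order_tendstoD(1)[OF V_ratio]) auto
  then show ?thesis
    by eventually_elim (use V_nonneg less_eq_real_def in fastforce)
qed

lemma V_scale_le: "0 < c \<Longrightarrow> 0 < \<epsilon> \<Longrightarrow> \<forall>\<^sub>F h in at_top. V (c * h) \<le> (1 + \<epsilon>) * V h"
  by (rule eventually_mp[OF _ eventually_conj[OF V_pos order_tendstoD(2)[OF V_ratio, of c "1 + \<epsilon>"]]])
     (auto intro!: always_eventually simp: field_simps)

lemma V_scale_ge: "0 < c \<Longrightarrow> 0 < \<epsilon> \<Longrightarrow> \<forall>\<^sub>F h in at_top. (1 - \<epsilon>) * V h \<le> V (c * h)"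
  by (rule eventually_mp[OF _ eventually_conj[OF V_pos order_tendstoD(1)[OF V_ratio, of c "1 - \<epsilon>"]]])
     (auto intro!: always_eventually simp: field_simps)

text \<open>For |y| <= h one has y^2 / h <= |y|, so the integrable |Y| dominates the
  quotient.\<close>

lemma V_over_tendsto_0: "((\<lambda>h. V h / h) \<longlongrightarrow> 0) at_top"
proof -
  have "((\<lambda>h. LINT \<omega>|M. (Y \<omega>)\<^sup>2 * indicator {..h} \<bar>Y \<omega>\<bar> / h) \<longlongrightarrow> (LINT \<omega>|M. 0)) at_top"
  proof (rule integral_dominated_convergence_at_top[where w = "\<lambda>\<omega>. \<bar>Y \<omega>\<bar>"])
    show "\<forall>\<^sub>F h in at_top. AE \<omega> in M. norm ((Y \<omega>)\<^sup>2 * indicator {..h} \<bar>Y \<omega>\<bar> / h) \<le> \<bar>Y \<omega>\<bar>"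
      using eventually_gt_at_top[of 0]
    proof eventually_elim
      case (elim h)
      have "y\<^sup>2 \<le> \<bar>y\<bar> * h" if "\<bar>y\<bar> \<le> h" for y :: real
        using mult_left_mono[OF that, of "\<bar>y\<bar>"] by (simp add: power2_eq_square)
      then show ?case using elim by (intro AE_I2) (auto simp: indicator_def field_simps)
    qed
    show "AE \<omega> in M. ((\<lambda>h. (Y \<omega>)\<^sup>2 * indicator {..h} \<bar>Y \<omega>\<bar> / h) \<longlongrightarrow> 0) at_top"
    proof (intro AE_I2)
      fix \<omega>
      have "((\<lambda>h. (Y \<omega>)\<^sup>2 / h) \<longlongrightarrow> 0) at_top"
        by (intro tendsto_divide_0[OF tendsto_const] filterlim_at_top_imp_at_infinity filterlim_ident)
      moreover have "\<forall>\<^sub>F h in at_top. (Y \<omega>)\<^sup>2 / h = (Y \<omega>)\<^sup>2 * indicator {..h} \<bar>Y \<omega>\<bar> / h"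
        using eventually_ge_at_top[of "\<bar>Y \<omega>\<bar>"] by eventually_elim simp
      ultimately show "((\<lambda>h. (Y \<omega>)\<^sup>2 * indicator {..h} \<bar>Y \<omega>\<bar> / h) \<longlongrightarrow> 0) at_top"
        by (rule Lim_transform_eventually)
    qed
  qed (auto intro: integrable_Y)
  then show ?thesis by (simp add: V_eq)
qed

lemma V_over_sq_tendsto_0: "((\<lambda>h. V h / h\<^sup>2) \<longlongrightarrow> 0) at_top"
proof -
  have "((\<lambda>h. V h / h * (1 / h)) \<longlongrightarrow> 0 * 0) at_top"
    by (intro tendsto_mult V_over_tendsto_0 tendsto_divide_0[OF tendsto_const]
        filterlim_at_top_imp_at_infinity filterlim_ident)
  then show ?thesis by (simp add: power2_eq_square)
qed

text \<open>Since V(2 s) <= 2 V(s) for large s, the quotient V(s) / s does not increase from s to 2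
  s; the factor 2 pays for the last incomplete doubling. Slow variation compares levels of fixed
  ratio, whereas this compares levels of unbounded ratio.\<close>

lemma V_over_quasi_decreasing:
  "\<exists>s0>0. \<forall>s\<ge>s0. \<forall>y\<ge>s. V y / y \<le> 2 * (V s / s)"
proof -
  obtain s0 where s0: "\<And>s. s \<ge> s0 \<Longrightarrow> V (2 * s) \<le> (1 + 1) * V s"
    using V_scale_le[of 2 1] by (auto simp: eventually_at_top_linorder)
  have "V y / y \<le> 2 * (V s / s)" if "s \<ge> max s0 1" "s \<le> y" "y \<le> 2 ^ k * s" for s y and k :: nat
    using that
  proof (induction k arbitrary: s)
    case 0
    then show ?case using V_nonneg[of s] by (auto intro!: divide_right_mono)
  next
    case (Suc k)
    have pos: "0 < s" "0 < y" using Suc.prems by auto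
    show ?case
    proof (cases "y \<le> 2 * s")
      case True
      have "V y / y \<le> 2 * V s / y" using V_mono[OF True] s0[of s] Suc.prems pos by (intro divide_right_mono) auto
      also have "\<dots> \<le> 2 * V s / s" using Suc.prems pos V_nonneg[of s] by (intro divide_left_mono mult_pos_pos) auto
      finally show ?thesis by simp
    next
      case False
      have "V y / y \<le> 2 * (V (2 * s) / (2 * s))" using Suc.prems False by (intro Suc.IH) auto
      also have "\<dots> \<le> 2 * V s / s" using s0[of s] Suc.prems pos by (simp add: field_simps)
      finally show ?thesis by simp
    qed
  qed
  moreover have "\<exists>k::nat. y \<le> 2 ^ k * s" if "s \<ge> 1" for s y :: real
  proof -
    obtain k :: nat where "y < 2 ^ k" using real_arch_pow[of 2 y] by auto
    also have "(2::real) ^ k \<le> 2 ^ k * s" using that by simp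
    finally show ?thesis by (auto intro: less_imp_le)
  qed
  ultimately show ?thesis
    by (intro exI[of _ "max s0 1"]) (auto, metis max.bounded_iff)
qed

lemma tail_moment_tendsto_0: "(tail_moment \<longlongrightarrow> 0) at_top"
proof -
  have "((\<lambda>h. LINT \<omega>|M. \<bar>Y \<omega>\<bar> * indicator {h<..} \<bar>Y \<omega>\<bar>) \<longlongrightarrow> (LINT \<omega>|M. 0)) at_top"
  proof (rule integral_dominated_convergence_at_top[where w = "\<lambda>\<omega>. \<bar>Y \<omega>\<bar>"])
    show "AE \<omega> in M. ((\<lambda>h. \<bar>Y \<omega>\<bar> * indicator {h<..} \<bar>Y \<omega>\<bar>) \<longlongrightarrow> 0) at_top"
    proof (intro AE_I2 tendsto_eventually)
      fix \<omega>
      show "\<forall>\<^sub>F h in at_top. \<bar>Y \<omega>\<bar> * indicator {h<..} \<bar>Y \<omega>\<bar> = 0"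
        using eventually_ge_at_top[of "\<bar>Y \<omega>\<bar>"] by eventually_elim simp
    qed
  qed (auto intro: integrable_Y simp: indicator_def)
  then show ?thesis by (simp add: tail_moment_def[abs_def])
qed

text \<open>On the shell h < |y| <= 2 h one has |y| <= y^2 / h, so the shell costs an increment of
  V, which slow variation makes small.\<close>

lemma tail_moment_double: "0 < h \<Longrightarrow> tail_moment h \<le> (V (2 * h) - V h) / h + tail_moment (2 * h)"
proof -
  assume h: "0 < h"
  have "tail_moment h \<le> (LINT \<omega>|M. (1 / h) * ((Y \<omega>)\<^sup>2 * indicator {..2 * h} \<bar>Y \<omega>\<bar> - (Y \<omega>)\<^sup>2 * indicator {..h} \<bar>Y \<omega>\<bar>)
      + \<bar>Y \<omega>\<bar> * indicator {2 * h<..} \<bar>Y \<omega>\<bar>)"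
    unfolding tail_moment_def
  proof (intro integral_mono integrable_tail_Y Bochner_Integration.integrable_add integrable_mult_right
      Bochner_Integration.integrable_diff integrable_trunc_sq)
    fix \<omega>
    have "\<bar>y\<bar> \<le> y\<^sup>2 / h" if "h < \<bar>y\<bar>" for y :: real
      using mult_left_mono[OF less_imp_le[OF that], of "\<bar>y\<bar>"] h by (simp add: power2_eq_square field_simps)
    then show "\<bar>Y \<omega>\<bar> * indicator {h<..} \<bar>Y \<omega>\<bar>
      \<le> 1 / h * ((Y \<omega>)\<^sup>2 * indicator {..2 * h} \<bar>Y \<omega>\<bar> - (Y \<omega>)\<^sup>2 * indicator {..h} \<bar>Y \<omega>\<bar>) + \<bar>Y \<omega>\<bar> * indicator {2 * h<..} \<bar>Y \<omega>\<bar>"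
      using h by (auto simp: indicator_def not_le)
  qed
  also have "\<dots> = (V (2 * h) - V h) / h + tail_moment (2 * h)"
    unfolding tail_moment_def V_eq
    by (subst Bochner_Integration.integral_add)
       (auto intro!: integrable_tail_Y integrable_trunc_sq Bochner_Integration.integrable_diff
         simp: Bochner_Integration.integral_diff[OF integrable_trunc_sq integrable_trunc_sq])
  finally show ?thesis .
qed

text \<open>Iteration over dyadic shells gives a geometric series: each step multiplies V(h) / h by
  at most (1 + e) / 2 <= 3 / 4, and the sum 4 of the series is the factor in \<open>iter\<close>.
  The leftover tail at 2^k h vanishes by integrability.\<close>

lemma tail_moment_le:
  assumes "0 < \<epsilon>"
  shows "\<forall>\<^sub>F h in at_top. tail_moment h \<le> \<epsilon> * (V h / h)"
proof -
  define e where "e = min (\<epsilon> / 4) (1 / 2)"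
  have e: "0 < e" "e \<le> 1 / 2" "4 * e \<le> \<epsilon>" using assms by (auto simp: e_def)
  obtain h0 where h0: "\<And>h. h \<ge> h0 \<Longrightarrow> V (2 * h) \<le> (1 + e) * V h"
    using V_scale_le[of 2 e] e by (auto simp: eventually_at_top_linorder)
  have iter: "tail_moment h \<le> 4 * e * (V h / h) + tail_moment (2 ^ k * h)" if "h \<ge> max h0 1" for h and k :: nat
    using that
  proof (induction k arbitrary: h)
    case 0
    then show ?case using e V_nonneg[of h] by simp
  next
    case (Suc k)
    have pos: "0 < h" using Suc.prems by simp
    have "tail_moment h \<le> (V (2 * h) - V h) / h + tail_moment (2 * h)"
      by (rule tail_moment_double[OF pos])
    also have "\<dots> \<le> e * V h / h + (4 * e * (V (2 * h) / (2 * h)) + tail_moment (2 ^ k * (2 * h)))"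
      using h0[of h] Suc.prems pos by (intro add_mono divide_right_mono Suc.IH) (auto simp: algebra_simps)
    also have "4 * e * (V (2 * h) / (2 * h)) \<le> 4 * e * ((1 + 1 / 2) * V h / (2 * h))"
      using h0[of h] Suc.prems pos e mult_right_mono[of "1 + e" "1 + 1/2" "V h"] V_nonneg[of h]
      by (intro mult_left_mono divide_right_mono) auto
    also have "e * V h / h + (4 * e * ((1 + 1 / 2) * V h / (2 * h)) + tail_moment (2 ^ k * (2 * h)))
        = 4 * e * (V h / h) + tail_moment (2 ^ Suc k * h)"
      using pos by (simp add: field_simps)
    finally show ?case by simp
  qed
  have "tail_moment h \<le> \<epsilon> * (V h / h)" if h: "h \<ge> max h0 1" for h
  proof -
    have "real k \<le> 2 ^ k * h" for k
    proof -
      have "real k \<le> 2 ^ k * 1" using of_nat_less_two_power[of k, where 'a = real] by simp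
      also have "\<dots> \<le> 2 ^ k * h" using h by (intro mult_left_mono) auto
      finally show ?thesis .
    qed
    then have "filterlim (\<lambda>k::nat. 2 ^ k * h) at_top sequentially"
      by (intro filterlim_at_top_mono[OF filterlim_real_sequentially always_eventually]) auto
    from filterlim_compose[OF tail_moment_tendsto_0 this]
    have "(\<lambda>k. 4 * e * (V h / h) + tail_moment (2 ^ k * h)) \<longlonglongrightarrow> 4 * e * (V h / h) + 0"
      by (intro tendsto_add tendsto_const)
    then have "tail_moment h \<le> 4 * e * (V h / h) + 0"
      by (rule LIMSEQ_le_const) (use iter[OF h] in auto)
    also have "\<dots> \<le> \<epsilon> * (V h / h)" using e h V_nonneg[of h] by (simp add: mult_right_mono divide_right_mono)
    finally show ?thesis .
  qed
  then show ?thesis unfolding eventually_at_top_linorder by blast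
qed

text \<open>Below d h the cube is at most d h y^2; between d h and h it is at most h y^2, and there
  slow variation leaves only V(h) - V(d h) <= d V(h). These are the two errors behind the
  requirement 2 d <= \<epsilon>.\<close>

lemma trunc_cube_le:
  assumes "0 < \<epsilon>"
  shows "\<forall>\<^sub>F h in at_top. (LINT \<omega>|M. \<bar>Y \<omega>\<bar> ^ 3 * indicator {..h} \<bar>Y \<omega>\<bar>) \<le> \<epsilon> * (h * V h)"
proof -
  define d where "d = min (\<epsilon> / 2) 1"
  have d: "0 < d" "d \<le> 1" "2 * d \<le> \<epsilon>" using assms by (auto simp: d_def)
  show ?thesis
    using V_scale_ge[OF d(1) d(1)] eventually_gt_at_top[of 0]
  proof eventually_elim
    case (elim h)
    have "(LINT \<omega>|M. \<bar>Y \<omega>\<bar> ^ 3 * indicator {..h} \<bar>Y \<omega>\<bar>) \<le> (LINT \<omega>|M. (d * h) * ((Y \<omega>)\<^sup>2 * indicator {..h} \<bar>Y \<omega>\<bar>)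
        + h * ((Y \<omega>)\<^sup>2 * indicator {..h} \<bar>Y \<omega>\<bar> - (Y \<omega>)\<^sup>2 * indicator {..d * h} \<bar>Y \<omega>\<bar>))"
    proof (intro integral_mono integrable_trunc_cube Bochner_Integration.integrable_add integrable_mult_right
        Bochner_Integration.integrable_diff integrable_trunc_sq)
      fix \<omega>
      have cube: "\<bar>y\<bar> ^ 3 \<le> b * y\<^sup>2" if "\<bar>y\<bar> \<le> b" for y b :: real
        using mult_right_mono[OF that, of "y\<^sup>2"] by (simp add: power2_eq_square power3_eq_cube abs_mult[symmetric])
      have dh: "d * h \<le> 1 * h" using d elim by (intro mult_right_mono) auto
      consider "\<bar>Y \<omega>\<bar> \<le> d * h" | "d * h < \<bar>Y \<omega>\<bar>" "\<bar>Y \<omega>\<bar> \<le> h" | "h < \<bar>Y \<omega>\<bar>" by linarith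
      then show "\<bar>Y \<omega>\<bar> ^ 3 * indicator {..h} \<bar>Y \<omega>\<bar> \<le> (d * h) * ((Y \<omega>)\<^sup>2 * indicator {..h} \<bar>Y \<omega>\<bar>)
        + h * ((Y \<omega>)\<^sup>2 * indicator {..h} \<bar>Y \<omega>\<bar> - (Y \<omega>)\<^sup>2 * indicator {..d * h} \<bar>Y \<omega>\<bar>)"
      proof cases
        case 1
        then have "\<bar>Y \<omega>\<bar> \<le> h" using dh by linarith
        then show ?thesis using 1 cube[OF 1] by simp
      next
        case 2
        then show ?thesis using cube[of "Y \<omega>" h] d elim by (auto intro: add_increasing)
      next
        case 3
        then have "d * h < \<bar>Y \<omega>\<bar>" using dh by linarith
        then show ?thesis using 3 by simp
      qed
    qed
    also have "\<dots> = d * h * V h + h * (V h - V (d * h))"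
      unfolding V_eq
      by (subst Bochner_Integration.integral_add)
         (auto intro!: integrable_trunc_sq Bochner_Integration.integrable_diff
           simp: Bochner_Integration.integral_diff[OF integrable_trunc_sq integrable_trunc_sq])
    also have "\<dots> \<le> d * h * V h + h * (d * V h)"
      using elim by (intro add_left_mono mult_left_mono) (auto simp: algebra_simps)
    also have "\<dots> = 2 * d * (h * V h)" by (simp add: algebra_simps)
    also have "\<dots> \<le> \<epsilon> * (h * V h)" using d elim V_nonneg[of h] by (intro mult_right_mono) auto
    finally show ?case .
  qed
qed

end

section \<open>Exponential moments of the truncated variable\<close>

lemma exp_taylor_bound: "\<bar>exp v - (\<Sum>k<n. v ^ k / fact k)\<bar> \<le> \<bar>v\<bar> ^ n / fact n * exp \<bar>v\<bar>" for v :: real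
proof -
  obtain t where t: "\<bar>t\<bar> \<le> \<bar>v\<bar>" "exp v = (\<Sum>k<n. v ^ k / fact k) + exp t / fact n * v ^ n"
    using Maclaurin_exp_le[of v n] by blast
  have "exp t \<le> exp \<bar>v\<bar>" using t(1) by auto
  then have "exp t * \<bar>v\<bar> ^ n / fact n \<le> exp \<bar>v\<bar> * \<bar>v\<bar> ^ n / fact n"
    by (intro divide_right_mono mult_right_mono) auto
  then show ?thesis using t(2) by (simp add: abs_mult power_abs mult.commute)
qed

text \<open>The common size of all Taylor remainders below; its mean at scale $h$ is negligible with respect to
  the truncated variance divided by $h^2$.\<close>

definition cubic_linear :: "real \<Rightarrow> real" where
  "cubic_linear u = (if \<bar>u\<bar> \<le> 1 then \<bar>u\<bar> ^ 3 else \<bar>u\<bar>)"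

lemma borel_measurable_cubic_linear [measurable]: "cubic_linear \<in> borel_measurable borel"
  unfolding cubic_linear_def[abs_def] by measurable

lemma cubic_linear_nonneg [simp]: "0 \<le> cubic_linear u"
  by (simp add: cubic_linear_def)

lemma cubic_linear_le: "cubic_linear u \<le> \<bar>u\<bar>"
proof (cases "\<bar>u\<bar> \<le> 1")
  case True
  then have "\<bar>u\<bar> ^ 3 \<le> \<bar>u\<bar> ^ 1" by (intro power_decreasing) auto
  then show ?thesis using True by (simp add: cubic_linear_def)
qed (simp add: cubic_linear_def)

lemma exp_le_27: "v \<le> 3 \<Longrightarrow> exp v \<le> (27::real)"
proof -
  assume "v \<le> 3"
  then have "exp v \<le> exp (3 * 1)" by simp
  also have "\<dots> = exp 1 ^ 3" using exp_of_nat_mult[of 3 "1::real"] by simp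
  also have "\<dots> \<le> 3 ^ 3" by (intro power_mono exp_le) auto
  finally show ?thesis by simp
qed

text \<open>This is the k-th power of a s / k <= exp (a s / k).\<close>

lemma power_exp_neg_bound:
  fixes s a :: real
  assumes "0 \<le> s" "0 < a" "k > 0"
  shows "s ^ k * exp (- (a * s)) \<le> (real k / a) ^ k"
proof -
  have "a * s / real k \<le> exp (a * s / real k)"
    using exp_ge_add_one_self[of "a * s / real k"] by linarith
  then have "(a * s / real k) ^ k \<le> exp (a * s / real k) ^ k"
    using assms by (intro power_mono) auto
  also have "\<dots> = exp (a * s)" using assms by (simp add: exp_of_nat_mult[symmetric])
  finally show ?thesis using assms by (simp add: power_divide power_mult_distrib exp_minus field_simps)
qed

lemma power_exp_neg_le:
  fixes s t :: real
  assumes "0 \<le> s" "1 / 2 \<le> t" "k > 0"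
  shows "s ^ k * exp (- (t * s)) \<le> (2 * real k) ^ k"
proof -
  have "s ^ k * exp (- (t * s)) \<le> (real k / t) ^ k"
    using assms by (intro power_exp_neg_bound) auto
  also have "\<dots> \<le> (real k / (1 / 2)) ^ k"
    using assms by (intro power_mono divide_left_mono) auto
  finally show ?thesis by (simp add: mult.commute)
qed

section \<open>Pointwise Taylor bounds for the truncated exponential\<close>

context
  fixes u b t :: real
  assumes t: "1 / 2 \<le> t" "t \<le> 2" and b: "1 / 2 \<le> b" "b \<le> 3 / 2"
begin

text \<open>The cut u <= b differs from |u| <= 1, the range of the second-order term. Where the two
  disagree, between b and 1 (\<open>border\<close>) or between 1 and b (\<open>pos\<close>),
  \<open>cubic_linear\<close> is bounded below and absorbs the discrepancy. For u < -1 the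
  exponential tames the powers of u, because t stays above 1 / 2.\<close>

lemma trunc_exp_cases:
  obtains (small) "\<bar>u\<bar> \<le> 1" "u \<le> b" "\<bar>t * u\<bar> \<le> 2 * \<bar>u\<bar>" "exp \<bar>t * u\<bar> \<le> 27" "cubic_linear u = \<bar>u\<bar> ^ 3"
  | (border) "b < u" "u \<le> 1" "1 / 8 \<le> cubic_linear u"
  | (neg) "u < - 1" "u \<le> b" "cubic_linear u = - u" "t * u \<le> 0" "exp (t * u) \<le> 1" "t * u \<ge> 2 * u"
      "u\<^sup>2 * exp (t * u) \<le> 4 * (- u)" "(- u) ^ 3 * exp (t * u) \<le> 100 * (- u)"
  | (pos) "1 < u" "u \<le> b" "cubic_linear u = u" "exp (t * u) \<le> 27" "0 < t * u" "t * u \<le> 2 * u"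
  | (large) "1 < u" "b < u" "cubic_linear u = u" "0 < t * u" "t * u \<le> 2 * u"
proof -
  have tu: "\<bar>t * u\<bar> \<le> 2 * \<bar>u\<bar>" using t by (simp add: abs_mult mult_right_mono)
  consider "\<bar>u\<bar> \<le> 1" "u \<le> b" | "b < u" "u \<le> 1" | "u < - 1" | "1 < u" "u \<le> b" | "1 < u" "b < u"
    by linarith
  then show ?thesis
  proof cases
    case 1
    then have "exp \<bar>t * u\<bar> \<le> 27" using tu by (intro exp_le_27) linarith
    then show ?thesis using 1 tu by (intro small) (auto simp: cubic_linear_def)
  next
    case 2
    have "(1 / 2) ^ 3 \<le> u ^ 3" using 2 b by (intro power_mono) auto
    then show ?thesis using 2 b by (intro border) (auto simp: cubic_linear_def power3_eq_cube)
  next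
    case 3
    have "(- u) ^ 1 * exp (- (t * (- u))) \<le> (2 * real 1) ^ 1"
      using 3 t by (intro power_exp_neg_le) auto
    then have e1: "(- u) * exp (t * u) \<le> 2" by simp
    have "(- u) ^ 2 * exp (- (t * (- u))) \<le> (2 * real 2) ^ 2"
      using 3 t by (intro power_exp_neg_le) auto
    then have e2: "u\<^sup>2 * exp (t * u) \<le> 16" by simp
    have "t * u \<le> 0" "2 * u \<le> t * u" using 3 t by (auto simp: mult_nonneg_nonpos intro: mult_right_mono_neg)
    then show ?thesis
      using 3 b mult_left_mono[OF e1, of "-u"] mult_left_mono[OF e2, of "-u"]
      by (intro neg) (auto simp: cubic_linear_def power2_eq_square power3_eq_cube algebra_simps)
  next
    case 4
    have "t * u \<le> 2 * (3 / 2)" using 4 b t by (intro mult_mono) auto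
    then have "exp (t * u) \<le> 27" by (intro exp_le_27) simp
    then show ?thesis using 4 tu t by (intro pos) (auto simp: cubic_linear_def)
  next
    case 5
    then show ?thesis using tu t by (intro large) (auto simp: cubic_linear_def)
  qed
qed

text \<open>The linear term is left untruncated because its mean is exactly zero; the quadratic one
  is truncated at |u| <= 1 because its mean is then exactly V(h) / h^2. The factor 100 is a round
  bound common to all cases and orders.\<close>

lemma trunc_exp_0:
  "\<bar>indicator {..b} u * exp (t * u) - 1 - t * u - t\<^sup>2 / 2 * (u\<^sup>2 * indicator {..1} \<bar>u\<bar>)\<bar> \<le> 100 * cubic_linear u"
proof (cases rule: trunc_exp_cases)
  case small
  have "\<bar>t * u\<bar> ^ 3 / fact 3 * exp \<bar>t * u\<bar> \<le> (2 * \<bar>u\<bar>) ^ 3 / fact 3 * 27"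
    using small by (intro mult_mono divide_right_mono power_mono) auto
  also have "\<dots> = 36 * \<bar>u\<bar> ^ 3" by (simp add: fact_numeral power_mult_distrib)
  also have "\<dots> \<le> 100 * \<bar>u\<bar> ^ 3" by (intro mult_right_mono) auto
  finally have "\<bar>t * u\<bar> ^ 3 / fact 3 * exp \<bar>t * u\<bar> \<le> 100 * \<bar>u\<bar> ^ 3" .
  moreover have "(\<Sum>k<3. (t * u) ^ k / fact k) = 1 + t * u + t\<^sup>2 / 2 * u\<^sup>2"
    by (simp add: eval_nat_numeral)
  ultimately have "\<bar>exp (t * u) - (1 + t * u + t\<^sup>2 / 2 * u\<^sup>2)\<bar> \<le> 100 * \<bar>u\<bar> ^ 3"
    using exp_taylor_bound[of "t * u" 3] by linarith
  then show ?thesis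
    using small by (simp add: diff_diff_eq)
next
  case border
  have "t * u \<le> 2 * 1" using border t b by (intro mult_mono) auto
  moreover have "0 \<le> t * u" using border t b by simp
  moreover have "t\<^sup>2 / 2 * u\<^sup>2 \<le> 2\<^sup>2 / 2 * 1\<^sup>2" using border t b by (intro mult_mono divide_right_mono power_mono) auto
  moreover have "0 \<le> t\<^sup>2 / 2 * u\<^sup>2" by simp
  ultimately have "\<bar>1 + t * u + t\<^sup>2 / 2 * u\<^sup>2\<bar> \<le> 5" by simp
  also have "5 \<le> 100 * cubic_linear u" using border by simp
  finally have "\<bar>1 + t * u + t\<^sup>2 / 2 * u\<^sup>2\<bar> \<le> 100 * cubic_linear u" .
  moreover have "indicator {..b} u * exp (t * u) - 1 - t * u - t\<^sup>2 / 2 * (u\<^sup>2 * indicator {..1} \<bar>u\<bar>)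
      = - (1 + t * u + t\<^sup>2 / 2 * u\<^sup>2)"
    using border b by simp
  ultimately show ?thesis by (simp only: abs_minus_cancel)
next
  case neg
  have "indicator {..b} u * exp (t * u) - 1 - t * u - t\<^sup>2 / 2 * (u\<^sup>2 * indicator {..1} \<bar>u\<bar>) = exp (t * u) - 1 - t * u"
    using neg by simp
  moreover have "\<bar>exp (t * u) - 1 - t * u\<bar> \<le> 100 * cubic_linear u" using neg exp_gt_zero[of "t * u"] by linarith
  ultimately show ?thesis by (simp only:)
next
  case pos
  have "indicator {..b} u * exp (t * u) - 1 - t * u - t\<^sup>2 / 2 * (u\<^sup>2 * indicator {..1} \<bar>u\<bar>) = exp (t * u) - 1 - t * u"
    using pos by simp
  moreover have "\<bar>exp (t * u) - 1 - t * u\<bar> \<le> 100 * cubic_linear u" using pos exp_gt_zero[of "t * u"] by linarith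
  ultimately show ?thesis by (simp only:)
next
  case large
  have "indicator {..b} u * exp (t * u) - 1 - t * u - t\<^sup>2 / 2 * (u\<^sup>2 * indicator {..1} \<bar>u\<bar>) = - 1 - t * u"
    using large by simp
  moreover have "\<bar>- 1 - t * u\<bar> \<le> 100 * cubic_linear u" using large by linarith
  ultimately show ?thesis by (simp only:)
qed

lemma trunc_exp_1:
  "\<bar>indicator {..b} u * (u * exp (t * u)) - u - t * (u\<^sup>2 * indicator {..1} \<bar>u\<bar>)\<bar> \<le> 100 * cubic_linear u"
proof (cases rule: trunc_exp_cases)
  case small
  have "\<bar>t * u\<bar> ^ 2 / fact 2 * exp \<bar>t * u\<bar> \<le> (2 * \<bar>u\<bar>) ^ 2 / fact 2 * 27"
    using small by (intro mult_mono divide_right_mono power_mono) auto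
  moreover have "(\<Sum>k<2. (t * u) ^ k / fact k) = 1 + t * u"
    by (simp add: eval_nat_numeral)
  ultimately have "\<bar>exp (t * u) - 1 - t * u\<bar> \<le> 54 * \<bar>u\<bar>\<^sup>2"
    using exp_taylor_bound[of "t * u" 2] by (simp add: power_mult_distrib algebra_simps)
  then have "\<bar>u\<bar> * \<bar>exp (t * u) - 1 - t * u\<bar> \<le> \<bar>u\<bar> * (54 * \<bar>u\<bar>\<^sup>2)" by (rule mult_left_mono) simp
  also have "\<bar>u\<bar> * \<bar>exp (t * u) - 1 - t * u\<bar> = \<bar>u * exp (t * u) - u - t * u\<^sup>2\<bar>"
    by (simp only: abs_mult[symmetric]) (simp add: algebra_simps power2_eq_square)
  finally have "\<bar>u * exp (t * u) - u - t * u\<^sup>2\<bar> \<le> 54 * \<bar>u\<bar> ^ 3"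
    by (simp add: power2_eq_square power3_eq_cube)
  moreover have "54 * \<bar>u\<bar> ^ 3 \<le> 100 * \<bar>u\<bar> ^ 3" by simp
  ultimately show ?thesis using small by simp
next
  case border
  have "t * u\<^sup>2 \<le> 2 * 1\<^sup>2" using border t b by (intro mult_mono power_mono) auto
  moreover have "0 \<le> t * u\<^sup>2" using t by simp
  ultimately show ?thesis using border b by (simp add: abs_if)
next
  case neg
  have "u * exp (t * u) \<le> 0" "u * 1 \<le> u * exp (t * u)" using neg by (auto intro: mult_left_mono_neg simp: mult_nonpos_nonneg)
  then show ?thesis using neg by (simp add: abs_if)
next
  case pos
  have "0 \<le> u * exp (t * u)" "u * exp (t * u) \<le> u * 27" using pos by (auto intro!: mult_left_mono)
  then show ?thesis using pos by (simp add: abs_if)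
next
  case large
  then show ?thesis by (simp add: abs_if)
qed

lemma trunc_exp_2:
  "\<bar>indicator {..b} u * (u\<^sup>2 * exp (t * u)) - u\<^sup>2 * indicator {..1} \<bar>u\<bar>\<bar> \<le> 100 * cubic_linear u"
proof (cases rule: trunc_exp_cases)
  case small
  have "\<bar>t * u\<bar> ^ 1 / fact 1 * exp \<bar>t * u\<bar> \<le> (2 * \<bar>u\<bar>) ^ 1 / fact 1 * 27"
    using small by (intro mult_mono divide_right_mono power_mono) auto
  then have "\<bar>exp (t * u) - 1\<bar> \<le> 54 * \<bar>u\<bar>"
    using exp_taylor_bound[of "t * u" 1] by simp
  then have "u\<^sup>2 * \<bar>exp (t * u) - 1\<bar> \<le> u\<^sup>2 * (54 * \<bar>u\<bar>)" by (rule mult_left_mono) simp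
  also have "u\<^sup>2 * \<bar>exp (t * u) - 1\<bar> = \<bar>u\<^sup>2 * exp (t * u) - u\<^sup>2\<bar>"
    using abs_mult[of "u\<^sup>2" "exp (t * u) - 1"] by (simp add: algebra_simps)
  also have "u\<^sup>2 * (54 * \<bar>u\<bar>) = 54 * \<bar>u\<bar> ^ 3"
  proof -
    have "s\<^sup>2 * (54 * s) = 54 * s ^ 3" for s :: real by (simp add: power2_eq_square power3_eq_cube)
    from this[of "\<bar>u\<bar>"] show ?thesis by simp
  qed
  also have "\<dots> \<le> 100 * \<bar>u\<bar> ^ 3" by (intro mult_right_mono) auto
  finally show ?thesis using small by simp
next
  case border
  have "u\<^sup>2 \<le> 1\<^sup>2" using border b by (intro power_mono) auto
  then show ?thesis using border b by simp
next
  case neg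
  then show ?thesis by simp
next
  case pos
  have "u * u \<le> u * (3 / 2)" using pos b by (intro mult_left_mono) auto
  then have "u\<^sup>2 * exp (t * u) \<le> (u * (3 / 2)) * 27" using pos by (intro mult_mono) (auto simp: power2_eq_square)
  then show ?thesis using pos by simp
next
  case large
  then show ?thesis by simp
qed

lemma trunc_exp_3:
  "indicator {..b} u * (\<bar>u\<bar> ^ 3 * exp (t * u)) \<le> 100 * cubic_linear u"
proof (cases rule: trunc_exp_cases)
  case small
  have "exp (t * u) \<le> exp \<bar>t * u\<bar>" by simp
  then have "exp (t * u) \<le> 100" using small by linarith
  then have "\<bar>u\<bar> ^ 3 * exp (t * u) \<le> \<bar>u\<bar> ^ 3 * 100" by (intro mult_left_mono) auto
  then show ?thesis using small by simp
next
  case pos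
  have "u ^ 2 \<le> (3 / 2) ^ 2" using pos b by (intro power_mono) auto
  then have "u * u\<^sup>2 \<le> u * (9 / 4)" using pos by (intro mult_left_mono) (auto simp: power2_eq_square)
  then have "u ^ 3 * exp (t * u) \<le> (u * (9 / 4)) * 27"
    using pos by (intro mult_mono) (auto simp: power2_eq_square power3_eq_cube)
  then show ?thesis using pos by simp
qed auto

text \<open>Boundedness supplies integrability up to the third power, although only the first moment
  of Y is known to be finite. The bound exceeds 6^3 = 216, reached for u < -1, and 27 * 27 / 8,
  reached on [-1, b].\<close>

lemma trunc_exp_bounded:
  assumes "k \<le> 3"
  shows "indicator {..b} u * (\<bar>u\<bar> ^ k * exp (t * u)) \<le> 300"
proof (cases "- 1 \<le> u \<and> u \<le> b")
  case True
  have "\<bar>u\<bar> ^ k \<le> (3 / 2) ^ k" using True b by (intro power_mono) auto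
  also have "\<dots> \<le> (3 / 2) ^ 3" using assms by (intro power_increasing) auto
  finally have 1: "\<bar>u\<bar> ^ k \<le> 27 / 8" by (simp add: power3_eq_cube)
  have "t * u \<le> 2 * (3 / 2)" 
  proof (cases "0 \<le> u")
    case True
    then show ?thesis using \<open>- 1 \<le> u \<and> u \<le> b\<close> t b by (intro mult_mono) auto
  next
    case False
    then have "t * u \<le> 0" using t by (intro mult_nonneg_nonpos) auto
    then show ?thesis by simp
  qed
  then have "exp (t * u) \<le> 27" by (intro exp_le_27) simp
  with 1 have "\<bar>u\<bar> ^ k * exp (t * u) \<le> 27 / 8 * 27" by (intro mult_mono) auto
  then show ?thesis using True by simp
next
  case False
  show ?thesis
  proof (cases "u \<le> b")
    case True
    then have u: "u < - 1" using False by simp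
    have "\<bar>u\<bar> ^ k \<le> \<bar>u\<bar> ^ 3" using u assms by (intro power_increasing) auto
    then have "\<bar>u\<bar> ^ k * exp (t * u) \<le> \<bar>u\<bar> ^ 3 * exp (- (t * \<bar>u\<bar>))" using u by (intro mult_mono) auto
    also have "\<dots> \<le> (2 * real 3) ^ 3" using t by (intro power_exp_neg_le) auto
    finally show ?thesis using True by simp
  qed simp
qed

end

section \<open>Moments of the tilted truncated variable\<close>

context sv_truncated_variance
begin

text \<open>The cut acts on \<open>\<xi>\<close> itself, because the maximum is taken over uncentred
  variables, while the weight is centred.\<close>

definition trunc_exp_moment :: "nat \<Rightarrow> real \<Rightarrow> real \<Rightarrow> real" where
  "trunc_exp_moment k h t = (LINT \<omega>|M. indicator {..h} (\<xi> \<omega>) * ((Y \<omega> / h) ^ k * exp (t * (Y \<omega> / h))))"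

definition trunc_exp_abs3 :: "real \<Rightarrow> real \<Rightarrow> real" where
  "trunc_exp_abs3 h t = (LINT \<omega>|M. indicator {..h} (\<xi> \<omega>) * (\<bar>Y \<omega> / h\<bar> ^ 3 * exp (t * (Y \<omega> / h))))"

definition remainder :: "real \<Rightarrow> real" where
  "remainder h = (LINT \<omega>|M. cubic_linear (Y \<omega> / h))"

lemma integrable_cubic_linear: "integrable M (\<lambda>\<omega>. cubic_linear (Y \<omega> / h))"
proof (rule Bochner_Integration.integrable_bound)
  show "integrable M (\<lambda>\<omega>. Y \<omega> / h)" using integrable_Y by simp
  show "AE \<omega> in M. norm (cubic_linear (Y \<omega> / h)) \<le> norm (Y \<omega> / h)"
    using cubic_linear_le[of "Y _ / h"] by auto
qed simp

lemma remainder_nonneg: "0 \<le> remainder h"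
  unfolding remainder_def by (intro integral_nonneg_AE AE_I2) simp

text \<open>After division by h^3 and by h respectively, the truncated third moment and the tail
  moment are both negligible against V(h) / h^2. This is where slow variation enters the Taylor
  expansions.\<close>

lemma remainder_le:
  assumes "0 < \<epsilon>"
  shows "\<forall>\<^sub>F h in at_top. remainder h \<le> \<epsilon> * (V h / h\<^sup>2)"
proof -
  have e: "0 < \<epsilon> / 2" using assms by simp
  show ?thesis
    using trunc_cube_le[OF e] tail_moment_le[OF e] eventually_gt_at_top[of 0]
  proof eventually_elim
    case (elim h)
    have "remainder h = (LINT \<omega>|M. (1 / h ^ 3) * (\<bar>Y \<omega>\<bar> ^ 3 * indicator {..h} \<bar>Y \<omega>\<bar>)
        + (1 / h) * (\<bar>Y \<omega>\<bar> * indicator {h<..} \<bar>Y \<omega>\<bar>))"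
      unfolding remainder_def using elim
      by (intro Bochner_Integration.integral_cong refl)
         (auto simp: cubic_linear_def power_divide indicator_def)
    also have "\<dots> = (1 / h ^ 3) * (LINT \<omega>|M. \<bar>Y \<omega>\<bar> ^ 3 * indicator {..h} \<bar>Y \<omega>\<bar>) + (1 / h) * tail_moment h"
      unfolding tail_moment_def
      by (subst Bochner_Integration.integral_add) (auto intro!: integrable_trunc_cube integrable_tail_Y integrable_mult_right
          simp del: times_divide_eq_left)
    also have "\<dots> \<le> (1 / h ^ 3) * (\<epsilon> / 2 * (h * V h)) + (1 / h) * (\<epsilon> / 2 * (V h / h))"
      using elim by (intro add_mono mult_left_mono) auto
    also have "\<dots> = \<epsilon> * (V h / h\<^sup>2)" using elim by (simp add: field_simps power2_eq_square power3_eq_cube)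
    finally show ?case .
  qed
qed

context
  fixes h t :: real
  assumes h: "2 * \<bar>mean M \<xi>\<bar> + 1 \<le> h" and t: "1 / 2 \<le> t" "t \<le> 2"
begin

text \<open>The cut \<open>\<xi> \<le> h\<close> on the scale of \<open>U\<close>; the lower bound
  on h keeps it in [1/2, 3/2].\<close>

private definition "b = (h - mean M \<xi>) / h"

private definition "U \<omega> = Y \<omega> / h"

private lemma [measurable]: "U \<in> borel_measurable M"
  unfolding U_def[abs_def] by measurable

private lemma integrable_U: "integrable M U"
  unfolding U_def[abs_def] using integrable_Y by simp

private lemma integral_U: "(LINT \<omega>|M. U \<omega>) = 0"
  unfolding U_def by (simp add: integral_Y)

private lemma h_pos: "0 < h" using h by linarith

private lemma b: "1 / 2 \<le> b" "b \<le> 3 / 2"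
  using h h_pos by (auto simp: b_def field_simps)

private lemma indicator_eq: "indicator {..h} (\<xi> \<omega>) = indicator {..b} (U \<omega>)"
  using h_pos by (auto simp: indicator_def b_def U_def Y_def divide_simps)

private lemma indicator_eq': "indicator {..1} \<bar>U \<omega>\<bar> = indicator {..h} \<bar>Y \<omega>\<bar>"
  using h_pos by (auto simp: indicator_def U_def)

private lemma integrable_trunc_exp_U:
  assumes "k \<le> 3"
  shows "integrable M (\<lambda>\<omega>. indicator {..h} (\<xi> \<omega>) * (\<bar>U \<omega>\<bar> ^ k * exp (t * U \<omega>)))"
    and "integrable M (\<lambda>\<omega>. indicator {..h} (\<xi> \<omega>) * ((U \<omega>) ^ k * exp (t * U \<omega>)))"
proof -
  have *: "AE \<omega> in M. norm (indicator {..h} (\<xi> \<omega>) * (\<bar>U \<omega>\<bar> ^ k * exp (t * U \<omega>))) \<le> 300"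
    using trunc_exp_bounded[OF t b assms] by (simp add: indicator_eq)
  show "integrable M (\<lambda>\<omega>. indicator {..h} (\<xi> \<omega>) * (\<bar>U \<omega>\<bar> ^ k * exp (t * U \<omega>)))"
    by (rule integrable_const_bound[OF *]) simp
  show "integrable M (\<lambda>\<omega>. indicator {..h} (\<xi> \<omega>) * ((U \<omega>) ^ k * exp (t * U \<omega>)))"
    by (rule integrable_const_bound[where B = 300]) (use * in \<open>auto simp: abs_mult power_abs\<close>)
qed

lemmas integrable_trunc_exp = integrable_trunc_exp_U[unfolded U_def]

private lemma q_eq: "V h / h\<^sup>2 = (LINT \<omega>|M. (U \<omega>)\<^sup>2 * indicator {..1} \<bar>U \<omega>\<bar>)"
  unfolding indicator_eq' V_eq by (simp add: power_divide U_def)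

private lemma integrable_q: "integrable M (\<lambda>\<omega>. (U \<omega>)\<^sup>2 * indicator {..1} \<bar>U \<omega>\<bar>)"
  unfolding indicator_eq' using integrable_trunc_sq[of h] by (simp add: power_divide U_def)

private lemma integral_diff_bound:
  assumes "integrable M f" "integrable M g" "\<And>\<omega>. \<bar>f \<omega> - g \<omega>\<bar> \<le> 100 * cubic_linear (U \<omega>)"
  shows "\<bar>(LINT \<omega>|M. f \<omega>) - (LINT \<omega>|M. g \<omega>)\<bar> \<le> 100 * remainder h"
proof -
  have "\<bar>LINT \<omega>|M. f \<omega> - g \<omega>\<bar> \<le> (LINT \<omega>|M. 100 * cubic_linear (U \<omega>))"
    using assms by (intro integral_abs_bound[THEN order_trans] integral_mono integrable_abs
        Bochner_Integration.integrable_diff integrable_mult_right integrable_cubic_linear[of h, folded U_def]) auto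
  then show ?thesis using assms by (simp add: remainder_def U_def)
qed

lemma trunc_exp_moment_0: "\<bar>trunc_exp_moment 0 h t - (1 + t\<^sup>2 / 2 * (V h / h\<^sup>2))\<bar> \<le> 100 * remainder h"
proof -
  have "(LINT \<omega>|M. (1 + t * (U \<omega>)) + t\<^sup>2 / 2 * ((U \<omega>)\<^sup>2 * indicator {..1} \<bar>U \<omega>\<bar>)) = 1 + t\<^sup>2 / 2 * (V h / h\<^sup>2)"
    unfolding q_eq using integrable_q integrable_U
    by (subst Bochner_Integration.integral_add) (auto simp: integral_U prob_space)
  moreover have "\<bar>trunc_exp_moment 0 h t - (LINT \<omega>|M. (1 + t * (U \<omega>)) + t\<^sup>2 / 2 * ((U \<omega>)\<^sup>2 * indicator {..1} \<bar>U \<omega>\<bar>))\<bar> \<le> 100 * remainder h"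
    unfolding trunc_exp_moment_def U_def[symmetric]
    by (rule integral_diff_bound)
       (use integrable_trunc_exp_U(2)[of 0] integrable_q integrable_U trunc_exp_0[OF t b] in
         \<open>auto simp: indicator_eq diff_diff_eq intro!: Bochner_Integration.integrable_add\<close>)
  ultimately show ?thesis by simp
qed

text \<open>The mean of U vanishes, so the drift t V(h) / h^2 per summand comes from the tilt alone;
  equating it with the target mean determines t to first order.\<close>

lemma trunc_exp_moment_1: "\<bar>trunc_exp_moment 1 h t - t * (V h / h\<^sup>2)\<bar> \<le> 100 * remainder h"
proof -
  have "(LINT \<omega>|M. U \<omega> + t * ((U \<omega>)\<^sup>2 * indicator {..1} \<bar>U \<omega>\<bar>)) = t * (V h / h\<^sup>2)"
    unfolding q_eq using integrable_q integrable_U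
    by (subst Bochner_Integration.integral_add) (auto simp: integral_U prob_space)
  moreover have "\<bar>trunc_exp_moment 1 h t - (LINT \<omega>|M. U \<omega> + t * ((U \<omega>)\<^sup>2 * indicator {..1} \<bar>U \<omega>\<bar>))\<bar> \<le> 100 * remainder h"
    unfolding trunc_exp_moment_def U_def[symmetric]
    by (rule integral_diff_bound)
       (use integrable_trunc_exp_U(2)[of 1] integrable_q integrable_U trunc_exp_1[OF t b] in
         \<open>auto simp: indicator_eq diff_diff_eq intro!: Bochner_Integration.integrable_add\<close>)
  ultimately show ?thesis by simp
qed

lemma trunc_exp_moment_2: "\<bar>trunc_exp_moment 2 h t - V h / h\<^sup>2\<bar> \<le> 100 * remainder h"
  unfolding trunc_exp_moment_def q_eq U_def[symmetric]
  by (rule integral_diff_bound)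
     (use integrable_trunc_exp_U(2)[of 2] integrable_q trunc_exp_2[OF t b] in \<open>auto simp: indicator_eq\<close>)

lemma trunc_exp_abs3_le: "trunc_exp_abs3 h t \<le> 100 * remainder h"
proof -
  have "trunc_exp_abs3 h t \<le> (LINT \<omega>|M. 100 * cubic_linear (U \<omega>))"
    unfolding trunc_exp_abs3_def U_def[symmetric]
    by (intro integral_mono integrable_trunc_exp_U integrable_mult_right integrable_cubic_linear[of h, folded U_def])
       (use trunc_exp_3[OF t b] in \<open>auto simp: indicator_eq\<close>)
  then show ?thesis by (simp add: remainder_def U_def)
qed

end

end

text \<open>In the unit disc |p^n - q^n| <= n |p - q|, so at s = u / sqrt (n v) the cubic error
  contributes n |s|^3 \<gamma>, of order (\<gamma> / v) / sqrt (n v). For bounded t the same error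
  is at most t^2 v / 4, which leaves 1 - t^2 v / 4 <= exp (- t^2 v / 4).\<close>

lemma char_power_gaussian:
  fixes \<psi> :: "nat \<Rightarrow> real \<Rightarrow> complex" and v \<gamma> :: "nat \<Rightarrow> real"
  assumes approx: "\<forall>\<^sub>F n in sequentially. \<forall>s. cmod (\<psi> n s - of_real (1 - s\<^sup>2 * v n / 2)) \<le> \<bar>s\<bar> ^ 3 * \<gamma> n"
    and le1: "\<forall>\<^sub>F n in sequentially. \<forall>s. cmod (\<psi> n s) \<le> 1"
    and v_pos: "\<forall>\<^sub>F n in sequentially. 0 < v n"
    and v_0: "v \<longlonglongrightarrow> 0"
    and \<gamma>: "(\<lambda>n. \<gamma> n / v n) \<longlonglongrightarrow> 0"
    and m: "filterlim (\<lambda>n. real n * v n) at_top sequentially"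
  shows "(\<lambda>n. \<psi> n (u / sqrt (real n * v n)) ^ n) \<longlonglongrightarrow> complex_of_real (exp (- (u\<^sup>2) / 2))"
    and "\<forall>\<^sub>F n in sequentially. \<forall>t. \<bar>t\<bar> \<le> T \<longrightarrow> cmod (\<psi> n t ^ n) \<le> exp (- (real n * v n * t\<^sup>2 / 4))"
proof -
  have "(\<lambda>n. (1 + (- (u\<^sup>2) / 2) / real n) ^ n) \<longlonglongrightarrow> exp (- (u\<^sup>2) / 2)"
    by (rule tendsto_exp_limit_sequentially)
  then have lim: "(\<lambda>n. complex_of_real ((1 + (- (u\<^sup>2) / 2) / real n) ^ n)) \<longlonglongrightarrow> complex_of_real (exp (- (u\<^sup>2) / 2))"
    by (rule tendsto_of_real)
  have "(\<lambda>n. \<psi> n (u / sqrt (real n * v n)) ^ n - complex_of_real ((1 + (- (u\<^sup>2) / 2) / real n) ^ n)) \<longlonglongrightarrow> 0"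
  proof (rule Lim_null_comparison)
    have "(\<lambda>n. (\<gamma> n / v n) * (\<bar>u\<bar> ^ 3 * (1 / sqrt (real n * v n)))) \<longlonglongrightarrow> 0 * (\<bar>u\<bar> ^ 3 * 0)"
      by (intro tendsto_mult \<gamma> tendsto_const tendsto_divide_0[OF tendsto_const] filterlim_at_top_imp_at_infinity
          filterlim_compose[OF sqrt_at_top m])
    then show "(\<lambda>n. (\<gamma> n / v n) * (\<bar>u\<bar> ^ 3 * (1 / sqrt (real n * v n)))) \<longlonglongrightarrow> 0" by simp
    \<comment> \<open>For n >= k the comparison value 1 - u^2 / (2 n) lies in [-1, 1], as the
      inequality for powers demands.\<close>
    obtain k :: nat where k: "u\<^sup>2 \<le> real k" using real_arch_simple by blast
    show "\<forall>\<^sub>F n in sequentially. norm (\<psi> n (u / sqrt (real n * v n)) ^ n - complex_of_real ((1 + (- (u\<^sup>2) / 2) / real n) ^ n))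
        \<le> (\<gamma> n / v n) * (\<bar>u\<bar> ^ 3 * (1 / sqrt (real n * v n)))"
      using approx le1 v_pos eventually_ge_at_top[of "max k 1"]
    proof eventually_elim
      case (elim n)
      define s where "s = u / sqrt (real n * v n)"
      have n: "real n > 0" "u\<^sup>2 \<le> real n" using elim k by auto
      have mp: "real n * v n > 0" using n elim by simp
      have w: "1 - s\<^sup>2 * v n / 2 = 1 + (- (u\<^sup>2) / 2) / real n"
        using n elim by (simp add: s_def power_divide)
      have "\<bar>1 + (- (u\<^sup>2) / 2) / real n\<bar> \<le> 1" using n by (simp add: abs_le_iff divide_simps)
      then have "cmod (\<psi> n s ^ n - complex_of_real (1 + (- (u\<^sup>2) / 2) / real n) ^ n)
          \<le> real n * cmod (\<psi> n s - complex_of_real (1 + (- (u\<^sup>2) / 2) / real n))"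
        using elim by (intro norm_power_diff; simp only: norm_of_real)
      also have "\<dots> \<le> real n * (\<bar>s\<bar> ^ 3 * \<gamma> n)"
        using elim(1) n unfolding w[symmetric] by (intro mult_left_mono) auto
      also have "\<dots> = (\<gamma> n / v n) * (\<bar>u\<bar> ^ 3 * (1 / sqrt (real n * v n)))"
      proof -
        have "\<bar>s\<bar> ^ 3 = \<bar>u\<bar> ^ 3 / (sqrt (real n * v n) * (real n * v n))"
          using mp by (simp add: s_def power_divide power3_eq_cube)
        then show ?thesis using n elim(3) by (simp add: field_simps)
      qed
      finally show ?case by (simp add: s_def)
    qed
  qed
  from tendsto_add[OF this lim]
  show "(\<lambda>n. \<psi> n (u / sqrt (real n * v n)) ^ n) \<longlonglongrightarrow> complex_of_real (exp (- (u\<^sup>2) / 2))" by simp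
next
  define T' where "T' = max T 1"
  have T': "T' \<ge> 1" "T \<le> T'" by (auto simp: T'_def)
  \<comment> \<open>This yields t^2 v <= 1, so that 1 - t^2 v / 2 is its own absolute value.\<close>
  have "\<forall>\<^sub>F n in sequentially. v n < 1 / T'\<^sup>2"
    using T' by (intro order_tendstoD(2)[OF v_0]) auto
  moreover have "\<forall>\<^sub>F n in sequentially. \<gamma> n / v n < 1 / (4 * T')"
    using T' by (intro order_tendstoD(2)[OF \<gamma>]) auto
  ultimately show "\<forall>\<^sub>F n in sequentially. \<forall>t. \<bar>t\<bar> \<le> T \<longrightarrow> cmod (\<psi> n t ^ n) \<le> exp (- (real n * v n * t\<^sup>2 / 4))"
    using approx v_pos
  proof eventually_elim
    case (elim n)
    show ?case
    proof (intro allI impI)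
      fix t :: real assume "\<bar>t\<bar> \<le> T"
      then have t: "\<bar>t\<bar> \<le> T'" using T' by simp
      have "t\<^sup>2 \<le> T'\<^sup>2" using t by (simp add: abs_le_square_iff[symmetric])
      then have "t\<^sup>2 * v n \<le> T'\<^sup>2 * v n" using elim by (intro mult_right_mono) auto
      also have "\<dots> \<le> 1" using elim(1) T' by (simp add: field_simps)
      finally have tv: "t\<^sup>2 * v n \<le> 1" .
      have gam: "T' * \<gamma> n \<le> v n / 4" using elim T' by (simp add: field_simps)
      have "\<bar>t\<bar> ^ 3 * \<gamma> n \<le> t\<^sup>2 * v n / 4"
      proof (cases "\<gamma> n \<ge> 0")
        case True
        have "\<bar>t\<bar> * \<gamma> n \<le> v n / 4" using mult_right_mono[OF t True] gam by linarith
        from mult_left_mono[OF this, of "t\<^sup>2"] show ?thesis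
          by (simp add: power3_eq_cube power2_eq_square algebra_simps)
      next
        case False
        then have "\<bar>t\<bar> ^ 3 * \<gamma> n \<le> 0" by (intro mult_nonneg_nonpos) auto
        also have "0 \<le> t\<^sup>2 * v n / 4" using elim by simp
        finally show ?thesis .
      qed
      moreover have "cmod (\<psi> n t) \<le> cmod (of_real (1 - t\<^sup>2 * v n / 2)) + cmod (\<psi> n t - of_real (1 - t\<^sup>2 * v n / 2))"
        using norm_triangle_ineq[of "of_real (1 - t\<^sup>2 * v n / 2)" "\<psi> n t - of_real (1 - t\<^sup>2 * v n / 2)"] by simp
      moreover have "cmod (of_real (1 - t\<^sup>2 * v n / 2)) = 1 - t\<^sup>2 * v n / 2"
        unfolding norm_of_real using tv by simp
      moreover have "cmod (\<psi> n t - of_real (1 - t\<^sup>2 * v n / 2)) \<le> \<bar>t\<bar> ^ 3 * \<gamma> n" using elim(3) by blast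
      ultimately have "cmod (\<psi> n t) \<le> 1 - t\<^sup>2 * v n / 4" by argo
      also have "\<dots> \<le> exp (- (t\<^sup>2 * v n / 4))" using exp_ge_add_one_self[of "- (t\<^sup>2 * v n / 4)"] by simp
      finally have "cmod (\<psi> n t) ^ n \<le> exp (- (t\<^sup>2 * v n / 4)) ^ n" by (intro power_mono) auto
      also have "\<dots> = exp (- (real n * v n * t\<^sup>2 / 4))" by (simp add: exp_of_nat_mult[symmetric] mult.commute mult.left_commute)
      finally show "cmod (\<psi> n t ^ n) \<le> exp (- (real n * v n * t\<^sup>2 / 4))" by (simp add: norm_power)
    qed
  qed
qed

section \<open>The tilted law of one summand\<close>

context sv_truncated_variance
begin

text \<open>Moments of the tilted law. The formula for the variance presupposes that the tilted mean is
  \<open>c\<close>, and the third moment is replaced by an upper bound.\<close>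

definition tilted_variance :: "real \<Rightarrow> real \<Rightarrow> real \<Rightarrow> real" where
  "tilted_variance h c t = trunc_exp_moment 2 h t / trunc_exp_moment 0 h t - c\<^sup>2"

definition tilted_abs3 :: "real \<Rightarrow> real \<Rightarrow> real \<Rightarrow> real" where
  "tilted_abs3 h c t = 4 * (trunc_exp_abs3 h t / trunc_exp_moment 0 h t + \<bar>c\<bar> ^ 3)"

definition tilted_char :: "real \<Rightarrow> real \<Rightarrow> real \<Rightarrow> real \<Rightarrow> complex" where
  "tilted_char h c t s = (CLINT \<omega>|M. (indicator {..h} (\<xi> \<omega>) * exp (t * (Y \<omega> / h))) * iexp (s * (Y \<omega> / h - c)))
      / trunc_exp_moment 0 h t"

text \<open>Continuity feeds the intermediate value theorem. The exponentials at t = 1 / 2 and t = 2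
  together dominate all those between, whatever the sign of Y.\<close>

lemma continuous_on_trunc_exp_moment:
  assumes h: "2 * \<bar>mean M \<xi>\<bar> + 1 \<le> h" and k: "k \<le> 1"
  shows "continuous_on {1/2..2} (trunc_exp_moment k h)"
proof (rule continuous_on_sequentiallyI)
  fix u :: "nat \<Rightarrow> real" and a
  assume u: "\<forall>n. u n \<in> {1/2..2}" and a: "a \<in> {1/2..2}" and lim: "u \<longlonglongrightarrow> a"
  let ?U = "\<lambda>\<omega>. Y \<omega> / h"
  show "(\<lambda>n. trunc_exp_moment k h (u n)) \<longlonglongrightarrow> trunc_exp_moment k h a"
    unfolding trunc_exp_moment_def
  proof (rule integral_dominated_convergence[where
        w = "\<lambda>\<omega>. indicator {..h} (\<xi> \<omega>) * (\<bar>?U \<omega>\<bar> ^ k * exp ((1/2) * ?U \<omega>)) + indicator {..h} (\<xi> \<omega>) * (\<bar>?U \<omega>\<bar> ^ k * exp (2 * ?U \<omega>))"])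
    show "integrable M (\<lambda>\<omega>. indicator {..h} (\<xi> \<omega>) * (\<bar>?U \<omega>\<bar> ^ k * exp ((1/2) * ?U \<omega>)) + indicator {..h} (\<xi> \<omega>) * (\<bar>?U \<omega>\<bar> ^ k * exp (2 * ?U \<omega>)))"
      using k by (intro Bochner_Integration.integrable_add integrable_trunc_exp h) auto
    show "AE \<omega> in M. (\<lambda>n. indicator {..h} (\<xi> \<omega>) * ((?U \<omega>) ^ k * exp (u n * ?U \<omega>))) \<longlonglongrightarrow> indicator {..h} (\<xi> \<omega>) * ((?U \<omega>) ^ k * exp (a * ?U \<omega>))"
      by (intro AE_I2 tendsto_intros lim)
    show "AE \<omega> in M. norm (indicator {..h} (\<xi> \<omega>) * ((?U \<omega>) ^ k * exp (u n * ?U \<omega>)))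
        \<le> indicator {..h} (\<xi> \<omega>) * (\<bar>?U \<omega>\<bar> ^ k * exp ((1/2) * ?U \<omega>)) + indicator {..h} (\<xi> \<omega>) * (\<bar>?U \<omega>\<bar> ^ k * exp (2 * ?U \<omega>))" for n
    proof (intro AE_I2)
      fix \<omega>
      define w where "w = ?U \<omega>"
      have un: "1 / 2 \<le> u n" "u n \<le> 2" using u by auto
      have "exp (u n * w) \<le> exp ((1 / 2) * w) + exp (2 * w)"
      proof (cases "0 \<le> w")
        case True
        then have "exp (u n * w) \<le> exp (2 * w)" using un by (simp add: mult_right_mono)
        then show ?thesis by (simp add: add_increasing)
      next
        case False
        then have "exp (u n * w) \<le> exp ((1 / 2) * w)" using un mult_right_mono_neg[of "1/2" "u n" w] by simp
        then show ?thesis by (simp add: add_increasing2)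
      qed
      then have "indicator {..h} (\<xi> \<omega>) * \<bar>w\<bar> ^ k * exp (u n * w) \<le> indicator {..h} (\<xi> \<omega>) * \<bar>w\<bar> ^ k * (exp ((1 / 2) * w) + exp (2 * w))"
        by (intro mult_left_mono) auto
      then show "norm (indicator {..h} (\<xi> \<omega>) * ((?U \<omega>) ^ k * exp (u n * ?U \<omega>)))
        \<le> indicator {..h} (\<xi> \<omega>) * (\<bar>?U \<omega>\<bar> ^ k * exp ((1/2) * ?U \<omega>)) + indicator {..h} (\<xi> \<omega>) * (\<bar>?U \<omega>\<bar> ^ k * exp (2 * ?U \<omega>))"
        unfolding w_def[symmetric] by (simp add: abs_mult power_abs algebra_simps)
    qed
  qed auto
qed

text \<open>Division by the zeroth moment makes w a probability density. By \<open>centred\<close>,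
  U has mean c under it, so the linear Taylor term integrates to zero and the quadratic one to
  \<open>tilted_variance\<close>.\<close>

lemma tilted_char_approx:
  assumes h: "2 * \<bar>mean M \<xi>\<bar> + 1 \<le> h" and t: "1 / 2 \<le> t" "t \<le> 2"
    and pos: "0 < trunc_exp_moment 0 h t" and centred: "trunc_exp_moment 1 h t = c * trunc_exp_moment 0 h t"
  shows "cmod (tilted_char h c t s - of_real (1 - s\<^sup>2 * tilted_variance h c t / 2)) \<le> \<bar>s\<bar> ^ 3 * tilted_abs3 h c t"
    and "cmod (tilted_char h c t s) \<le> 1"
proof -
  define U where "U \<omega> = Y \<omega> / h" for \<omega>
  define g where "g = trunc_exp_moment 0 h t"
  define w where "w \<omega> = indicator {..h} (\<xi> \<omega>) * exp (t * U \<omega>) / g" for \<omega>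
  have [measurable]: "U \<in> borel_measurable M" "w \<in> borel_measurable M"
    unfolding U_def[abs_def] w_def[abs_def] by measurable
  have g: "0 < g" using pos by (simp add: g_def)
  have w_nonneg: "0 \<le> w \<omega>" for \<omega> using g by (simp add: w_def)
  have int: "integrable M (\<lambda>\<omega>. w \<omega> * U \<omega> ^ k)" and int_abs: "integrable M (\<lambda>\<omega>. w \<omega> * \<bar>U \<omega>\<bar> ^ k)" if "k \<le> 3" for k
    using integrable_divide[OF integrable_trunc_exp(2)[OF h t that], of g] integrable_divide[OF integrable_trunc_exp(1)[OF h t that], of g]
    by (simp_all add: w_def U_def mult.commute mult.left_commute)
  have mom: "(LINT \<omega>|M. w \<omega> * U \<omega> ^ k) = trunc_exp_moment k h t / g" for k
  proof -
    have "(LINT \<omega>|M. w \<omega> * U \<omega> ^ k) = (LINT \<omega>|M. indicator {..h} (\<xi> \<omega>) * (U \<omega> ^ k * exp (t * U \<omega>)) / g)"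
      by (intro Bochner_Integration.integral_cong) (auto simp: w_def)
    then show ?thesis by (simp add: trunc_exp_moment_def U_def)
  qed
  have abs3: "(LINT \<omega>|M. w \<omega> * \<bar>U \<omega>\<bar> ^ 3) = trunc_exp_abs3 h t / g"
  proof -
    have "(LINT \<omega>|M. w \<omega> * \<bar>U \<omega>\<bar> ^ 3) = (LINT \<omega>|M. indicator {..h} (\<xi> \<omega>) * (\<bar>U \<omega>\<bar> ^ 3 * exp (t * U \<omega>)) / g)"
      by (intro Bochner_Integration.integral_cong) (auto simp: w_def)
    then show ?thesis by (simp add: trunc_exp_abs3_def U_def)
  qed
  have int_w: "integrable M w" using int[of 0] by simp
  have int_wU: "integrable M (\<lambda>\<omega>. w \<omega> * U \<omega>)" using int[of 1] by simp
  have int_wU2: "integrable M (\<lambda>\<omega>. w \<omega> * (U \<omega>)\<^sup>2)" using int[of 2] by simp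
  have E0: "(LINT \<omega>|M. w \<omega>) = 1" using mom[of 0] g by (simp add: g_def)
  have E1: "(LINT \<omega>|M. w \<omega> * U \<omega>) = c" using mom[of 1] g centred by (simp add: g_def)
  have E2: "(LINT \<omega>|M. w \<omega> * (U \<omega>)\<^sup>2) = trunc_exp_moment 2 h t / g" by (rule mom)
  have E1c: "(LINT \<omega>|M. w \<omega> * (U \<omega> - c)) = 0"
    using int_w int_wU by (simp add: right_diff_distrib E0 E1)
  have sq: "w \<omega> * (U \<omega> - c)\<^sup>2 = w \<omega> * (U \<omega>)\<^sup>2 - 2 * c * (w \<omega> * U \<omega>) + c\<^sup>2 * w \<omega>" for \<omega>
    by (simp add: power2_eq_square algebra_simps)
  have int_sq: "integrable M (\<lambda>\<omega>. w \<omega> * (U \<omega> - c)\<^sup>2)"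
    unfolding sq using int_w int_wU int_wU2 by simp
  have E2c: "(LINT \<omega>|M. w \<omega> * (U \<omega> - c)\<^sup>2) = tilted_variance h c t"
    unfolding sq using int_w int_wU int_wU2
    by (simp add: E0 E1 E2 tilted_variance_def g_def, simp add: power2_eq_square)
  \<comment> \<open>The source of the factor 4 in \<open>tilted_abs3\<close>: 4 (p^3 + q^3) - (p +
    q)^3 = 3 (p + q) (p - q)^2.\<close>
  have cube: "\<bar>a - c\<bar> ^ 3 \<le> 4 * (\<bar>a\<bar> ^ 3 + \<bar>c\<bar> ^ 3)" for a :: real
  proof -
    have "\<bar>a - c\<bar> ^ 3 \<le> (\<bar>a\<bar> + \<bar>c\<bar>) ^ 3" by (intro power_mono) auto
    also have "\<dots> \<le> 4 * (\<bar>a\<bar> ^ 3 + \<bar>c\<bar> ^ 3)"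
    proof -
      have "(p + q) ^ 3 \<le> 4 * (p ^ 3 + q ^ 3)" if "0 \<le> p" "0 \<le> q" for p q :: real
      proof -
        have "0 \<le> 3 * (p + q) * (p - q)\<^sup>2" using that by simp
        then show ?thesis by (simp add: power2_eq_square power3_eq_cube algebra_simps)
      qed
      then show ?thesis by simp
    qed
    finally show ?thesis .
  qed
  have int_bd: "integrable M (\<lambda>\<omega>. 4 * (w \<omega> * \<bar>U \<omega>\<bar> ^ 3 + \<bar>c\<bar> ^ 3 * w \<omega>))"
    using int_abs[of 3] int_w by simp
  have E3: "(LINT \<omega>|M. 4 * (w \<omega> * \<bar>U \<omega>\<bar> ^ 3 + \<bar>c\<bar> ^ 3 * w \<omega>)) = tilted_abs3 h c t"
    using int_abs[of 3] int_w by (simp add: abs3 E0 tilted_abs3_def g_def)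
  have tc: "tilted_char h c t s = (CLINT \<omega>|M. w \<omega> * iexp (s * (U \<omega> - c)))"
  proof -
    have "(CLINT \<omega>|M. w \<omega> * iexp (s * (U \<omega> - c))) = (CLINT \<omega>|M. ((indicator {..h} (\<xi> \<omega>) * exp (t * U \<omega>)) * iexp (s * (U \<omega> - c))) / g)"
      by (intro Bochner_Integration.integral_cong) (auto simp: w_def)
    then show ?thesis by (simp add: tilted_char_def U_def g_def)
  qed
  have int_c: "complex_integrable M (\<lambda>\<omega>. w \<omega> * iexp (s * (U \<omega> - c)))"
    by (rule Bochner_Integration.integrable_bound[OF int_w]) (auto simp: norm_mult)
  show "cmod (tilted_char h c t s) \<le> 1"
  proof -
    have "cmod (tilted_char h c t s) \<le> (LINT \<omega>|M. norm (w \<omega> * iexp (s * (U \<omega> - c))))"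
      unfolding tc by (rule integral_norm_bound)
    also have "\<dots> = 1" using w_nonneg by (simp add: norm_mult E0)
    finally show ?thesis .
  qed
  let ?T = "\<lambda>\<omega>. complex_of_real (w \<omega>) + \<i> * s * complex_of_real (w \<omega> * (U \<omega> - c)) - complex_of_real (s\<^sup>2 / 2 * (w \<omega> * (U \<omega> - c)\<^sup>2))"
  have i1: "complex_integrable M (\<lambda>\<omega>. complex_of_real (w \<omega>))" using int_w by simp
  have i2: "complex_integrable M (\<lambda>\<omega>. complex_of_real (w \<omega> * (U \<omega> - c)))"
    using int_w int_wU by (simp add: right_diff_distrib del: of_real_mult)
  have i3: "complex_integrable M (\<lambda>\<omega>. complex_of_real (s\<^sup>2 / 2 * (w \<omega> * (U \<omega> - c)\<^sup>2)))"
    using int_sq by (simp del: of_real_mult of_real_power)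
  have "(CLINT \<omega>|M. ?T \<omega>) = of_real (1 - s\<^sup>2 * tilted_variance h c t / 2)"
    using i1 i2 i3
    by (simp only: Bochner_Integration.integral_diff Bochner_Integration.integral_add
        Bochner_Integration.integrable_add integrable_mult_right integral_mult_right_zero integral_complex_of_real E0 E1c E2c) simp
  then have diff: "tilted_char h c t s - of_real (1 - s\<^sup>2 * tilted_variance h c t / 2) = (CLINT \<omega>|M. w \<omega> * iexp (s * (U \<omega> - c)) - ?T \<omega>)"
    unfolding tc using i1 i2 i3 int_c
    by (simp only: Bochner_Integration.integral_diff Bochner_Integration.integrable_diff
        Bochner_Integration.integrable_add integrable_mult_right)
  have "cmod (CLINT \<omega>|M. w \<omega> * iexp (s * (U \<omega> - c)) - ?T \<omega>) \<le> (LINT \<omega>|M. \<bar>s\<bar> ^ 3 * (4 * (w \<omega> * \<bar>U \<omega>\<bar> ^ 3 + \<bar>c\<bar> ^ 3 * w \<omega>)))"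
  proof (rule order_trans[OF integral_norm_bound integral_mono[OF integrable_norm]])
    show "complex_integrable M (\<lambda>\<omega>. w \<omega> * iexp (s * (U \<omega> - c)) - ?T \<omega>)"
      using i1 i2 i3 int_c
      by (simp only: Bochner_Integration.integrable_diff Bochner_Integration.integrable_add integrable_mult_right)
    show "integrable M (\<lambda>\<omega>. \<bar>s\<bar> ^ 3 * (4 * (w \<omega> * \<bar>U \<omega>\<bar> ^ 3 + \<bar>c\<bar> ^ 3 * w \<omega>)))"
      using int_bd by (rule integrable_mult_right)
    fix \<omega>
    define a where "a = s * (U \<omega> - c)"
    have taylor: "(\<Sum>k\<le>2. (\<i> * a) ^ k / fact k) = 1 + \<i> * of_real a - of_real (a\<^sup>2 / 2)"
      by (simp add: eval_nat_numeral) (simp add: algebra_simps)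
    have lin: "\<i> * s * complex_of_real (w \<omega> * (U \<omega> - c)) = \<i> * complex_of_real (w \<omega> * a)"
      by (simp add: a_def)
    have quad: "s\<^sup>2 / 2 * (w \<omega> * (U \<omega> - c)\<^sup>2) = w \<omega> * (a\<^sup>2 / 2)"
      by (simp add: a_def power_mult_distrib)
    have "w \<omega> * iexp (s * (U \<omega> - c)) - ?T \<omega> = w \<omega> * (iexp a - (\<Sum>k\<le>2. (\<i> * a) ^ k / fact k))"
      unfolding taylor lin quad a_def[symmetric] by (simp add: algebra_simps)
    then have "cmod (w \<omega> * iexp (s * (U \<omega> - c)) - ?T \<omega>) = w \<omega> * cmod (iexp a - (\<Sum>k\<le>2. (\<i> * a) ^ k / fact k))"
      using w_nonneg by (simp add: norm_mult)
    also have "\<dots> \<le> w \<omega> * (\<bar>a\<bar> ^ 3 / 6)"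
      using iexp_approx1[of a 2] by (intro mult_left_mono w_nonneg) (simp add: eval_nat_numeral)
    also have "\<dots> \<le> w \<omega> * \<bar>a\<bar> ^ 3" by (intro mult_left_mono w_nonneg) simp
    also have "\<bar>a\<bar> ^ 3 = \<bar>s\<bar> ^ 3 * \<bar>U \<omega> - c\<bar> ^ 3" by (simp add: a_def abs_mult power_mult_distrib)
    also have "w \<omega> * \<dots> \<le> w \<omega> * (\<bar>s\<bar> ^ 3 * (4 * (\<bar>U \<omega>\<bar> ^ 3 + \<bar>c\<bar> ^ 3)))"
      using cube by (intro mult_left_mono w_nonneg) auto
    finally show "cmod (w \<omega> * iexp (s * (U \<omega> - c)) - ?T \<omega>) \<le> \<bar>s\<bar> ^ 3 * (4 * (w \<omega> * \<bar>U \<omega>\<bar> ^ 3 + \<bar>c\<bar> ^ 3 * w \<omega>))"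
      by (simp add: algebra_simps)
  qed
  also have "\<dots> = \<bar>s\<bar> ^ 3 * tilted_abs3 h c t" unfolding E3[symmetric] by (rule integral_mult_right_zero)
  finally show "cmod (tilted_char h c t s - of_real (1 - s\<^sup>2 * tilted_variance h c t / 2)) \<le> \<bar>s\<bar> ^ 3 * tilted_abs3 h c t" unfolding diff .
qed


text \<open>The tilt \<open>t = 1\<close> does not suffice: it centres the sum only up to an error that need not be
  small compared with its standard deviation. Hence the intermediate value theorem.\<close>

lemma exists_tilt:
  fixes h c :: "nat \<Rightarrow> real"
  assumes h: "filterlim h at_top sequentially"
    and c: "(\<lambda>n. c n / (V (h n) / (h n)\<^sup>2)) \<longlonglongrightarrow> 1"
  obtains \<theta> where "\<theta> \<longlonglongrightarrow> 1"
    and "\<forall>\<^sub>F n in sequentially. 1 / 2 \<le> \<theta> n \<and> \<theta> n \<le> 2"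
    and "\<forall>\<^sub>F n in sequentially. trunc_exp_moment 1 (h n) (\<theta> n) = c n * trunc_exp_moment 0 (h n) (\<theta> n)"
    and "\<forall>\<^sub>F n in sequentially. 0 < trunc_exp_moment 0 (h n) (\<theta> n)"
    and "(\<lambda>n. tilted_variance (h n) (c n) (\<theta> n) / (V (h n) / (h n)\<^sup>2)) \<longlonglongrightarrow> 1"
    and "(\<lambda>n. tilted_abs3 (h n) (c n) (\<theta> n) / (V (h n) / (h n)\<^sup>2)) \<longlonglongrightarrow> 0"
proof -
  define q where "q n = V (h n) / (h n)\<^sup>2" for n
  define R where "R n = remainder (h n)" for n
  \<comment> \<open>Bounds the distance of \<open>f n\<close> from the affine function t q - c: the
    error of the first moment, plus |c| times the deviation of the zeroth moment from 1.\<close>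
  define e where "e n = 100 * R n + \<bar>c n\<bar> * (2 * q n + 100 * R n)" for n
  define f where "f n t = trunc_exp_moment 1 (h n) t - c n * trunc_exp_moment 0 (h n) t" for n t
  have ev_h: "eventually (\<lambda>n. P (h n)) sequentially" if "eventually P at_top" for P
    using h that by (simp add: filterlim_iff)
  have h_large: "\<forall>\<^sub>F n in sequentially. 2 * \<bar>mean M \<xi>\<bar> + 1 \<le> h n"
    by (rule ev_h[OF eventually_ge_at_top])
  have q_pos: "\<forall>\<^sub>F n in sequentially. 0 < q n"
    unfolding q_def by (rule ev_h) (use V_pos eventually_gt_at_top[of 0] in eventually_elim, simp)
  have q_0: "q \<longlonglongrightarrow> 0"
    unfolding q_def[abs_def] by (rule filterlim_compose[OF V_over_sq_tendsto_0 h])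
  have R_nonneg: "0 \<le> R n" for n by (simp add: R_def remainder_nonneg)
  have q_nonneg: "0 \<le> q n" for n by (simp add: q_def V_nonneg)
  have Rq: "(\<lambda>n. R n / q n) \<longlonglongrightarrow> 0"
  proof (rule tendstoI)
    fix \<epsilon> :: real assume "0 < \<epsilon>"
    then have "\<forall>\<^sub>F n in sequentially. R n \<le> \<epsilon> / 2 * q n"
      unfolding R_def q_def by (intro ev_h remainder_le) simp
    then show "\<forall>\<^sub>F n in sequentially. dist (R n / q n) 0 < \<epsilon>"
      using q_pos
    proof eventually_elim
      case (elim n)
      have "R n / q n \<le> \<epsilon> / 2" using elim by (simp add: field_simps)
      also have "\<dots> < \<epsilon>" using \<open>0 < \<epsilon>\<close> by simp
      finally show ?case using R_nonneg[of n] q_nonneg[of n] by (simp add: dist_real_def)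
    qed
  qed
  have from_ratio: "g \<longlonglongrightarrow> 0" if "(\<lambda>n. g n / q n) \<longlonglongrightarrow> l" for g :: "nat \<Rightarrow> real" and l
  proof -
    have "(\<lambda>n. g n / q n * q n) \<longlonglongrightarrow> l * 0" by (intro tendsto_mult that q_0)
    moreover have "\<forall>\<^sub>F n in sequentially. g n / q n * q n = g n" using q_pos by eventually_elim simp
    ultimately show ?thesis by (auto intro: Lim_transform_eventually)
  qed
  have cq: "(\<lambda>n. c n / q n) \<longlonglongrightarrow> 1" using c by (simp add: q_def)
  have c_0: "c \<longlonglongrightarrow> 0" by (rule from_ratio[OF cq])
  have R_0: "R \<longlonglongrightarrow> 0" by (rule from_ratio[OF Rq])
  have eq: "(\<lambda>n. e n / q n) \<longlonglongrightarrow> 0"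
  proof -
    have "(\<lambda>n. 100 * (R n / q n) + \<bar>c n / q n\<bar> * (2 * q n + 100 * R n)) \<longlonglongrightarrow> 100 * 0 + \<bar>1\<bar> * (2 * 0 + 100 * 0)"
      by (intro tendsto_intros Rq cq q_0 R_0)
    moreover have "100 * (R n / q n) + \<bar>c n / q n\<bar> * (2 * q n + 100 * R n) = e n / q n" for n
      using q_nonneg[of n] by (simp add: e_def add_divide_distrib)
    ultimately show ?thesis by simp
  qed
  have M0: "\<bar>trunc_exp_moment 0 (h n) t - 1\<bar> \<le> 2 * q n + 100 * R n"
    if "2 * \<bar>mean M \<xi>\<bar> + 1 \<le> h n" "1 / 2 \<le> t" "t \<le> 2" for n t
  proof -
    have "t\<^sup>2 \<le> 2\<^sup>2" using that by (intro power_mono) auto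
    then have "t\<^sup>2 / 2 * q n \<le> 2 * q n" using q_nonneg by (intro mult_right_mono) auto
    moreover have "0 \<le> t\<^sup>2 / 2 * q n" using q_nonneg[of n] by simp
    ultimately show ?thesis using trunc_exp_moment_0[OF that] by (simp add: q_def R_def)
  qed
  have f_approx: "\<bar>f n t - (t * q n - c n)\<bar> \<le> e n"
    if "2 * \<bar>mean M \<xi>\<bar> + 1 \<le> h n" "1 / 2 \<le> t" "t \<le> 2" for n t
  proof -
    have "\<bar>c n * (trunc_exp_moment 0 (h n) t - 1)\<bar> \<le> \<bar>c n\<bar> * (2 * q n + 100 * R n)"
      unfolding abs_mult by (intro mult_left_mono M0 that) auto
    moreover have "\<bar>trunc_exp_moment 1 (h n) t - t * q n\<bar> \<le> 100 * R n"
      using trunc_exp_moment_1[OF that] by (simp add: q_def R_def)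
    moreover have "f n t - (t * q n - c n) = (trunc_exp_moment 1 (h n) t - t * q n) - c n * (trunc_exp_moment 0 (h n) t - 1)"
      by (simp add: f_def algebra_simps)
    ultimately show ?thesis unfolding e_def by linarith
  qed
  have root: "\<forall>\<^sub>F n in sequentially. \<exists>t. 1 / 2 \<le> t \<and> t \<le> 3 / 2 \<and> f n t = 0"
  proof -
    \<comment> \<open>With these margins the affine part is below - q / 4 at t = 1 / 2 and above q /
      4 at t = 3 / 2, which the error q / 8 cannot overturn.\<close>
    have "\<forall>\<^sub>F n in sequentially. 3 / 4 < c n / q n" "\<forall>\<^sub>F n in sequentially. c n / q n < 5 / 4"
      "\<forall>\<^sub>F n in sequentially. e n / q n < 1 / 8"
      using order_tendstoD(1)[OF cq, of "3/4"] order_tendstoD(2)[OF cq, of "5/4"] order_tendstoD(2)[OF eq, of "1/8"] by auto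
    then show ?thesis
      using q_pos h_large
    proof eventually_elim
      case (elim n)
      have b: "3 / 4 * q n < c n" "c n < 5 / 4 * q n" "e n < 1 / 8 * q n"
        using elim by (auto simp: field_simps)
      have "f n (1 / 2) \<le> 0" "0 \<le> f n (3 / 2)"
        using f_approx[OF elim(5), of "1 / 2"] f_approx[OF elim(5), of "3 / 2"] b elim(4) by auto
      moreover have "continuous_on {1 / 2..3 / 2} (f n)"
        unfolding f_def[abs_def]
        by (intro continuous_intros continuous_on_subset[OF continuous_on_trunc_exp_moment[OF elim(5)]]) auto
      ultimately show ?case using IVT'[of "f n" "1/2" 0 "3/2"] by auto
    qed
  qed
  \<comment> \<open>The choice is meaningful only where a root exists, that is eventually; all
    conclusions are eventual as well.\<close>
  define \<theta> where "\<theta> n = (SOME t. 1 / 2 \<le> t \<and> t \<le> 3 / 2 \<and> f n t = 0)" for n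
  have \<theta>: "\<forall>\<^sub>F n in sequentially. 1 / 2 \<le> \<theta> n \<and> \<theta> n \<le> 3 / 2 \<and> f n (\<theta> n) = 0"
    using root unfolding \<theta>_def by eventually_elim (rule someI_ex)
  then have \<theta>_range: "\<forall>\<^sub>F n in sequentially. 1 / 2 \<le> \<theta> n \<and> \<theta> n \<le> 2" by eventually_elim auto
  have \<theta>_1: "\<theta> \<longlonglongrightarrow> 1"
  proof -
    have "(\<lambda>n. \<theta> n - c n / q n) \<longlonglongrightarrow> 0"
    proof (rule Lim_null_comparison[OF _ eq])
      show "\<forall>\<^sub>F n in sequentially. norm (\<theta> n - c n / q n) \<le> e n / q n"
        using \<theta> q_pos h_large
      proof eventually_elim
        case (elim n)
        have "\<bar>\<theta> n * q n - c n\<bar> \<le> e n" using f_approx[OF elim(3), of "\<theta> n"] elim by auto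
        then have "\<bar>\<theta> n * q n - c n\<bar> / q n \<le> e n / q n" using elim by (intro divide_right_mono) auto
        moreover have "\<theta> n - c n / q n = (\<theta> n * q n - c n) / q n" using elim by (simp add: field_simps)
        ultimately show ?case using elim by simp
      qed
    qed
    from tendsto_add[OF this cq] show ?thesis by simp
  qed
  define g where "g n = trunc_exp_moment 0 (h n) (\<theta> n)" for n
  have g_1: "g \<longlonglongrightarrow> 1"
  proof -
    have "(\<lambda>n. g n - 1) \<longlonglongrightarrow> 0"
    proof (rule Lim_null_comparison)
      show "\<forall>\<^sub>F n in sequentially. norm (g n - 1) \<le> 2 * q n + 100 * R n"
        using \<theta>_range h_large by eventually_elim (simp add: g_def M0)
      have "(\<lambda>n. 2 * q n + 100 * R n) \<longlonglongrightarrow> 2 * 0 + 100 * 0" by (intro tendsto_intros q_0 R_0)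
      then show "(\<lambda>n. 2 * q n + 100 * R n) \<longlonglongrightarrow> 0" by simp
    qed
    from tendsto_add[OF this tendsto_const[of 1]] show ?thesis by simp
  qed
  have g_pos: "\<forall>\<^sub>F n in sequentially. 0 < g n" using order_tendstoD(1)[OF g_1, of 0] by simp
  have R100: "(\<lambda>n. 100 * (R n / q n)) \<longlonglongrightarrow> 0" using tendsto_mult[OF tendsto_const[of 100] Rq] by simp
  have M2: "(\<lambda>n. trunc_exp_moment 2 (h n) (\<theta> n) / q n) \<longlonglongrightarrow> 1"
  proof -
    have "(\<lambda>n. trunc_exp_moment 2 (h n) (\<theta> n) / q n - 1) \<longlonglongrightarrow> 0"
    proof (rule Lim_null_comparison[OF _ R100])
      show "\<forall>\<^sub>F n in sequentially. norm (trunc_exp_moment 2 (h n) (\<theta> n) / q n - 1) \<le> 100 * (R n / q n)"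
        using \<theta>_range q_pos h_large
      proof eventually_elim
        case (elim n)
        have "\<bar>trunc_exp_moment 2 (h n) (\<theta> n) - q n\<bar> / q n \<le> 100 * R n / q n"
          using trunc_exp_moment_2[OF elim(3), of "\<theta> n"] elim by (intro divide_right_mono) (auto simp: q_def R_def)
        moreover have "trunc_exp_moment 2 (h n) (\<theta> n) / q n - 1 = (trunc_exp_moment 2 (h n) (\<theta> n) - q n) / q n"
          using elim by (simp add: field_simps)
        ultimately show ?case using elim by simp
      qed
    qed
    from tendsto_add[OF this tendsto_const[of 1]] show ?thesis by simp
  qed
  have M3: "(\<lambda>n. trunc_exp_abs3 (h n) (\<theta> n) / q n) \<longlonglongrightarrow> 0"
  proof (rule Lim_null_comparison[OF _ R100])
    show "\<forall>\<^sub>F n in sequentially. norm (trunc_exp_abs3 (h n) (\<theta> n) / q n) \<le> 100 * (R n / q n)"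
      using \<theta>_range q_pos h_large
    proof eventually_elim
      case (elim n)
      have "0 \<le> trunc_exp_abs3 (h n) (\<theta> n)"
        unfolding trunc_exp_abs3_def by (intro integral_nonneg_AE AE_I2) auto
      then show ?case
        using divide_right_mono[OF trunc_exp_abs3_le[OF elim(3), of "\<theta> n"], of "q n"] elim by (simp add: R_def)
    qed
  qed
  have "(\<lambda>n. (trunc_exp_moment 2 (h n) (\<theta> n) / q n) / g n - (c n / q n) * c n) \<longlonglongrightarrow> 1 / 1 - 1 * 0"
    by (intro tendsto_intros M2 g_1 cq c_0) simp
  then have v: "(\<lambda>n. tilted_variance (h n) (c n) (\<theta> n) / q n) \<longlonglongrightarrow> 1"
    by (simp add: tilted_variance_def g_def power2_eq_square diff_divide_distrib mult.commute)
  have "(\<lambda>n. 4 * ((trunc_exp_abs3 (h n) (\<theta> n) / q n) / g n + \<bar>c n / q n\<bar> * \<bar>c n\<bar>\<^sup>2)) \<longlonglongrightarrow> 4 * (0 / 1 + \<bar>1\<bar> * \<bar>0\<bar>\<^sup>2)"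
    by (intro tendsto_intros M3 g_1 cq c_0) simp
  moreover have "4 * ((trunc_exp_abs3 (h n) (\<theta> n) / q n) / g n + \<bar>c n / q n\<bar> * \<bar>c n\<bar>\<^sup>2) = tilted_abs3 (h n) (c n) (\<theta> n) / q n" for n
    using q_nonneg[of n] by (simp add: tilted_abs3_def g_def power3_eq_cube power2_eq_square add_divide_distrib mult.commute)
  ultimately have "(\<lambda>n. tilted_abs3 (h n) (c n) (\<theta> n) / q n) \<longlonglongrightarrow> 0" by simp
  moreover have "\<forall>\<^sub>F n in sequentially. trunc_exp_moment 1 (h n) (\<theta> n) = c n * trunc_exp_moment 0 (h n) (\<theta> n)"
    using \<theta> by eventually_elim (simp add: f_def)
  ultimately show thesis
    using \<theta>_1 \<theta>_range g_pos v by (intro that) (auto simp: q_def g_def)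
qed

end

section \<open>No big jump\<close>

lemma countable_not_isCont_indicator_mult:
  fixes g :: "real \<Rightarrow> real"
  assumes "countable (frontier B)" "\<And>z. isCont g z"
  shows "countable {z. \<not> isCont (\<lambda>z. indicator B z * g z) z}"
proof (rule countable_subset[OF _ assms(1)])
  show "{z. \<not> isCont (\<lambda>z. indicator B z * g z) z} \<subseteq> frontier B"
    using assms(2) isCont_indicator[where A = B] by (auto intro: continuous_mult)
qed

lemma local_limit_indicator:
  fixes N :: "nat \<Rightarrow> real measure" and g :: "real \<Rightarrow> real"
  assumes N: "\<And>n. real_distribution (N n)"
    and m: "filterlim m at_top sequentially"
    and lim: "\<And>u. (\<lambda>n. char (N n) (u / sqrt (m n))) \<longlonglongrightarrow> complex_of_real (exp (- (u\<^sup>2) / 2))"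
    and bound: "\<And>T. \<forall>\<^sub>F n in sequentially. \<forall>t. \<bar>t\<bar> \<le> T \<longrightarrow> cmod (char (N n) t) \<le> exp (- (m n * t\<^sup>2 / 4))"
    and [measurable]: "B \<in> sets borel" and B: "B \<subseteq> {0..}" "countable (frontier B)"
    and g: "\<And>z. isCont g z" "\<And>z. 0 \<le> z \<Longrightarrow> \<bar>g z\<bar> * (1 + z\<^sup>2) \<le> C"
  shows "(\<lambda>n. sqrt (m n) * (LINT z|N n. indicator B z * g z)) \<longlonglongrightarrow> (LBINT z. indicator B z * g z) / sqrt (2 * pi)"
proof -
  define f where "f z = indicator B z * (g z / sq_tent_ft z)" for z
  obtain c where c: "c > 0" "\<And>z. 0 \<le> z \<Longrightarrow> c \<le> sq_tent_ft z * (1 + z\<^sup>2)" using sq_tent_ft_ge by blast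
  have [measurable]: "g \<in> borel_measurable borel"
    using g(1) by (intro borel_measurable_continuous_onI continuous_at_imp_continuous_on) auto
  have eq: "sq_tent_ft z * f z = indicator B z * g z" for z
    using sq_tent_ft_pos[of z] by (simp add: f_def)
  have C: "0 \<le> C" using g(2)[of 0] by simp
  have "(\<lambda>n. sqrt (m n) * (LINT z|N n. sq_tent_ft z * f z)) \<longlonglongrightarrow> (LBINT z. sq_tent_ft z * f z) / sqrt (2 * pi)"
  proof (rule local_limit[OF N m lim bound])
    show "f \<in> borel_measurable borel" unfolding f_def[abs_def] by measurable
    show "\<bar>f z\<bar> \<le> C / c" for z
    proof (cases "z \<in> B")
      case True
      then have z: "0 \<le> z" using B by auto
      have "\<bar>g z\<bar> * c \<le> \<bar>g z\<bar> * (sq_tent_ft z * (1 + z\<^sup>2))" using c(2)[OF z] by (intro mult_left_mono) auto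
      also have "\<dots> = (\<bar>g z\<bar> * (1 + z\<^sup>2)) * sq_tent_ft z" by simp
      also have "\<dots> \<le> C * sq_tent_ft z" using g(2)[OF z] by (intro mult_right_mono) auto
      finally show ?thesis using True c(1) sq_tent_ft_pos[of z] by (simp add: f_def field_simps)
    next
      case False
      then show ?thesis using C c(1) by (simp add: f_def)
    qed
    show "countable {z. \<not> isCont f z}"
      unfolding f_def[abs_def]
    proof (rule countable_not_isCont_indicator_mult[OF B(2)])
      show "isCont (\<lambda>z. g z / sq_tent_ft z) z" for z
        using g(1)[of z] isCont_sq_tent_ft[of z] sq_tent_ft_pos[of z]
        by (intro continuous_divide) (auto simp: less_imp_neq[THEN not_sym])
    qed
  qed
  then show ?thesis by (simp only: eq)
qed

text \<open>The tilt varies with n. Once \<theta> exceeds 1 / 2, the two exponentials differ by at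
  most |\<theta> - 1| z exp (- z / 2); the local limit for this majorant shows that the error, even
  multiplied by sqrt (m n), is of order |\<theta> - 1|.\<close>

lemma local_limit_exp_indicator:
  fixes N :: "nat \<Rightarrow> real measure" and \<theta> :: "nat \<Rightarrow> real"
  assumes N: "\<And>n. real_distribution (N n)"
    and m: "filterlim m at_top sequentially"
    and lim: "\<And>u. (\<lambda>n. char (N n) (u / sqrt (m n))) \<longlonglongrightarrow> complex_of_real (exp (- (u\<^sup>2) / 2))"
    and bound: "\<And>T. \<forall>\<^sub>F n in sequentially. \<forall>t. \<bar>t\<bar> \<le> T \<longrightarrow> cmod (char (N n) t) \<le> exp (- (m n * t\<^sup>2 / 4))"
    and [measurable]: "B \<in> sets borel" and B: "B \<subseteq> {0..}" "countable (frontier B)"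
    and \<theta>: "\<theta> \<longlonglongrightarrow> 1"
  shows "(\<lambda>n. sqrt (m n) * (LINT z|N n. indicator B z * exp (- (\<theta> n * z)))) \<longlonglongrightarrow> (LBINT z. indicator B z * exp (- z)) / sqrt (2 * pi)"
proof -
  interpret N: real_distribution "N n" for n by (rule N)
  have lim1: "(\<lambda>n. sqrt (m n) * (LINT z|N n. indicator B z * exp (- z))) \<longlonglongrightarrow> (LBINT z. indicator B z * exp (- z)) / sqrt (2 * pi)"
  proof (rule local_limit_indicator[OF N m lim bound, where C = 17])
    show "\<bar>exp (- z)\<bar> * (1 + z\<^sup>2) \<le> 17" if "0 \<le> z" for z :: real
      using power_exp_neg_le[of z 1 2] that by (simp add: algebra_simps) (smt (verit) exp_ge_zero one_le_exp_iff exp_le_one_iff mult.commute)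
  qed (use B in auto)
  have lim2: "(\<lambda>n. sqrt (m n) * (LINT z|N n. indicator {0..} z * (z * exp (- (1 / 2 * z))))) \<longlonglongrightarrow>
      (LBINT z. indicator {0..} z * (z * exp (- (1 / 2 * z)))) / sqrt (2 * pi)"
  proof (rule local_limit_indicator[OF N m lim bound, where C = 300])
    fix z :: real assume z: "0 \<le> z"
    have "z ^ 1 * exp (- (1 / 2 * z)) \<le> 2" "z ^ 3 * exp (- (1 / 2 * z)) \<le> 216"
      using power_exp_neg_le[of z "1/2" 1] power_exp_neg_le[of z "1/2" 3] z by auto
    moreover have "\<bar>z * exp (- (1 / 2 * z))\<bar> * (1 + z\<^sup>2) = z ^ 1 * exp (- (1 / 2 * z)) + z ^ 3 * exp (- (1 / 2 * z))"
      using z by (simp add: algebra_simps power2_eq_square power3_eq_cube)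
    ultimately show "\<bar>z * exp (- (1 / 2 * z))\<bar> * (1 + z\<^sup>2) \<le> 300" by linarith
  qed auto
  have "(\<lambda>n. sqrt (m n) * (LINT z|N n. indicator B z * exp (- (\<theta> n * z))) - sqrt (m n) * (LINT z|N n. indicator B z * exp (- z))) \<longlonglongrightarrow> 0"
  proof (rule Lim_null_comparison)
    have "(\<lambda>n. \<bar>\<theta> n - 1\<bar> * (sqrt (m n) * (LINT z|N n. indicator {0..} z * (z * exp (- (1 / 2 * z)))))) \<longlonglongrightarrow>
      \<bar>1 - 1\<bar> * ((LBINT z. indicator {0..} z * (z * exp (- (1 / 2 * z)))) / sqrt (2 * pi))"
      by (intro tendsto_intros \<theta> lim2)
    then show "(\<lambda>n. \<bar>\<theta> n - 1\<bar> * (sqrt (m n) * (LINT z|N n. indicator {0..} z * (z * exp (- (1 / 2 * z)))))) \<longlonglongrightarrow> 0" by simp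
    have "\<forall>\<^sub>F n in sequentially. 1 / 2 < \<theta> n" using order_tendstoD(1)[OF \<theta>, of "1/2"] by simp
    moreover have "\<forall>\<^sub>F n in sequentially. 0 < m n" using m by (simp add: filterlim_at_top_dense)
    ultimately show "\<forall>\<^sub>F n in sequentially. norm (sqrt (m n) * (LINT z|N n. indicator B z * exp (- (\<theta> n * z))) - sqrt (m n) * (LINT z|N n. indicator B z * exp (- z)))
        \<le> \<bar>\<theta> n - 1\<bar> * (sqrt (m n) * (LINT z|N n. indicator {0..} z * (z * exp (- (1 / 2 * z)))))"
    proof eventually_elim
      case (elim n)
      have exp_diff: "\<bar>exp (- (\<theta> n * z)) - exp (- z)\<bar> \<le> \<bar>\<theta> n - 1\<bar> * (z * exp (- (1 / 2 * z)))" if z: "0 \<le> z" for z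
      proof -
        have aux: "\<bar>exp (- a) - exp (- b)\<bar> \<le> (b - a) * exp (- a)" if "a \<le> b" for a b :: real
        proof -
          have "1 - exp (- (b - a)) \<le> b - a" using exp_ge_add_one_self[of "- (b - a)"] by linarith
          from mult_right_mono[OF this, of "exp (- a)"]
          have "exp (- a) - exp (- b) \<le> (b - a) * exp (- a)" by (simp add: left_diff_distrib exp_add[symmetric])
          then show ?thesis using that by simp
        qed
        have half: "1 / 2 * z \<le> \<theta> n * z" "1 / 2 * z \<le> z"
          using mult_right_mono[of "1 / 2" "\<theta> n" z] z elim by linarith+
        show ?thesis
        proof (cases "\<theta> n \<le> 1")
          case True
          have "\<bar>exp (- (\<theta> n * z)) - exp (- z)\<bar> \<le> (z - \<theta> n * z) * exp (- (\<theta> n * z))"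
            using mult_right_mono[OF True z] by (intro aux) simp
          also have "\<dots> \<le> (z - \<theta> n * z) * exp (- (1 / 2 * z))"
            using half mult_right_mono[OF True z] by (intro mult_left_mono) auto
          finally show ?thesis using True by (simp add: algebra_simps)
        next
          case False
          then have "\<bar>exp (- z) - exp (- (\<theta> n * z))\<bar> \<le> (\<theta> n * z - z) * exp (- z)"
            using z mult_right_mono[of 1 "\<theta> n" z] by (intro aux) simp
          also have "\<dots> \<le> (\<theta> n * z - z) * exp (- (1 / 2 * z))"
            using half False z mult_right_mono[of 1 "\<theta> n" z] by (intro mult_left_mono) auto
          finally show ?thesis using False by (simp add: algebra_simps abs_minus_commute)
        qed
      qed
      have i1: "integrable (N n) (\<lambda>z. indicator B z * exp (- (t * z)))" if "0 \<le> t" for t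
      proof (rule N.integrable_const_bound[where B = 1])
        show "AE z in N n. norm (indicator B z * exp (- (t * z))) \<le> 1"
          using B(1) that by (intro AE_I2) (auto simp: indicator_def intro!: mult_nonneg_nonneg)
      qed simp
      have i2: "integrable (N n) (\<lambda>z. indicator {0..} z * (z * exp (- (1 / 2 * z))))"
      proof (rule N.integrable_const_bound[where B = 2])
        show "AE z in N n. norm (indicator {0..} z * (z * exp (- (1 / 2 * z)))) \<le> 2"
          using power_exp_neg_le[of _ "1/2" 1] by (intro AE_I2) (auto simp: indicator_def)
      qed simp
      have "\<bar>(LINT z|N n. indicator B z * exp (- (\<theta> n * z))) - (LINT z|N n. indicator B z * exp (- (1 * z)))\<bar>
          = \<bar>LINT z|N n. indicator B z * exp (- (\<theta> n * z)) - indicator B z * exp (- (1 * z))\<bar>"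
        using i1[of "\<theta> n"] i1[of 1] elim by (subst Bochner_Integration.integral_diff) auto
      also have "\<dots> \<le> (LINT z|N n. \<bar>indicator B z * exp (- (\<theta> n * z)) - indicator B z * exp (- (1 * z))\<bar>)"
        by (rule integral_abs_bound)
      also have "\<dots> \<le> (LINT z|N n. \<bar>\<theta> n - 1\<bar> * (indicator {0..} z * (z * exp (- (1 / 2 * z)))))"
      proof (intro integral_mono integrable_abs Bochner_Integration.integrable_diff i1 integrable_mult_right i2)
        fix z
        show "\<bar>indicator B z * exp (- (\<theta> n * z)) - indicator B z * exp (- (1 * z))\<bar> \<le> \<bar>\<theta> n - 1\<bar> * (indicator {0..} z * (z * exp (- (1 / 2 * z))))"
          using exp_diff[of z] B(1) by (cases "z \<in> B") (auto simp: indicator_def)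
      qed (use elim in auto)
      also have "\<dots> = \<bar>\<theta> n - 1\<bar> * (LINT z|N n. indicator {0..} z * (z * exp (- (1 / 2 * z))))"
        by (rule integral_mult_right_zero)
      finally have "sqrt (m n) * \<bar>(LINT z|N n. indicator B z * exp (- (\<theta> n * z))) - (LINT z|N n. indicator B z * exp (- z))\<bar>
          \<le> sqrt (m n) * (\<bar>\<theta> n - 1\<bar> * (LINT z|N n. indicator {0..} z * (z * exp (- (1 / 2 * z)))))"
        using elim by (intro mult_left_mono) auto
      then show ?case
        unfolding real_norm_def right_diff_distrib[symmetric] abs_mult
        using elim by (simp add: mult.left_commute)
    qed
  qed
  from tendsto_add[OF this lim1] show ?thesis by simp
qed

section \<open>Tilted laws of independent sums\<close>

locale sv_iid = sv_truncated_variance M \<xi> for M :: "'a measure" and \<xi> :: "'a \<Rightarrow> real" +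
  fixes X :: "nat \<Rightarrow> 'a \<Rightarrow> real"
  assumes iid: "iid_copies M \<xi> X"
begin

lemma measurable_X [measurable]: "1 \<le> i \<Longrightarrow> X i \<in> borel_measurable M"
  using iid by (auto simp: iid_copies_def indep_vars_def)

lemma distr_X: "1 \<le> i \<Longrightarrow> distr M borel (X i) = distr M borel \<xi>"
  using iid by (auto simp: iid_copies_def)

lemma measurable_X_Icc: "i \<in> {1..n} \<Longrightarrow> X i \<in> borel_measurable M"
  by simp

lemma integrable_X_iff:
  fixes g :: "real \<Rightarrow> 'b::{banach, second_countable_topology}"
  assumes [measurable]: "g \<in> borel_measurable borel" and i: "1 \<le> i"
  shows "integrable M (\<lambda>\<omega>. g (X i \<omega>)) \<longleftrightarrow> integrable M (\<lambda>\<omega>. g (\<xi> \<omega>))"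
  using integrable_distr_eq[OF measurable_X[OF i] assms(1)] integrable_distr_eq[OF measurable_xi assms(1)] distr_X[OF i]
  by simp

lemma integral_X:
  fixes g :: "real \<Rightarrow> 'b::{banach, second_countable_topology}"
  assumes [measurable]: "g \<in> borel_measurable borel" and i: "1 \<le> i"
  shows "(LINT \<omega>|M. g (X i \<omega>)) = (LINT \<omega>|M. g (\<xi> \<omega>))"
  using integral_distr[OF measurable_X[OF i] assms(1)] integral_distr[OF measurable_xi assms(1)] distr_X[OF i]
  by simp

lemma indep_X:
  assumes "J \<subseteq> {1..}" "\<And>j. j \<in> J \<Longrightarrow> g j \<in> borel_measurable borel"
  shows "indep_vars (\<lambda>_. borel) (\<lambda>j \<omega>. g j (X j \<omega>)) J"
  by (rule indep_vars_compose2[where M' = "\<lambda>_. borel"])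
     (use iid assms in \<open>auto simp: iid_copies_def intro: indep_vars_subset\<close>)

lemma prod_X:
  fixes g :: "nat \<Rightarrow> real \<Rightarrow> 'b::{real_normed_field, banach, second_countable_topology}"
  assumes J: "finite J" "J \<subseteq> {1..}" and g: "\<And>j. j \<in> J \<Longrightarrow> g j \<in> borel_measurable borel"
    and int: "\<And>j. j \<in> J \<Longrightarrow> integrable M (\<lambda>\<omega>. g j (\<xi> \<omega>))"
  shows "(LINT \<omega>|M. (\<Prod>j\<in>J. g j (X j \<omega>))) = (\<Prod>j\<in>J. LINT \<omega>|M. g j (\<xi> \<omega>))"
    and "integrable M (\<lambda>\<omega>. \<Prod>j\<in>J. g j (X j \<omega>))"
proof -
  have *: "\<And>j. j \<in> J \<Longrightarrow> integrable M (\<lambda>\<omega>. g j (X j \<omega>))"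
    using J g int by (subst integrable_X_iff) auto
  show "integrable M (\<lambda>\<omega>. \<Prod>j\<in>J. g j (X j \<omega>))"
    by (rule indep_vars_integrable[OF J(1) indep_X[OF J(2) g] *])
  show "(LINT \<omega>|M. (\<Prod>j\<in>J. g j (X j \<omega>))) = (\<Prod>j\<in>J. LINT \<omega>|M. g j (\<xi> \<omega>))"
  proof -
    have "(LINT \<omega>|M. (\<Prod>j\<in>J. g j (X j \<omega>))) = (\<Prod>j\<in>J. LINT \<omega>|M. g j (X j \<omega>))"
      by (rule indep_vars_lebesgue_integral[OF J(1) indep_X[OF J(2) g] *])
    also have "\<dots> = (\<Prod>j\<in>J. LINT \<omega>|M. g j (\<xi> \<omega>))"
      using J g by (intro prod.cong integral_X) auto
    finally show ?thesis .
  qed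
qed

lemma measurable_psum [measurable]: "psum X n \<in> borel_measurable M"
  unfolding psum_def[abs_def] by (intro borel_measurable_sum) auto

lemma psum_centred: "psum X n \<omega> - real n * mean M \<xi> = (\<Sum>i=1..n. X i \<omega> - mean M \<xi>)"
  by (simp add: psum_def sum_subtractf)

lemma pmax_le_iff: "1 \<le> n \<Longrightarrow> pmax X n \<omega> \<le> h \<longleftrightarrow> (\<forall>i\<in>{1..n}. X i \<omega> \<le> h)"
  unfolding pmax_def by (subst Max_le_iff) auto

lemma measurable_pmax [measurable]: "1 \<le> n \<Longrightarrow> pmax X n \<in> borel_measurable M"
  unfolding pmax_def[abs_def] by (intro borel_measurable_Max) auto

text \<open>The density of the tilted product law. For n >= 1 it vanishes off the event
  \<open>pmax X n \<omega> \<le> h\<close>, so tilting and excluding a big jump happen at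
  once.\<close>

definition tilt_weight :: "nat \<Rightarrow> real \<Rightarrow> real \<Rightarrow> 'a \<Rightarrow> real" where
  "tilt_weight n h t \<omega> = (\<Prod>i=1..n. indicator {..h} (X i \<omega>) * exp (t * ((X i \<omega> - mean M \<xi>) / h)) / trunc_exp_moment 0 h t)"

definition scaled_excess :: "nat \<Rightarrow> real \<Rightarrow> real \<Rightarrow> 'a \<Rightarrow> real" where
  "scaled_excess n h c \<omega> = (\<Sum>i=1..n. (X i \<omega> - mean M \<xi>) / h - c)"

definition tilted_law :: "nat \<Rightarrow> real \<Rightarrow> real \<Rightarrow> real \<Rightarrow> real measure" where
  "tilted_law n h c t = distr (density M (\<lambda>\<omega>. ennreal (tilt_weight n h t \<omega>))) borel (scaled_excess n h c)"

lemma measurable_tilt_weight [measurable]: "tilt_weight n h t \<in> borel_measurable M"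
  unfolding tilt_weight_def[abs_def]
  by (intro borel_measurable_prod borel_measurable_divide borel_measurable_times
      measurable_compose[OF measurable_X_Icc borel_measurable_indicator] borel_measurable_const) (auto intro!: measurable_X_Icc)

lemma measurable_scaled_excess [measurable]: "scaled_excess n h c \<in> borel_measurable M"
  unfolding scaled_excess_def[abs_def] by (intro borel_measurable_sum) auto

context
  fixes h t :: real
  assumes h: "2 * \<bar>mean M \<xi>\<bar> + 1 \<le> h" and t: "1 / 2 \<le> t" "t \<le> 2" and pos: "0 < trunc_exp_moment 0 h t"
begin

private abbreviation "wt y \<equiv> indicator {..h} y * exp (t * ((y - mean M \<xi>) / h)) / trunc_exp_moment 0 h t"

private lemma integrable_wt: "integrable M (\<lambda>\<omega>. wt (\<xi> \<omega>))"
  using integrable_divide[OF integrable_trunc_exp(2)[OF h t, of 0]] by (simp add: Y_def)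

private lemma integral_wt: "(LINT \<omega>|M. wt (\<xi> \<omega>)) = 1"
  using pos by (simp add: trunc_exp_moment_def Y_def)

lemma tilt_weight_nonneg: "0 \<le> tilt_weight n h t \<omega>"
  unfolding tilt_weight_def using pos by (intro prod_nonneg) auto

lemma integrable_tilt_weight: "integrable M (tilt_weight n h t)"
  and integral_tilt_weight: "(LINT \<omega>|M. tilt_weight n h t \<omega>) = 1"
proof -
  show "integrable M (tilt_weight n h t)"
    unfolding tilt_weight_def[abs_def]
    by (rule prod_X(2)[of "{1..n}" "\<lambda>_ y. wt y"]) (use integrable_wt in auto)
  have "(LINT \<omega>|M. tilt_weight n h t \<omega>) = (\<Prod>i=1..n. LINT \<omega>|M. wt (\<xi> \<omega>))"
    unfolding tilt_weight_def
    by (rule prod_X(1)[of "{1..n}" "\<lambda>_ y. wt y"]) (use integrable_wt in auto)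
  then show "(LINT \<omega>|M. tilt_weight n h t \<omega>) = 1" by (simp only: integral_wt prod.neutral_const)
qed

lemma real_distribution_tilted_law: "real_distribution (tilted_law n h c t)"
proof -
  have "prob_space (density M (\<lambda>\<omega>. ennreal (tilt_weight n h t \<omega>)))"
  proof (rule prob_spaceI)
    have "(\<integral>\<^sup>+\<omega>. ennreal (tilt_weight n h t \<omega>) \<partial>M) = ennreal (LINT \<omega>|M. tilt_weight n h t \<omega>)"
      using integrable_tilt_weight tilt_weight_nonneg by (intro nn_integral_eq_integral) auto
    then show "emeasure (density M (\<lambda>\<omega>. ennreal (tilt_weight n h t \<omega>))) (space (density M (\<lambda>\<omega>. ennreal (tilt_weight n h t \<omega>)))) = 1"
      by (simp add: integral_tilt_weight emeasure_density indicator_def cong: nn_integral_cong)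
  qed
  then interpret D: prob_space "density M (\<lambda>\<omega>. ennreal (tilt_weight n h t \<omega>))" .
  show ?thesis unfolding tilted_law_def by (rule D.real_distribution_distr) simp
qed

lemma integral_tilted_law:
  fixes f :: "real \<Rightarrow> 'b::{banach, second_countable_topology}"
  assumes [measurable]: "f \<in> borel_measurable borel"
  shows "(LINT z|tilted_law n h c t. f z) = (LINT \<omega>|M. tilt_weight n h t \<omega> *\<^sub>R f (scaled_excess n h c \<omega>))"
  unfolding tilted_law_def
  by (subst integral_distr; (subst integral_density)?) (auto simp: tilt_weight_nonneg)

lemma char_tilted_law: "char (tilted_law n h c t) s = tilted_char h c t s ^ n"
proof -
  let ?g = "\<lambda>y. complex_of_real (wt y) * iexp (s * ((y - mean M \<xi>) / h - c))"
  have int: "complex_integrable M (\<lambda>\<omega>. ?g (\<xi> \<omega>))"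
    by (rule Bochner_Integration.integrable_bound[OF integrable_wt])
       (measurable, intro AE_I2, simp only: norm_mult norm_exp_i_times norm_of_real mult_1_right real_norm_def order_refl)
  have prod_eq: "tilt_weight n h t \<omega> *\<^sub>R iexp (s * scaled_excess n h c \<omega>) = (\<Prod>i=1..n. ?g (X i \<omega>))" for \<omega>
  proof -
    have "iexp (s * scaled_excess n h c \<omega>) = exp (\<Sum>i=1..n. \<i> * complex_of_real (s * ((X i \<omega> - mean M \<xi>) / h - c)))"
      unfolding scaled_excess_def by (simp only: sum_distrib_left of_real_sum)
    also have "\<dots> = (\<Prod>i=1..n. iexp (s * ((X i \<omega> - mean M \<xi>) / h - c)))"
      by (rule exp_sum) simp
    finally show ?thesis
      unfolding tilt_weight_def scaleR_conv_of_real of_real_prod prod.distrib by simp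
  qed
  have "char (tilted_law n h c t) s = (CLINT \<omega>|M. \<Prod>i=1..n. ?g (X i \<omega>))"
    unfolding char_def by (subst integral_tilted_law) (auto simp only: prod_eq, measurable)
  also have "\<dots> = (\<Prod>i=1..n. CLINT \<omega>|M. ?g (\<xi> \<omega>))"
    by (rule prod_X(1)[of "{1..n}" "\<lambda>_. ?g"]) (use int in auto)
  also have "\<dots> = (CLINT \<omega>|M. ?g (\<xi> \<omega>)) ^ n" by simp
  also have "(CLINT \<omega>|M. ?g (\<xi> \<omega>)) = tilted_char h c t s"
  proof -
    have "(CLINT \<omega>|M. ?g (\<xi> \<omega>)) = (CLINT \<omega>|M. (indicator {..h} (\<xi> \<omega>) * exp (t * (Y \<omega> / h))) * iexp (s * (Y \<omega> / h - c)) / trunc_exp_moment 0 h t)"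
      by (intro Bochner_Integration.integral_cong) (auto simp: Y_def)
    then show ?thesis by (simp add: tilted_char_def)
  qed
  finally show ?thesis .
qed

text \<open>The weight and the factor exp (- t z) multiply to a constant on the event of no big jump
  and to zero off it. The constant does not depend on B, hence cancels in conditional
  probabilities.\<close>

lemma untilt:
  assumes [measurable]: "B \<in> sets borel" and n: "1 \<le> n"
  shows "(LINT z|tilted_law n h c t. indicator B z * exp (- (t * z)))
    = (exp (t * c) / trunc_exp_moment 0 h t) ^ n * \<P>(\<omega> in M. scaled_excess n h c \<omega> \<in> B \<and> pmax X n \<omega> \<le> h)"
proof -
  let ?k = "(exp (t * c) / trunc_exp_moment 0 h t) ^ n"
  have eq: "tilt_weight n h t \<omega> * exp (- (t * scaled_excess n h c \<omega>)) = ?k * indicator {..h} (pmax X n \<omega>)" for \<omega>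
  proof -
    have "exp (- (t * scaled_excess n h c \<omega>)) = exp (\<Sum>i=1..n. - (t * ((X i \<omega> - mean M \<xi>) / h - c)))"
      unfolding scaled_excess_def by (simp add: sum_distrib_left sum_negf)
    also have "\<dots> = (\<Prod>i=1..n. exp (- (t * ((X i \<omega> - mean M \<xi>) / h - c))))"
      by (rule exp_sum) simp
    finally have "tilt_weight n h t \<omega> * exp (- (t * scaled_excess n h c \<omega>)) =
        (\<Prod>i=1..n. wt (X i \<omega>) * exp (- (t * ((X i \<omega> - mean M \<xi>) / h - c))))"
      unfolding tilt_weight_def prod.distrib by simp
    also have "\<dots> = (\<Prod>i=1..n. exp (t * c) / trunc_exp_moment 0 h t * indicator {..h} (X i \<omega>))"
    proof (intro prod.cong refl)
      fix i
      have "exp (t * ((X i \<omega> - mean M \<xi>) / h)) * exp (- (t * ((X i \<omega> - mean M \<xi>) / h - c))) = exp (t * c)"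
        by (simp add: exp_add[symmetric] algebra_simps)
      then show "wt (X i \<omega>) * exp (- (t * ((X i \<omega> - mean M \<xi>) / h - c))) = exp (t * c) / trunc_exp_moment 0 h t * indicator {..h} (X i \<omega>)"
        by (simp add: field_simps)
    qed
    also have "\<dots> = ?k * (\<Prod>i=1..n. indicator {..h} (X i \<omega>))" unfolding prod.distrib by simp
    also have "(\<Prod>i=1..n. indicator {..h} (X i \<omega>) :: real) = indicator {..h} (pmax X n \<omega>)"
      using n by (auto simp: indicator_def pmax_le_iff prod_zero_iff)
    finally show ?thesis .
  qed
  have "(LINT z|tilted_law n h c t. indicator B z * exp (- (t * z))) =
      (LINT \<omega>|M. tilt_weight n h t \<omega> * (indicator B (scaled_excess n h c \<omega>) * exp (- (t * scaled_excess n h c \<omega>))))"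
    by (subst integral_tilted_law) auto
  also have "\<dots> = (LINT \<omega>|M. ?k * indicator {\<omega> \<in> space M. scaled_excess n h c \<omega> \<in> B \<and> pmax X n \<omega> \<le> h} \<omega>)"
  proof (intro Bochner_Integration.integral_cong refl)
    fix \<omega> assume "\<omega> \<in> space M"
    have split: "tilt_weight n h t \<omega> * (indicator B (scaled_excess n h c \<omega>) * exp (- (t * scaled_excess n h c \<omega>))) =
       indicator B (scaled_excess n h c \<omega>) * (?k * indicator {..h} (pmax X n \<omega>))"
      unfolding eq[symmetric] by simp
    show "tilt_weight n h t \<omega> * (indicator B (scaled_excess n h c \<omega>) * exp (- (t * scaled_excess n h c \<omega>))) =
      ?k * indicator {\<omega> \<in> space M. scaled_excess n h c \<omega> \<in> B \<and> pmax X n \<omega> \<le> h} \<omega>"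
      unfolding split using \<open>\<omega> \<in> space M\<close> by (simp add: indicator_def)
  qed
  also have "\<dots> = ?k * \<P>(\<omega> in M. scaled_excess n h c \<omega> \<in> B \<and> pmax X n \<omega> \<le> h)"
  proof -
    have "{\<omega> \<in> space M. scaled_excess n h c \<omega> \<in> B \<and> pmax X n \<omega> \<le> h} \<in> events" using n by measurable
    then show ?thesis by (simp add: measure_def)
  qed
  finally show ?thesis .
qed

end

lemma scaled_excess_eq:
  assumes "1 \<le> n" "0 < h"
  shows "scaled_excess n h (x / (real n * h)) \<omega> = (psum X n \<omega> - real n * mean M \<xi> - x) / h"
  unfolding psum_centred scaled_excess_def sum_subtractf sum_divide_distrib[symmetric]
  using assms by (simp add: diff_divide_distrib sum_subtractf)

lemma exp_law_1: "real_distribution (exp_law 1)"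
  and measure_exp_law_1: "B \<in> sets borel \<Longrightarrow> measure (exp_law 1) B = (LBINT z. indicator (B \<inter> {0..}) z * exp (- z))"
proof -
  have meas: "exponential_density 1 \<in> borel_measurable borel"
    unfolding exponential_density_def[abs_def] by measurable
  interpret E: prob_space "exp_law 1"
    unfolding exp_law_def by (rule prob_space_exponential_density) simp
  show "real_distribution (exp_law 1)"
    by (intro real_distribution.intro E.prob_space_axioms real_distribution_axioms.intro) (auto simp: exp_law_def)
  assume [measurable]: "B \<in> sets borel"
  have "measure (exp_law 1) B = (LINT z|exp_law 1. indicator B z)" by (simp add: exp_law_def)
  also have "\<dots> = (LBINT z. exponential_density 1 z *\<^sub>R indicator B z)"
    unfolding exp_law_def using meas
    by (subst integral_density) (auto simp: exponential_density_nonneg)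
  also have "\<dots> = (LBINT z. indicator (B \<inter> {0..}) z * exp (- z))"
    by (intro Bochner_Integration.integral_cong) (auto simp: exponential_density_def indicator_def)
  finally show "measure (exp_law 1) B = (LBINT z. indicator (B \<inter> {0..}) z * exp (- z))" .
qed

text \<open>The factor \<open>k n\<close> is common to all sets B. Its size is never evaluated: only
  the quotient of the limits for an initial interval and for the whole half line enters.\<close>

theorem weak_conv_no_big_jump:
  fixes x h :: "nat \<Rightarrow> real"
  assumes h: "filterlim h at_top sequentially"
    and ratio: "(\<lambda>n. (x n / h n) / (real n * (V (h n) / (h n)\<^sup>2))) \<longlonglongrightarrow> 1"
    and xh: "filterlim (\<lambda>n. x n / h n) at_top sequentially"
  shows "weak_conv_m
     (\<lambda>n. cond_law M (\<lambda>\<omega>. (psum X n \<omega> - real n * mean M \<xi> - x n) / h n)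
        (\<lambda>\<omega>. psum X n \<omega> - real n * mean M \<xi> \<ge> x n \<and> pmax X n \<omega> \<le> h n)) (exp_law 1)"
proof -
  define q where "q n = V (h n) / (h n)\<^sup>2" for n
  define c where "c n = x n / (real n * h n)" for n
  have cq: "(\<lambda>n. c n / q n) \<longlonglongrightarrow> 1"
    using ratio by (simp add: c_def q_def divide_divide_eq_left mult.commute mult.left_commute)
  then obtain \<theta> where \<theta>: "\<theta> \<longlonglongrightarrow> 1"
    and range: "\<forall>\<^sub>F n in sequentially. 1 / 2 \<le> \<theta> n \<and> \<theta> n \<le> 2"
    and centred: "\<forall>\<^sub>F n in sequentially. trunc_exp_moment 1 (h n) (\<theta> n) = c n * trunc_exp_moment 0 (h n) (\<theta> n)"
    and pos: "\<forall>\<^sub>F n in sequentially. 0 < trunc_exp_moment 0 (h n) (\<theta> n)"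
    and var: "(\<lambda>n. tilted_variance (h n) (c n) (\<theta> n) / q n) \<longlonglongrightarrow> 1"
    and abs3: "(\<lambda>n. tilted_abs3 (h n) (c n) (\<theta> n) / q n) \<longlonglongrightarrow> 0"
    using exists_tilt[OF h, of c] unfolding q_def by blast
  define v where "v n = tilted_variance (h n) (c n) (\<theta> n)" for n
  define m where "m n = real n * v n" for n
  define good where "good n \<longleftrightarrow> 2 * \<bar>mean M \<xi>\<bar> + 1 \<le> h n \<and> 1 / 2 \<le> \<theta> n \<and> \<theta> n \<le> 2 \<and>
    trunc_exp_moment 1 (h n) (\<theta> n) = c n * trunc_exp_moment 0 (h n) (\<theta> n) \<and> 0 < trunc_exp_moment 0 (h n) (\<theta> n) \<and> 1 \<le> n" for n
  have ev_h: "eventually (\<lambda>n. P (h n)) sequentially" if "eventually P at_top" for P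
    using h that by (simp add: filterlim_iff)
  have good: "\<forall>\<^sub>F n in sequentially. good n"
    using range centred pos ev_h[OF eventually_ge_at_top[of "2 * \<bar>mean M \<xi>\<bar> + 1"]] eventually_ge_at_top[of 1]
    by eventually_elim (simp add: good_def)
  have q_pos: "\<forall>\<^sub>F n in sequentially. 0 < q n"
    unfolding q_def by (rule ev_h) (use V_pos eventually_gt_at_top[of 0] in eventually_elim, simp)
  have q_0: "q \<longlonglongrightarrow> 0"
    unfolding q_def[abs_def] by (rule filterlim_compose[OF V_over_sq_tendsto_0 h])
  have v_pos: "\<forall>\<^sub>F n in sequentially. 0 < v n"
    using order_tendstoD(1)[OF var, of 0, simplified] q_pos
    by eventually_elim (simp add: v_def zero_less_divide_iff)
  have v_0: "v \<longlonglongrightarrow> 0"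
  proof -
    have "(\<lambda>n. tilted_variance (h n) (c n) (\<theta> n) / q n * q n) \<longlonglongrightarrow> 1 * 0" by (intro tendsto_mult var q_0)
    moreover have "\<forall>\<^sub>F n in sequentially. tilted_variance (h n) (c n) (\<theta> n) / q n * q n = v n"
      using q_pos by eventually_elim (simp add: v_def)
    ultimately show ?thesis by (auto intro: Lim_transform_eventually)
  qed
  have gv: "(\<lambda>n. tilted_abs3 (h n) (c n) (\<theta> n) / v n) \<longlonglongrightarrow> 0"
  proof -
    have "(\<lambda>n. (tilted_abs3 (h n) (c n) (\<theta> n) / q n) / (tilted_variance (h n) (c n) (\<theta> n) / q n)) \<longlonglongrightarrow> 0 / 1"
      by (intro tendsto_divide var abs3) simp
    moreover have "\<forall>\<^sub>F n in sequentially. (tilted_abs3 (h n) (c n) (\<theta> n) / q n) / (tilted_variance (h n) (c n) (\<theta> n) / q n) = tilted_abs3 (h n) (c n) (\<theta> n) / v n"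
      using q_pos by eventually_elim (simp add: v_def)
    ultimately show ?thesis by (auto intro: Lim_transform_eventually)
  qed
  \<comment> \<open>Eventually m is the variance of the tilted scaled sum. Since v and c are both
    equivalent to q, it is equivalent to n c = x / h.\<close>
  have m_top: "filterlim m at_top sequentially"
  proof -
    have "(\<lambda>n. (tilted_variance (h n) (c n) (\<theta> n) / q n) / (c n / q n)) \<longlonglongrightarrow> 1 / 1"
      by (intro tendsto_divide var cq) simp
    then have "filterlim (\<lambda>n. (tilted_variance (h n) (c n) (\<theta> n) / q n) / (c n / q n) * (x n / h n)) at_top sequentially"
      using xh by (intro filterlim_tendsto_pos_mult_at_top[of _ 1]) auto
    moreover have "\<forall>\<^sub>F n in sequentially. (tilted_variance (h n) (c n) (\<theta> n) / q n) / (c n / q n) * (x n / h n) = m n"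
    proof -
      have "\<forall>\<^sub>F n in sequentially. 0 < x n / h n" using xh by (simp add: filterlim_at_top_dense)
      then show ?thesis using q_pos eventually_ge_at_top[of 1] ev_h[OF eventually_gt_at_top[of 0]]
        by eventually_elim (simp add: m_def v_def c_def field_simps)
    qed
    ultimately show ?thesis by (simp cong: filterlim_cong)
  qed
  \<comment> \<open>A point mass fills in where the tilted law need not be a probability measure,
    because the local limit theorem asks for a distribution at every n.\<close>
  define N where "N n = (if good n then tilted_law n (h n) (c n) (\<theta> n) else return borel 0)" for n
  have N: "real_distribution (N n)" for n
  proof (cases "good n")
    case True
    then show ?thesis unfolding N_def good_def by (auto intro: real_distribution_tilted_law)
  next
    case False
    then show ?thesis
      by (simp add: N_def real_distribution_def real_distribution_axioms_def prob_space_return)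
  qed
  have char_N: "char (N n) s = tilted_char (h n) (c n) (\<theta> n) s ^ n" if "good n" for n s
    using that by (simp add: N_def, simp add: good_def char_tilted_law)
  have approx: "\<forall>\<^sub>F n in sequentially. \<forall>s. cmod (tilted_char (h n) (c n) (\<theta> n) s - of_real (1 - s\<^sup>2 * v n / 2)) \<le> \<bar>s\<bar> ^ 3 * tilted_abs3 (h n) (c n) (\<theta> n)"
    using good by eventually_elim (auto simp only: good_def v_def intro!: tilted_char_approx(1))
  have le1: "\<forall>\<^sub>F n in sequentially. \<forall>s. cmod (tilted_char (h n) (c n) (\<theta> n) s) \<le> 1"
    using good by eventually_elim (auto simp only: good_def intro!: tilted_char_approx(2))
  note gauss = char_power_gaussian[OF approx le1 v_pos v_0 gv m_top[unfolded m_def], folded m_def]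
  have lim: "(\<lambda>n. char (N n) (u / sqrt (m n))) \<longlonglongrightarrow> complex_of_real (exp (- (u\<^sup>2) / 2))" for u
    using good by (intro Lim_transform_eventually[OF gauss(1)]) (auto elim: eventually_mono simp: char_N)
  have bound: "\<forall>\<^sub>F n in sequentially. \<forall>t. \<bar>t\<bar> \<le> T \<longrightarrow> cmod (char (N n) t) \<le> exp (- (m n * t\<^sup>2 / 4))" for T
    using gauss(2)[of T] good by eventually_elim (simp add: char_N)
  define k where "k n = sqrt (m n) * (exp (\<theta> n * c n) / trunc_exp_moment 0 (h n) (\<theta> n)) ^ n" for n
  define prb where "prb B n = \<P>(\<omega> in M. (psum X n \<omega> - real n * mean M \<xi> - x n) / h n \<in> B \<and> pmax X n \<omega> \<le> h n)" for B n
  have main: "(\<lambda>n. k n * prb (B \<inter> {0..}) n) \<longlonglongrightarrow> measure (exp_law 1) B / sqrt (2 * pi)"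
    if [measurable]: "B \<in> sets borel" and fr: "countable (frontier (B \<inter> {0..}))" for B
  proof -
    have "(\<lambda>n. sqrt (m n) * (LINT z|N n. indicator (B \<inter> {0..}) z * exp (- (\<theta> n * z)))) \<longlonglongrightarrow>
        (LBINT z. indicator (B \<inter> {0..}) z * exp (- z)) / sqrt (2 * pi)"
      by (rule local_limit_exp_indicator[OF N m_top lim bound]) (use fr \<theta> in auto)
    moreover have "\<forall>\<^sub>F n in sequentially. sqrt (m n) * (LINT z|N n. indicator (B \<inter> {0..}) z * exp (- (\<theta> n * z))) = k n * prb (B \<inter> {0..}) n"
      using good
    proof eventually_elim
      case (elim n)
      then have g: "2 * \<bar>mean M \<xi>\<bar> + 1 \<le> h n" "1 / 2 \<le> \<theta> n" "\<theta> n \<le> 2" "0 < trunc_exp_moment 0 (h n) (\<theta> n)" "1 \<le> n"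
        by (auto simp: good_def)
      then have hp: "0 < h n" by linarith
      have "(LINT z|N n. indicator (B \<inter> {0..}) z * exp (- (\<theta> n * z))) = (exp (\<theta> n * c n) / trunc_exp_moment 0 (h n) (\<theta> n)) ^ n * prb (B \<inter> {0..}) n"
        unfolding prb_def scaled_excess_eq[OF g(5) hp, symmetric] c_def[symmetric] using elim g
        by (simp only: N_def if_True, intro untilt) auto
      then show ?case by (simp add: k_def)
    qed
    ultimately show ?thesis
      unfolding measure_exp_law_1[OF that(1)] by (rule Lim_transform_eventually)
  qed
  interpret E: real_distribution "exp_law 1" by (rule exp_law_1)
  have main_UNIV: "(\<lambda>n. k n * prb {0..} n) \<longlonglongrightarrow> 1 / sqrt (2 * pi)"
    using main[of UNIV] E.prob_space by simp
  \<comment> \<open>The conditioning event is eventually not null, since its probability times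
    \<open>k n\<close> approaches a positive limit.\<close>
  have prb_pos: "\<forall>\<^sub>F n in sequentially. 0 < prb {0..} n"
    using order_tendstoD(1)[OF main_UNIV, of 0]
  proof (rule eventually_mono)
    fix n assume "0 < k n * prb {0..} n"
    then have "prb {0..} n \<noteq> 0" by auto
    then show "0 < prb {0..} n" by (simp add: prb_def zero_less_measure_iff)
  qed simp
  show ?thesis
    unfolding weak_conv_m_def weak_conv_def
  proof (intro allI impI)
    fix y :: real
    have fr: "countable (frontier ({..y} \<inter> {0..}))"
    proof (rule countable_subset[of _ "{0, y}"])
      have "closure {0..y} \<subseteq> {0..y}" by simp
      then show "frontier ({..y} \<inter> {0..}) \<subseteq> {0, y}"
        by (auto simp: frontier_def Int_commute[of "{..y}"] atLeastAtMost_def[symmetric])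
    qed simp
    have "(\<lambda>n. (k n * prb ({..y} \<inter> {0..}) n) / (k n * prb {0..} n)) \<longlonglongrightarrow> (measure (exp_law 1) {..y} / sqrt (2 * pi)) / (1 / sqrt (2 * pi))"
      by (intro tendsto_divide main main_UNIV fr) auto
    then have "(\<lambda>n. (k n * prb ({..y} \<inter> {0..}) n) / (k n * prb {0..} n)) \<longlonglongrightarrow> cdf (exp_law 1) y"
      by (simp add: cdf_def)
    moreover have "\<forall>\<^sub>F n in sequentially. (k n * prb ({..y} \<inter> {0..}) n) / (k n * prb {0..} n) =
      cdf (cond_law M (\<lambda>\<omega>. (psum X n \<omega> - real n * mean M \<xi> - x n) / h n)
        (\<lambda>\<omega>. psum X n \<omega> - real n * mean M \<xi> \<ge> x n \<and> pmax X n \<omega> \<le> h n)) y"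
      using order_tendstoD(1)[OF main_UNIV, of 0, simplified] prb_pos ev_h[OF eventually_gt_at_top[of 0]] eventually_ge_at_top[of 1]
    proof eventually_elim
      case (elim n)
      let ?Z = "\<lambda>\<omega>. (psum X n \<omega> - real n * mean M \<xi> - x n) / h n"
      let ?A = "{\<omega> \<in> space M. psum X n \<omega> - real n * mean M \<xi> \<ge> x n \<and> pmax X n \<omega> \<le> h n}"
      note [measurable] = measurable_pmax[OF elim(4)]
      have A: "?A \<in> events" by measurable
      have A_eq: "?A = {\<omega> \<in> space M. ?Z \<omega> \<in> {0..} \<and> pmax X n \<omega> \<le> h n}"
        using elim by (auto simp: zero_le_divide_iff)
      have prb_A: "prb {0..} n = measure M ?A" unfolding A_eq prb_def by simp
      have Z: "?Z \<in> borel_measurable M" by measurable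
      have "cdf (cond_law M ?Z (\<lambda>\<omega>. psum X n \<omega> - real n * mean M \<xi> \<ge> x n \<and> pmax X n \<omega> \<le> h n)) y
          = measure (uniform_measure M ?A) (?Z -` {..y} \<inter> space M)"
        unfolding cdf_def cond_law_def by (subst measure_distr) (use Z in auto)
      also have "\<dots> = measure M (?A \<inter> (?Z -` {..y} \<inter> space M)) / measure M ?A"
        using elim(2) A measurable_sets[OF Z, of "{..y}"] unfolding prb_A
        by (intro measure_uniform_measure) (auto simp: emeasure_eq_measure)
      also have "?A \<inter> (?Z -` {..y} \<inter> space M) = {\<omega> \<in> space M. ?Z \<omega> \<in> {..y} \<inter> {0..} \<and> pmax X n \<omega> \<le> h n}"
        unfolding A_eq by auto
      also have "measure M \<dots> = prb ({..y} \<inter> {0..}) n" by (simp add: prb_def)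
      finally show ?case using elim(1) by (auto simp: prb_A)
    qed
    ultimately show "(\<lambda>n. cdf (cond_law M (\<lambda>\<omega>. (psum X n \<omega> - real n * mean M \<xi> - x n) / h n)
        (\<lambda>\<omega>. psum X n \<omega> - real n * mean M \<xi> \<ge> x n \<and> pmax X n \<omega> \<le> h n)) y) \<longlonglongrightarrow> cdf (exp_law 1) y"
      by (rule Lim_transform_eventually)
  qed
qed

end

section \<open>One big jump\<close>

lemma exp_le_quadratic:
  fixes v :: real
  assumes v: "\<bar>v\<bar> \<le> 1"
  shows "exp v \<le> 1 + v + v\<^sup>2"
proof (cases "0 \<le> v")
  case True
  then show ?thesis using v by (intro exp_bound) auto
next
  case False
  define s where "s = - v"
  have s: "0 \<le> s" "s \<le> 1" using False v by (auto simp: s_def)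
  have "1 + s + s\<^sup>2 / 2 \<le> exp s" using s by (intro exp_lower_Taylor_quadratic) auto
  \<comment> \<open>At v = - s the claim reads 1 <= exp s (1 - s + s^2); the Taylor lower bound of
    exp s reduces it to polynomials.\<close>
  moreover have "1 \<le> (1 + s + s\<^sup>2 / 2) * (1 - s + s\<^sup>2)"
  proof -
    have "(1 + s + s\<^sup>2 / 2) * (1 - s + s\<^sup>2) = 1 + s\<^sup>2 / 2 + s ^ 3 / 2 + s ^ 4 / 2"
      by (simp add: power2_eq_square power3_eq_cube power4_eq_xxxx field_simps)
    then show ?thesis using s by simp
  qed
  moreover have "0 \<le> 1 - s + s\<^sup>2" using s by simp
  ultimately have "1 \<le> exp s * (1 - s + s\<^sup>2)" by (meson mult_right_mono order_trans)
  then show ?thesis by (simp add: s_def exp_minus field_simps)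
qed

text \<open>A dilation c slightly above 1 costs at most the fraction e of f. Both bounds for a big
  jump use it, one between z / c and z, the other between z and c z.\<close>

lemma inter_reg_varying_lower:
  assumes f: "inter_reg_varying f" and nonneg: "\<And>x. 0 \<le> f x" and e: "0 < e" "e < 1"
  shows "\<exists>c>1. c \<le> 2 \<and> (\<forall>\<^sub>F x in at_top. 0 < f x \<and> (1 - e) * f x \<le> f (c * x))"
proof -
  have "ereal (1 - e) < 1" using e by simp
  then have "\<forall>\<^sub>F c in at_right 1. ereal (1 - e) < Liminf at_top (\<lambda>x. ereal (f (c * x) / f x))"
    by (rule order_tendstoD(1)[OF conjunct1[OF f[unfolded inter_reg_varying_def]]])
  moreover have "\<forall>\<^sub>F c in at_right (1::real). c \<in> {1<..<2}"
    by (rule eventually_at_right_real) simp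
  ultimately have "\<forall>\<^sub>F c in at_right 1. ereal (1 - e) < Liminf at_top (\<lambda>x. ereal (f (c * x) / f x)) \<and> c \<in> {1<..<2}"
    by eventually_elim simp
  then obtain c where c: "1 < c" "c < 2" "ereal (1 - e) < Liminf at_top (\<lambda>x. ereal (f (c * x) / f x))"
    using eventually_happens'[OF trivial_limit_at_right_real] by fastforce
  have "\<forall>\<^sub>F x in at_top. ereal (1 - e) < ereal (f (c * x) / f x)"
    using c(3) by (rule less_LiminfD)
  then have "\<forall>\<^sub>F x in at_top. 0 < f x \<and> (1 - e) * f x \<le> f (c * x)"
  proof eventually_elim
    case (elim x)
    \<comment> \<open>A zero denominator would make the quotient 0, which is below 1 - e.\<close>
    have "f x \<noteq> 0" using elim e by auto
    then have "0 < f x" using nonneg[of x] by simp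
    then show ?case using elim by (simp add: field_simps)
  qed
  with c show ?thesis by (intro exI[of _ c]) auto
qed

text \<open>Dilation by c loses at most a factor 2, and d dilations with c^d > 2 overshoot 2 w;
  monotonicity brings the argument back to 2 w.\<close>

lemma antimono_doubling:
  assumes f: "inter_reg_varying f" and nonneg: "\<And>x. 0 \<le> f x" and anti: "antimono f"
  shows "\<exists>d X0. 0 < X0 \<and> (\<forall>w\<ge>X0. 0 < f w \<and> f w \<le> 2 ^ d * f (2 * w))"
proof -
  obtain c where c: "1 < c" "\<forall>\<^sub>F x in at_top. 0 < f x \<and> (1 - 1 / 2) * f x \<le> f (c * x)"
    using inter_reg_varying_lower[OF f nonneg, of "1/2"] by auto
  then obtain X1 where "\<forall>x\<ge>X1. 0 < f x \<and> (1 - 1 / 2) * f x \<le> f (c * x)"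
    unfolding eventually_at_top_linorder by blast
  then have X1: "0 < f x \<and> f x \<le> 2 * f (c * x)" if "X1 \<le> x" for x
    using that by fastforce
  obtain d :: nat where d: "2 < c ^ d" using real_arch_pow[OF c(1)] by blast
  have iter: "f w \<le> 2 ^ k * f (c ^ k * w)" if "max X1 1 \<le> w" for w k
  proof (induction k)
    case (Suc k)
    have "1 * w \<le> c ^ k * w" using c(1) that by (intro mult_right_mono one_le_power) auto
    then have "X1 \<le> c ^ k * w" using that by linarith
    then have "2 ^ k * f (c ^ k * w) \<le> 2 ^ k * (2 * f (c * (c ^ k * w)))" using X1 by (intro mult_left_mono) auto
    with Suc have "f w \<le> 2 ^ k * (2 * f (c * (c ^ k * w)))" by linarith
    then show ?case by (simp add: mult.assoc mult.left_commute)
  qed simp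
  have "0 < f w \<and> f w \<le> 2 ^ d * f (2 * w)" if w: "max X1 1 \<le> w" for w
  proof
    show "0 < f w" using X1[of w] w by simp
    have "2 * w \<le> c ^ d * w" using d w by (intro mult_right_mono) auto
    then have "f (c ^ d * w) \<le> f (2 * w)" by (rule antimonoD[OF anti])
    then have "2 ^ d * f (c ^ d * w) \<le> 2 ^ d * f (2 * w)" by simp
    with iter[OF w, of d] show "f w \<le> 2 ^ d * f (2 * w)" by linarith
  qed
  then show ?thesis by (intro exI[of _ d] exI[of _ "max X1 1"]) auto
qed

lemma doubling_iterate:
  fixes f :: "real \<Rightarrow> real"
  assumes dbl: "\<And>w. X0 \<le> w \<Longrightarrow> f w \<le> 2 ^ d * f (2 * w)" and X0: "0 < X0" "X0 \<le> z / 2 ^ j"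
  shows "f (z / 2 ^ j) \<le> 2 ^ (d * j) * f z"
  using X0(2)
proof (induction j)
  case (Suc j)
  have "z / 2 ^ Suc j \<le> z / 2 ^ j"
  proof -
    have "0 < z / 2 ^ Suc j" using Suc.prems X0 by linarith
    then have "0 < z" by (simp add: zero_less_divide_iff)
    then show ?thesis by (simp add: field_simps)
  qed
  then have IH: "f (z / 2 ^ j) \<le> 2 ^ (d * j) * f z" using Suc by linarith
  have "f (z / 2 ^ Suc j) \<le> 2 ^ d * f (2 * (z / 2 ^ Suc j))" using dbl Suc.prems by blast
  also have "\<dots> = 2 ^ d * f (z / 2 ^ j)" by simp
  also have "\<dots> \<le> 2 ^ d * (2 ^ (d * j) * f z)" using IH by (intro mult_left_mono) auto
  finally show ?case by (simp add: power_add)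
qed simp

text \<open>Doubling keeps z^d f(z) above a positive constant c, so f decays at most polynomially
  and an exponential is eventually smaller.\<close>

lemma exp_neg_le_doubling:
  fixes f :: "real \<Rightarrow> real"
  assumes dbl: "\<And>w. X0 \<le> w \<Longrightarrow> 0 < f w \<and> f w \<le> 2 ^ d * f (2 * w)" and anti: "antimono f"
    and X0: "0 < X0" and a: "0 < a" and e: "0 < e"
  shows "\<forall>\<^sub>F z in at_top. exp (- (a * z)) \<le> e * f z"
proof -
  define c where "c = X0 ^ d * f (2 * X0)"
  have c_pos: "0 < c" using X0 dbl[of "2 * X0"] by (simp add: c_def)
  have lower: "c \<le> z ^ d * f z" if "X0 \<le> z" "z \<le> 2 ^ Suc k * X0" for z k
    using that
  proof (induction k arbitrary: z)
    case 0
    have "c \<le> X0 ^ d * f z"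
      unfolding c_def using antimonoD[OF anti, of z "2 * X0"] 0 X0 by (intro mult_left_mono) auto
    also have "\<dots> \<le> z ^ d * f z" using 0 X0 dbl[of z] by (intro mult_right_mono power_mono) auto
    finally show ?case .
  next
    case (Suc k)
    show ?case
    proof (cases "z \<le> 2 * X0")
      case True
      have "c \<le> X0 ^ d * f z"
        unfolding c_def using antimonoD[OF anti True] X0 by (intro mult_left_mono) auto
      also have "\<dots> \<le> z ^ d * f z" using Suc.prems X0 dbl[of z] by (intro mult_right_mono power_mono) auto
      finally show ?thesis .
    next
      case False
      have "c \<le> (z / 2) ^ d * f (z / 2)" using Suc.prems False by (intro Suc.IH) auto
      also have "\<dots> \<le> (z / 2) ^ d * (2 ^ d * f (2 * (z / 2)))"
        using dbl[of "z / 2"] False X0 by (intro mult_left_mono) auto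
      also have "\<dots> = z ^ d * f z" by (simp add: power_divide)
      finally show ?thesis .
    qed
  qed
  \<comment> \<open>Bounds z^(d + 1) exp (- a z), with one power more than the lower bound on f
    uses; the surplus factor z beats K / (e c).\<close>
  define K where "K = (real (Suc d) / a) ^ Suc d"
  have K_nonneg: "0 \<le> K" using a by (simp add: K_def)
  have "exp (- (a * z)) \<le> e * f z" if z: "max X0 (max 1 (K / (e * c))) \<le> z" for z
  proof -
    obtain k :: nat where "z / X0 < 2 ^ k" using real_arch_pow[of 2] by auto
    then have "z \<le> 2 ^ k * X0" using X0 by (simp add: field_simps)
    also have "\<dots> \<le> 2 ^ Suc k * X0" using X0 by simp
    finally have low: "c \<le> z ^ d * f z" using z by (intro lower) auto
    have fz: "0 < f z" using dbl[of z] z by simp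
    have "z ^ Suc d * exp (- (a * z)) \<le> K" unfolding K_def using z a by (intro power_exp_neg_bound) auto
    also have "K \<le> e * c * z" using z e c_pos by (simp add: field_simps)
    also have "\<dots> \<le> e * (z ^ d * f z) * z" using low e z by (intro mult_right_mono mult_left_mono) auto
    also have "\<dots> = z ^ Suc d * (e * f z)" by simp
    finally show ?thesis using z by (subst (asm) mult_le_cancel_left_pos) auto
  qed
  then show ?thesis unfolding eventually_at_top_linorder by blast
qed

text \<open>2^(d (j + 1)) is the growth of the tail from z down to z / 2^(j + 1), and the
  exponential is the Chernoff gain at level z / 2^j. Bounding one further power of 2^j makes the
  levels summable.\<close>

lemma dyadic_exp_bound:
  fixes d :: nat
  obtains B :: real where "0 < B" "\<And>j::nat. 2 * 2 ^ (d * Suc j) * exp (- (2 ^ j / 32)) \<le> B / 2 ^ j"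
proof
  define B where "B = 2 * 2 ^ d * (real (Suc d) / (1 / 32)) ^ Suc d"
  show "0 < B" by (simp add: B_def)
  fix j :: nat
  have "(2 ^ j :: real) ^ Suc d * exp (- (1 / 32 * 2 ^ j)) \<le> (real (Suc d) / (1 / 32)) ^ Suc d"
    by (rule power_exp_neg_bound) auto
  then have "2 * 2 ^ d * ((2 ^ j) ^ Suc d * exp (- (1 / 32 * 2 ^ j))) \<le> B"
    unfolding B_def mult.assoc by (intro mult_left_mono) auto
  then show "2 * 2 ^ (d * Suc j) * exp (- (2 ^ j / 32)) \<le> B / 2 ^ j"
    by (simp add: field_simps power_add power_mult[symmetric])
qed

section \<open>Tail and exponential moments of one summand\<close>

context sv_truncated_variance
begin

lemma tail_eq: "tail M \<xi> y = \<P>(\<omega> in M. y < \<xi> \<omega>)"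
proof -
  have "cdf (distr M borel \<xi>) y = \<P>(\<omega> in M. \<xi> \<omega> \<le> y)"
    unfolding cdf_def by (subst measure_distr) (auto intro!: arg_cong[where f = prob])
  then show ?thesis
    unfolding tail_def using prob_neg[of "\<lambda>\<omega>. \<xi> \<omega> \<le> y"] by (simp add: not_le)
qed

lemma tail_nonneg: "0 \<le> tail M \<xi> y"
  by (simp add: tail_eq)

lemma antimono_tail: "antimono (tail M \<xi>)"
  unfolding tail_eq[abs_def] by (intro antimonoI finite_measure_mono) auto

lemma tail_eq_integral: "tail M \<xi> y = (LINT \<omega>|M. indicator {y<..} (\<xi> \<omega>))"
proof -
  have "(LINT \<omega>|M. indicator {y<..} (\<xi> \<omega>) :: real) = (LINT \<omega>|M. indicator {\<omega> \<in> space M. y < \<xi> \<omega>} \<omega>)"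
    by (intro Bochner_Integration.integral_cong) (auto simp: indicator_def)
  also have "\<dots> = \<P>(\<omega> in M. y < \<xi> \<omega>)" by simp
  finally show ?thesis by (simp add: tail_eq)
qed

lemma prob_abs_Y_le: "0 < y \<Longrightarrow> \<P>(\<omega> in M. y < \<bar>Y \<omega>\<bar>) \<le> tail_moment y / y"
proof -
  assume y: "0 < y"
  have "\<P>(\<omega> in M. y < \<bar>Y \<omega>\<bar>) = (LINT \<omega>|M. indicator {\<omega> \<in> space M. y < \<bar>Y \<omega>\<bar>} \<omega>)" by simp
  also have "\<dots> \<le> (LINT \<omega>|M. \<bar>Y \<omega>\<bar> * indicator {y<..} \<bar>Y \<omega>\<bar> / y)"
    using y by (intro integral_mono_AE' integrable_divide integrable_tail_Y) (auto simp: indicator_def field_simps)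
  finally show ?thesis by (simp add: tail_moment_def)
qed

text \<open>Passing from y to 2 y absorbs the mean once y >= |mean|; Markov's inequality on the tail
  then brings in \<open>tail_moment\<close>.\<close>

lemma tail_le_q:
  "\<forall>\<^sub>F y in at_top. tail M \<xi> (2 * y) \<le> V y / y\<^sup>2"
  using tail_moment_le[OF zero_less_one] eventually_gt_at_top[of 0] eventually_ge_at_top[of "\<bar>mean M \<xi>\<bar>"]
proof eventually_elim
  case (elim y)
  have "tail M \<xi> (2 * y) \<le> \<P>(\<omega> in M. y < \<bar>Y \<omega>\<bar>)"
    unfolding tail_eq using elim by (intro finite_measure_mono) (auto simp: Y_def)
  also have "\<dots> \<le> tail_moment y / y" using elim by (intro prob_abs_Y_le) auto
  also have "\<dots> \<le> V y / y / y" using elim by (intro divide_right_mono) auto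
  finally show ?case by (simp add: power2_eq_square)
qed

text \<open>The quadratic part and the tail part each contribute (1 / 16)^2, together 1 / 128. The
  cut is one-sided and uncentred, so u may exceed 1, but only up to 3 / 2, where its square is
  dominated by a linear term. The tilt 1 / 16 is small enough for the variance cost to stay within
  half of the gain in \<open>exponent\<close>.\<close>

lemma one_sided_mgf:
  "\<forall>\<^sub>F y in at_top. (LINT \<omega>|M. indicator {..y} (\<xi> \<omega>) * exp (1 / 16 * (Y \<omega> / y))) \<le> exp (1 / 128 * (V y / y\<^sup>2))"
proof -
  have "\<forall>\<^sub>F y in at_top. tail_moment y \<le> 1 / 16 * (V y / y)" by (rule tail_moment_le) simp
  then show ?thesis
    using eventually_ge_at_top[of "2 * \<bar>mean M \<xi>\<bar> + 1"]
  proof eventually_elim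
    case (elim y)
    have y: "0 < y" using elim by linarith
    have bd: "indicator {..y} (\<xi> \<omega>) * exp (1 / 16 * (Y \<omega> / y))
        \<le> 1 + Y \<omega> / y / 16 + (Y \<omega>)\<^sup>2 * indicator {..y} \<bar>Y \<omega>\<bar> / y\<^sup>2 / 256 + \<bar>Y \<omega>\<bar> * indicator {y<..} \<bar>Y \<omega>\<bar> / y / 16" for \<omega>
    proof -
      define u where "u = Y \<omega> / y"
      have i1: "\<bar>Y \<omega>\<bar> * indicator {y<..} \<bar>Y \<omega>\<bar> / y = \<bar>u\<bar> * indicator {1<..} \<bar>u\<bar>"
        and i2: "(Y \<omega>)\<^sup>2 * indicator {..y} \<bar>Y \<omega>\<bar> / y\<^sup>2 = u\<^sup>2 * indicator {..1} \<bar>u\<bar>"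
        using y by (auto simp: u_def indicator_def power_divide)
      have u_le: "u \<le> 3 / 2" if "\<xi> \<omega> \<le> y"
        using that elim y by (auto simp: u_def Y_def field_simps)
      show ?thesis
      proof (cases "\<xi> \<omega> \<le> y")
        case True
        consider "\<bar>u\<bar> \<le> 1" | "1 < u" | "u < - 1" by linarith
        then have "exp (1 / 16 * u) \<le> 1 + u / 16 + u\<^sup>2 * indicator {..1} \<bar>u\<bar> / 256 + \<bar>u\<bar> * indicator {1<..} \<bar>u\<bar> / 16"
        proof cases
          case 1
          then show ?thesis using exp_le_quadratic[of "1 / 16 * u"] by (simp add: power_mult_distrib power_divide)
        next
          case 2
          have "u * u \<le> 3 / 2 * u" using 2 u_le[OF True] by (intro mult_right_mono) auto
          moreover have "exp (1 / 16 * u) \<le> 1 + 1 / 16 * u + u * u / 256"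
            using 2 exp_le_quadratic[of "1 / 16 * u"] u_le[OF True] by (simp add: power2_eq_square)
          ultimately have "exp (1 / 16 * u) \<le> 1 + u / 16 + u / 16" using 2 by argo
          then show ?thesis using 2 by simp
        next
          case 3
          then show ?thesis by simp
        qed
        then show ?thesis using True unfolding i1 i2 u_def[symmetric] by simp
      next
        case False
        have "\<bar>u\<bar> \<le> 1 \<or> 1 < u \<or> u < -1" by linarith
        moreover have "0 \<le> u\<^sup>2 * indicator {..1} \<bar>u\<bar>" "0 \<le> \<bar>u\<bar> * indicator {1<..} \<bar>u\<bar>" by auto
        ultimately have "0 \<le> 1 + u / 16 + u\<^sup>2 * indicator {..1} \<bar>u\<bar> / 256 + \<bar>u\<bar> * indicator {1<..} \<bar>u\<bar> / 16"
          by (auto simp: indicator_def)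
        then show ?thesis using False unfolding i1 i2 u_def[symmetric] by simp
      qed
    qed
    have int_rhs: "integrable M (\<lambda>\<omega>. 1 + Y \<omega> / y / 16 + (Y \<omega>)\<^sup>2 * indicator {..y} \<bar>Y \<omega>\<bar> / y\<^sup>2 / 256 + \<bar>Y \<omega>\<bar> * indicator {y<..} \<bar>Y \<omega>\<bar> / y / 16)"
      by (intro Bochner_Integration.integrable_add integrable_divide integrable_Y integrable_trunc_sq integrable_tail_Y) simp
    have "(LINT \<omega>|M. indicator {..y} (\<xi> \<omega>) * exp (1 / 16 * (Y \<omega> / y)))
        \<le> (LINT \<omega>|M. 1 + Y \<omega> / y / 16 + (Y \<omega>)\<^sup>2 * indicator {..y} \<bar>Y \<omega>\<bar> / y\<^sup>2 / 256 + \<bar>Y \<omega>\<bar> * indicator {y<..} \<bar>Y \<omega>\<bar> / y / 16)"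
      by (rule integral_mono_AE'[OF int_rhs]) (intro AE_I2 bd order_trans[OF _ bd]; simp)+
    also have "\<dots> = 1 + V y / y\<^sup>2 / 256 + tail_moment y / y / 16"
      using y by (simp add: integrable_Y integrable_trunc_sq integrable_tail_Y integral_Y prob_space V_eq tail_moment_def)
    also have "\<dots> \<le> 1 + V y / y\<^sup>2 / 256 + (1 / 16 * (V y / y)) / y / 16"
      using elim y by (intro add_left_mono divide_right_mono) auto
    also have "\<dots> = 1 + 1 / 128 * (V y / y\<^sup>2)" by (simp add: power2_eq_square)
    also have "\<dots> \<le> exp (1 / 128 * (V y / y\<^sup>2))" by (rule exp_ge_add_one_self)
    finally show ?case .
  qed
qed

text \<open>The sign s serves both tails at once. With a two-sided cut the exponent stays in
  [-1, 1], so the quadratic bound for exp applies directly.\<close>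

lemma two_sided_mgf:
  assumes s: "\<bar>s\<bar> = 1"
  shows "\<forall>\<^sub>F y in at_top. (LINT \<omega>|M. indicator {..y} \<bar>Y \<omega>\<bar> * exp (s * (Y \<omega> / y))) \<le> exp (2 * (V y / y\<^sup>2))"
  using tail_moment_le[OF zero_less_one] eventually_gt_at_top[of 0]
proof eventually_elim
  case (elim y)
  have bd: "indicator {..y} \<bar>Y \<omega>\<bar> * exp (s * (Y \<omega> / y))
      \<le> 1 + s * (Y \<omega> / y) + (Y \<omega>)\<^sup>2 * indicator {..y} \<bar>Y \<omega>\<bar> / y\<^sup>2 + \<bar>Y \<omega>\<bar> * indicator {y<..} \<bar>Y \<omega>\<bar> / y" for \<omega>
  proof (cases "\<bar>Y \<omega>\<bar> \<le> y")
    case True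
    have "\<bar>s * (Y \<omega> / y)\<bar> \<le> 1" using True s elim by (simp add: abs_mult)
    then have "exp (s * (Y \<omega> / y)) \<le> 1 + s * (Y \<omega> / y) + (s * (Y \<omega> / y))\<^sup>2" by (rule exp_le_quadratic)
    also have "(s * (Y \<omega> / y))\<^sup>2 = (Y \<omega>)\<^sup>2 / y\<^sup>2"
    proof -
      have "s\<^sup>2 = 1" using s by (metis power2_abs one_power2)
      then show ?thesis by (simp add: power_mult_distrib power_divide)
    qed
    finally show ?thesis using True by simp
  next
    case False
    have "\<bar>s * (Y \<omega> / y)\<bar> = \<bar>Y \<omega>\<bar> / y" using s elim by (simp add: abs_mult)
    then have "- (s * (Y \<omega> / y)) \<le> \<bar>Y \<omega>\<bar> / y" using abs_ge_minus_self[of "s * (Y \<omega> / y)"] by simp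
    then have "0 \<le> 1 + s * (Y \<omega> / y) + \<bar>Y \<omega>\<bar> / y" by argo
    then show ?thesis using False by simp
  qed
  have int_rhs: "integrable M (\<lambda>\<omega>. 1 + s * (Y \<omega> / y) + (Y \<omega>)\<^sup>2 * indicator {..y} \<bar>Y \<omega>\<bar> / y\<^sup>2 + \<bar>Y \<omega>\<bar> * indicator {y<..} \<bar>Y \<omega>\<bar> / y)"
    by (intro Bochner_Integration.integrable_add integrable_mult_right integrable_divide integrable_Y integrable_trunc_sq integrable_tail_Y) simp
  have "(LINT \<omega>|M. indicator {..y} \<bar>Y \<omega>\<bar> * exp (s * (Y \<omega> / y)))
      \<le> (LINT \<omega>|M. 1 + s * (Y \<omega> / y) + (Y \<omega>)\<^sup>2 * indicator {..y} \<bar>Y \<omega>\<bar> / y\<^sup>2 + \<bar>Y \<omega>\<bar> * indicator {y<..} \<bar>Y \<omega>\<bar> / y)"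
    by (rule integral_mono_AE'[OF int_rhs]) (intro AE_I2 bd order_trans[OF _ bd]; simp)+
  also have "\<dots> = 1 + V y / y\<^sup>2 + tail_moment y / y"
    using elim by (simp add: integrable_Y integrable_trunc_sq integrable_tail_Y integral_Y prob_space V_eq tail_moment_def)
  also have "\<dots> \<le> 1 + V y / y\<^sup>2 + (1 * (V y / y)) / y"
    using elim by (intro add_left_mono divide_right_mono) auto
  also have "\<dots> = 1 + 2 * (V y / y\<^sup>2)" by (simp add: power2_eq_square)
  also have "\<dots> \<le> exp (2 * (V y / y\<^sup>2))" by (rule exp_ge_add_one_self)
  finally show ?case .
qed

end

section \<open>Chernoff bounds for sums over index sets\<close>

context sv_iid
begin

abbreviation "\<mu> \<equiv> mean M \<xi>"

text \<open>General index sets instead of initial segments, since a jump is removed from the sum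
  before the remainder is estimated.\<close>

abbreviation dev :: "nat set \<Rightarrow> 'a \<Rightarrow> real" where
  "dev J \<omega> \<equiv> (\<Sum>l\<in>J. X l \<omega> - \<mu>)"

lemma measurable_dev: "J \<subseteq> {1..} \<Longrightarrow> dev J \<in> borel_measurable M"
  by (intro borel_measurable_sum borel_measurable_diff measurable_X) auto

lemma measurable_dev_Icc [measurable]: "dev {1..n} \<in> borel_measurable M"
  by (intro measurable_dev) auto

lemma prob_X_gt: "1 \<le> i \<Longrightarrow> \<P>(\<omega> in M. s < X i \<omega>) = tail M \<xi> s"
proof -
  assume i: "1 \<le> i"
  have "\<P>(\<omega> in M. s < X i \<omega>) = measure (distr M borel (X i)) {s<..}"
    using measurable_X[OF i] by (subst measure_distr) (auto intro!: arg_cong[where f = prob])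
  also have "\<dots> = measure (distr M borel \<xi>) {s<..}" by (simp add: distr_X[OF i])
  also have "\<dots> = \<P>(\<omega> in M. s < \<xi> \<omega>)"
    by (subst measure_distr) (auto intro!: arg_cong[where f = prob])
  finally show ?thesis by (simp add: tail_eq)
qed

lemma prob_abs_X_gt: "1 \<le> i \<Longrightarrow> \<P>(\<omega> in M. y < \<bar>X i \<omega> - \<mu>\<bar>) = \<P>(\<omega> in M. y < \<bar>Y \<omega>\<bar>)"
proof -
  assume i: "1 \<le> i"
  have "\<P>(\<omega> in M. y < \<bar>X i \<omega> - \<mu>\<bar>) = measure (distr M borel (X i)) {s. y < \<bar>s - \<mu>\<bar>}"
    using measurable_X[OF i] by (subst measure_distr) (auto intro!: arg_cong[where f = prob])
  also have "\<dots> = measure (distr M borel \<xi>) {s. y < \<bar>s - \<mu>\<bar>}" by (simp add: distr_X[OF i])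
  also have "\<dots> = \<P>(\<omega> in M. y < \<bar>Y \<omega>\<bar>)"
    by (subst measure_distr) (auto intro!: arg_cong[where f = prob] simp: Y_def)
  finally show ?thesis .
qed

lemma prob_X_gt_dev:
  assumes i: "1 \<le> i" "i \<notin> J" and J: "finite J" "J \<subseteq> {1..}" and B: "B \<in> sets borel"
  shows "\<P>(\<omega> in M. s < X i \<omega> \<and> dev J \<omega> \<in> B) = tail M \<xi> s * \<P>(\<omega> in M. dev J \<omega> \<in> B)"
proof -
  have "indep_vars (\<lambda>_. borel) (\<lambda>j \<omega>. X j \<omega> - \<mu>) (insert i J)"
    using indep_X[of "insert i J" "\<lambda>_ y. y - \<mu>"] i J by auto
  then have ind: "indep_var borel (\<lambda>\<omega>. X i \<omega> - \<mu>) borel (dev J)"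
    by (rule indep_vars_sum[OF J(1) i(2)])
  have "\<P>(\<omega> in M. s < X i \<omega> \<and> dev J \<omega> \<in> B) = prob ((\<lambda>\<omega>. (X i \<omega> - \<mu>, dev J \<omega>)) -` ({s - \<mu><..} \<times> B) \<inter> space M)"
    by (rule arg_cong[where f = prob]) auto
  also have "\<dots> = prob ((\<lambda>\<omega>. X i \<omega> - \<mu>) -` {s - \<mu><..} \<inter> space M) * prob (dev J -` B \<inter> space M)"
    using B by (intro indep_varD[OF ind]) auto
  also have "(\<lambda>\<omega>. X i \<omega> - \<mu>) -` {s - \<mu><..} \<inter> space M = {\<omega> \<in> space M. s < X i \<omega>}" by auto
  also have "dev J -` B \<inter> space M = {\<omega> \<in> space M. dev J \<omega> \<in> B}" by auto
  finally show ?thesis by (simp only: prob_X_gt[OF i(1)])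
qed

text \<open>Markov's inequality for a product. The factors may depend on the index, so that one
  summand can be singled out as the jump, and truncations enter as indicators inside the
  factors.\<close>

lemma chernoff_prod:
  fixes g :: "nat \<Rightarrow> real \<Rightarrow> real"
  assumes J: "finite J" "J \<subseteq> {1..}" and g: "\<And>j. j \<in> J \<Longrightarrow> g j \<in> borel_measurable borel"
    and int: "\<And>j. j \<in> J \<Longrightarrow> integrable M (\<lambda>\<omega>. g j (\<xi> \<omega>))"
    and nonneg: "\<And>j y. j \<in> J \<Longrightarrow> 0 \<le> g j y"
    and A: "A \<in> events" "\<And>\<omega>. \<omega> \<in> A \<Longrightarrow> exp a \<le> (\<Prod>j\<in>J. g j (X j \<omega>))"
  shows "prob A \<le> exp (- a) * (\<Prod>j\<in>J. LINT \<omega>|M. g j (\<xi> \<omega>))"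
proof -
  have prod_nn: "0 \<le> (\<Prod>j\<in>J. g j (X j \<omega>))" for \<omega> using nonneg by (intro prod_nonneg) auto
  have "prob A = (LINT \<omega>|M. indicator A \<omega>)" using A(1) by simp
  also have "\<dots> \<le> (LINT \<omega>|M. exp (- a) * (\<Prod>j\<in>J. g j (X j \<omega>)))"
  proof (rule integral_mono_AE')
    show "integrable M (\<lambda>\<omega>. exp (- a) * (\<Prod>j\<in>J. g j (X j \<omega>)))"
      by (intro integrable_mult_right prod_X(2)[OF J g int])
    show "AE \<omega> in M. indicator A \<omega> \<le> exp (- a) * (\<Prod>j\<in>J. g j (X j \<omega>))"
    proof (intro AE_I2)
      fix \<omega>
      show "indicator A \<omega> \<le> exp (- a) * (\<Prod>j\<in>J. g j (X j \<omega>))"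
      proof (cases "\<omega> \<in> A")
        case True
        from mult_left_mono[OF A(2)[OF True], of "exp (- a)"] show ?thesis
          using True by (simp add: exp_add[symmetric])
      qed (simp add: prod_nn)
    qed
    show "AE \<omega> in M. 0 \<le> exp (- a) * (\<Prod>j\<in>J. g j (X j \<omega>))" using prod_nn by simp
  qed
  also have "\<dots> = exp (- a) * (\<Prod>j\<in>J. LINT \<omega>|M. g j (\<xi> \<omega>))"
    by (simp add: prod_X(1)[OF J g int])
  finally show ?thesis .
qed

definition mgf :: "real \<Rightarrow> real" where
  "mgf y = (LINT \<omega>|M. indicator {..y} (\<xi> \<omega>) * exp (1 / 16 * (Y \<omega> / y)))"

lemma integrable_indicator_exp:
  assumes "0 < y" and [measurable]: "B \<in> sets borel" and "B \<subseteq> {..y}"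
  shows "integrable M (\<lambda>\<omega>. indicator B (\<xi> \<omega>) * exp (1 / 16 * ((\<xi> \<omega> - \<mu>) / y)))"
proof (rule integrable_const_bound[where B = "exp (1 / 16 * ((y - \<mu>) / y))"])
  show "AE \<omega> in M. norm (indicator B (\<xi> \<omega>) * exp (1 / 16 * ((\<xi> \<omega> - \<mu>) / y))) \<le> exp (1 / 16 * ((y - \<mu>) / y))"
    using assms by (intro AE_I2) (auto simp: indicator_def divide_right_mono)
qed simp

lemma mgf_nonneg: "0 \<le> mgf y"
  unfolding mgf_def by (intro integral_nonneg_AE AE_I2) auto

lemma prod_exp_dev: "finite J \<Longrightarrow> (\<Prod>j\<in>J. exp (c * ((X j \<omega> - \<mu>) / y))) = exp (c * (dev J \<omega> / y))"
  by (simp add: exp_sum[symmetric] sum_distrib_left sum_divide_distrib)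

context
  fixes n :: nat and x z y :: real
  assumes n: "1 \<le> n" and x: "0 < x" "x \<le> z" and y: "0 < y"
    and mgf_le: "mgf y \<le> exp (1 / 128 * (V y / y\<^sup>2))" and var: "real n * V y \<le> 4 * x * y"
begin

text \<open>With n V(y) <= 4 x y the variance term is at most 4 x / (128 y) = x / (32 y), which is
  at most half of the gain z / (16 y) because x <= z.\<close>

private lemma exponent: "exp (- (1 / 16 * (z / y))) * exp (1 / 128 * (V y / y\<^sup>2)) ^ n \<le> exp (- (z / (32 * y)))"
proof -
  have "real n * (1 / 128 * (V y / y\<^sup>2)) = real n * V y / (128 * y\<^sup>2)" by simp
  also have "\<dots> \<le> 4 * x * y / (128 * y\<^sup>2)" using var by (intro divide_right_mono) auto
  also have "\<dots> = x / (32 * y)" using y by (simp add: power2_eq_square)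
  also have "\<dots> \<le> z / (32 * y)" using x y by (intro divide_right_mono) auto
  finally have "- (1 / 16 * (z / y)) + real n * (1 / 128 * (V y / y\<^sup>2)) \<le> - (z / (32 * y))" by simp
  then show ?thesis by (simp only: exp_of_nat_mult[symmetric] exp_add[symmetric] exp_le_cancel_iff)
qed

lemma prob_no_jump_le: "\<P>(\<omega> in M. z \<le> dev {1..n} \<omega> \<and> pmax X n \<omega> \<le> y) \<le> exp (- (z / (32 * y)))"
proof -
  note [measurable] = measurable_pmax[OF n]
  let ?g = "\<lambda>s. indicator {..y} s * exp (1 / 16 * ((s - \<mu>) / y))"
  have "\<P>(\<omega> in M. z \<le> dev {1..n} \<omega> \<and> pmax X n \<omega> \<le> y) \<le> exp (- (1 / 16 * (z / y))) * (\<Prod>j\<in>{1..n}. LINT \<omega>|M. ?g (\<xi> \<omega>))"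
  proof (rule chernoff_prod)
    fix \<omega> assume \<omega>: "\<omega> \<in> {\<omega> \<in> space M. z \<le> dev {1..n} \<omega> \<and> pmax X n \<omega> \<le> y}"
    then have "(\<Prod>j\<in>{1..n}. ?g (X j \<omega>)) = (\<Prod>j\<in>{1..n}. exp (1 / 16 * ((X j \<omega> - \<mu>) / y)))"
      using n by (intro prod.cong) (auto simp: pmax_le_iff)
    also have "\<dots> = exp (1 / 16 * (dev {1..n} \<omega> / y))" by (rule prod_exp_dev) simp
    finally show "exp (1 / 16 * (z / y)) \<le> (\<Prod>j\<in>{1..n}. ?g (X j \<omega>))"
      using \<omega> y by (simp add: divide_right_mono)
  qed (use integrable_indicator_exp[OF y, of "{..y}"] in auto)
  also have "(\<Prod>j\<in>{1..n}. LINT \<omega>|M. ?g (\<xi> \<omega>)) = mgf y ^ n" by (simp add: mgf_def Y_def)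
  also have "exp (- (1 / 16 * (z / y))) * mgf y ^ n \<le> exp (- (1 / 16 * (z / y))) * exp (1 / 128 * (V y / y\<^sup>2)) ^ n"
    using mgf_le mgf_nonneg by (intro mult_left_mono power_mono) auto
  also note exponent
  finally show ?thesis .
qed

text \<open>A union bound over the index that jumps. Its factor is restricted to (y / 2, y], where
  the exponential is at most 2, and so contributes the tail at y / 2; the remaining factors keep the
  Chernoff gain.\<close>

lemma prob_jump_le:
  assumes y': "2 * \<bar>\<mu>\<bar> + 1 \<le> y"
  shows "\<P>(\<omega> in M. z \<le> dev {1..n} \<omega> \<and> y / 2 < pmax X n \<omega> \<and> pmax X n \<omega> \<le> y)
    \<le> real n * (2 * tail M \<xi> (y / 2) * exp (- (z / (32 * y))))"
proof -
  note [measurable] = measurable_pmax[OF n]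
  let ?A = "\<lambda>i. {\<omega> \<in> space M. z \<le> dev {1..n} \<omega> \<and> y / 2 < X i \<omega> \<and> pmax X n \<omega> \<le> y}"
  have A: "?A i \<in> events" if "i \<in> {1..n}" for i
    using measurable_X_Icc[OF that] by measurable
  let ?g = "\<lambda>s. indicator {..y} s * exp (1 / 16 * ((s - \<mu>) / y))"
  let ?g' = "\<lambda>s. indicator {y / 2<..y} s * exp (1 / 16 * ((s - \<mu>) / y))"
  have int: "integrable M (\<lambda>\<omega>. ?g (\<xi> \<omega>))" and int': "integrable M (\<lambda>\<omega>. ?g' (\<xi> \<omega>))"
    by (intro integrable_indicator_exp y; auto)+
  have g': "(LINT \<omega>|M. ?g' (\<xi> \<omega>)) \<le> 2 * tail M \<xi> (y / 2)"
  proof -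
    have "(LINT \<omega>|M. ?g' (\<xi> \<omega>)) \<le> (LINT \<omega>|M. 2 * indicator {y / 2<..} (\<xi> \<omega>))"
    proof (intro integral_mono integrable_indicator_exp y)
      show "integrable M (\<lambda>\<omega>. 2 * indicator {y / 2<..} (\<xi> \<omega>) :: real)"
        by (rule integrable_const_bound[where B = 2]) (auto simp: indicator_def)
      fix \<omega>
      show "?g' (\<xi> \<omega>) \<le> 2 * indicator {y / 2<..} (\<xi> \<omega>)"
      proof (cases "\<xi> \<omega> \<in> {y / 2<..y}")
        case True
        have "(\<xi> \<omega> - \<mu>) / y \<le> (3 / 2 * y) / y" using True y y' by (intro divide_right_mono) auto
        also have "(3 / 2 * y) / y = 3 / 2" using y by simp
        finally have "1 / 16 * ((\<xi> \<omega> - \<mu>) / y) \<le> 3 / 32" by linarith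
        then have "exp (1 / 16 * ((\<xi> \<omega> - \<mu>) / y)) \<le> exp (3 / 32)" by (simp only: exp_le_cancel_iff)
        also have "\<dots> \<le> 1 + 3 / 32 + (3 / 32)\<^sup>2" by (rule exp_le_quadratic) simp
        also have "\<dots> \<le> 2" by (simp add: power2_eq_square)
        finally show ?thesis using True by simp
      qed (simp add: indicator_def)
    qed auto
    then show ?thesis by (simp add: tail_eq_integral)
  qed
  have "prob (?A i) \<le> 2 * tail M \<xi> (y / 2) * exp (- (z / (32 * y)))" if i: "i \<in> {1..n}" for i
  proof -
    let ?h = "\<lambda>j. if j = i then ?g' else ?g"
    have "prob (?A i) \<le> exp (- (1 / 16 * (z / y))) * (\<Prod>j\<in>{1..n}. LINT \<omega>|M. ?h j (\<xi> \<omega>))"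
    proof (rule chernoff_prod)
      show "?A i \<in> events" by (rule A[OF i])
      fix \<omega> assume \<omega>: "\<omega> \<in> ?A i"
      then have "(\<Prod>j\<in>{1..n}. ?h j (X j \<omega>)) = (\<Prod>j\<in>{1..n}. exp (1 / 16 * ((X j \<omega> - \<mu>) / y)))"
        using n by (intro prod.cong) (auto simp: pmax_le_iff)
      also have "\<dots> = exp (1 / 16 * (dev {1..n} \<omega> / y))" by (rule prod_exp_dev) simp
      finally show "exp (1 / 16 * (z / y)) \<le> (\<Prod>j\<in>{1..n}. ?h j (X j \<omega>))"
        using \<omega> y by (simp add: divide_right_mono)
    qed (use int int' in auto)
    also have "(\<Prod>j\<in>{1..n}. LINT \<omega>|M. ?h j (\<xi> \<omega>)) = (LINT \<omega>|M. ?g' (\<xi> \<omega>)) * (\<Prod>j\<in>{1..n} - {i}. LINT \<omega>|M. ?g (\<xi> \<omega>))"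
      using i by (subst prod.remove[of _ i]) (auto intro!: prod.cong)
    also have "(\<Prod>j\<in>{1..n} - {i}. LINT \<omega>|M. ?g (\<xi> \<omega>)) = mgf y ^ (n - 1)"
      using i by (simp add: mgf_def Y_def)
    also have "exp (- (1 / 16 * (z / y))) * ((LINT \<omega>|M. ?g' (\<xi> \<omega>)) * mgf y ^ (n - 1))
        \<le> exp (- (1 / 16 * (z / y))) * ((2 * tail M \<xi> (y / 2)) * exp (1 / 128 * (V y / y\<^sup>2)) ^ n)"
    proof (intro mult_left_mono mult_mono g')
      have "mgf y ^ (n - 1) \<le> exp (1 / 128 * (V y / y\<^sup>2)) ^ (n - 1)"
        using mgf_le mgf_nonneg by (intro power_mono) auto
      \<comment> \<open>The base is at least 1, so restoring the removed factor is harmless and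
        \<open>exponent\<close> applies.\<close>
      also have "\<dots> \<le> exp (1 / 128 * (V y / y\<^sup>2)) ^ n"
        using V_nonneg[of y] by (intro power_increasing) auto
      finally show "mgf y ^ (n - 1) \<le> exp (1 / 128 * (V y / y\<^sup>2)) ^ n" .
    qed (auto simp: tail_nonneg mgf_nonneg)
    also have "\<dots> = 2 * tail M \<xi> (y / 2) * (exp (- (1 / 16 * (z / y))) * exp (1 / 128 * (V y / y\<^sup>2)) ^ n)"
      by (simp add: mult.left_commute mult.assoc)
    also have "\<dots> \<le> 2 * tail M \<xi> (y / 2) * exp (- (z / (32 * y)))"
      using exponent tail_nonneg by (intro mult_left_mono) auto
    finally show ?thesis .
  qed
  then have "(\<Sum>i\<in>{1..n}. prob (?A i)) \<le> real n * (2 * tail M \<xi> (y / 2) * exp (- (z / (32 * y))))"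
    using sum_bounded_above[of "{1..n}" "\<lambda>i. prob (?A i)"] by simp
  moreover have "\<P>(\<omega> in M. z \<le> dev {1..n} \<omega> \<and> y / 2 < pmax X n \<omega> \<and> pmax X n \<omega> \<le> y) \<le> prob (\<Union>i\<in>{1..n}. ?A i)"
  proof (rule finite_measure_mono)
    show "{\<omega> \<in> space M. z \<le> dev {1..n} \<omega> \<and> y / 2 < pmax X n \<omega> \<and> pmax X n \<omega> \<le> y} \<subseteq> (\<Union>i\<in>{1..n}. ?A i)"
      using pmax_le_iff[OF n, of _ "y / 2"] by (auto simp: not_le[symmetric])
  qed (use A in auto)
  moreover have "prob (\<Union>i\<in>{1..n}. ?A i) \<le> (\<Sum>i\<in>{1..n}. prob (?A i))"
    using A by (intro finite_measure_subadditive_finite) auto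
  ultimately show ?thesis by linarith
qed

end

text \<open>Descending induction over the dyadic levels, which stops once the level falls below \<open>r\<close>
  (the event is empty) or below \<open>Y0\<close> (the Chernoff bound suffices).\<close>

lemma prob_medium_jump_le:
  assumes n: "1 \<le> n" and x: "0 < x" "x \<le> z" and X0: "0 < X0" "2 * X0 \<le> Y0" "2 * \<bar>\<mu>\<bar> + 1 \<le> Y0"
    and mgf_le: "\<And>y. Y0 \<le> y \<Longrightarrow> mgf y \<le> exp (1 / 128 * (V y / y\<^sup>2))"
    and var: "\<And>y. max r Y0 \<le> y \<Longrightarrow> real n * V y \<le> 4 * x * y"
    and dbl: "\<And>w. X0 \<le> w \<Longrightarrow> tail M \<xi> w \<le> 2 ^ d * tail M \<xi> (2 * w)"
    and B: "0 < B" "\<And>j::nat. 2 * 2 ^ (d * Suc j) * exp (- (2 ^ j / 32)) \<le> B / 2 ^ j"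
  shows "\<P>(\<omega> in M. z \<le> dev {1..n} \<omega> \<and> r < pmax X n \<omega> \<and> pmax X n \<omega> \<le> z / 2 ^ j)
    \<le> 2 * (B / 2 ^ j) * (real n * tail M \<xi> z) + exp (- (z / (32 * Y0)))"
proof -
  note [measurable] = measurable_pmax[OF n]
  have Y0: "0 < Y0" using X0 by linarith
  define p where "p y = \<P>(\<omega> in M. z \<le> dev {1..n} \<omega> \<and> r < pmax X n \<omega> \<and> pmax X n \<omega> \<le> y)" for y
  have z: "0 < z" using x by linarith
  have nt: "0 \<le> real n * tail M \<xi> z" using tail_nonneg by simp
  have p_0: "p y = 0" if "y \<le> r" for y
  proof -
    have "{\<omega> \<in> space M. z \<le> dev {1..n} \<omega> \<and> r < pmax X n \<omega> \<and> pmax X n \<omega> \<le> y} = {}" using that by auto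
    then show ?thesis unfolding p_def by (simp only: measure_empty)
  qed
  have base: "p y \<le> 2 * (B / 2 ^ j) * (real n * tail M \<xi> z) + exp (- (z / (32 * Y0)))" if "y \<le> Y0" for y and j :: nat
  proof -
    have "p y \<le> exp (- (z / (32 * Y0)))"
    proof (cases "y \<le> r")
      case True
      then show ?thesis by (simp add: p_0)
    next
      case False
      have "p y \<le> \<P>(\<omega> in M. z \<le> dev {1..n} \<omega> \<and> pmax X n \<omega> \<le> Y0)"
        unfolding p_def using that by (intro finite_measure_mono) auto
      also have "\<dots> \<le> exp (- (z / (32 * Y0)))"
        using False that by (intro prob_no_jump_le[OF n x Y0 mgf_le var]) auto
      finally show ?thesis .
    qed
    moreover have "0 \<le> 2 * (B / 2 ^ j) * (real n * tail M \<xi> z)" using nt B by simp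
    ultimately show ?thesis by linarith
  qed
  have "p (z / 2 ^ j) \<le> 2 * (B / 2 ^ j) * (real n * tail M \<xi> z) + exp (- (z / (32 * Y0)))"
    if "z / 2 ^ j \<le> 2 ^ k * Y0" for j k
    using that
  proof (induction k arbitrary: j)
    case 0
    then show ?case by (intro base) simp
  next
    case (Suc k)
    let ?y = "z / 2 ^ j"
    show ?case
    proof (cases "?y \<le> Y0 \<or> ?y \<le> r")
      case True
      then show ?thesis
      proof
        assume "?y \<le> r"
        then show ?thesis using nt B by (simp add: p_0)
      qed (rule base)
    next
      case False
      then have y: "0 < ?y" "Y0 \<le> ?y" "r \<le> ?y" using Y0 by auto
      \<comment> \<open>This level costs B / 2^j and the lower ones 2 B / 2^(j + 1) by induction;
        the sum is 2 B / 2^j again.\<close>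
      have "p ?y \<le> p (?y / 2) + \<P>(\<omega> in M. z \<le> dev {1..n} \<omega> \<and> ?y / 2 < pmax X n \<omega> \<and> pmax X n \<omega> \<le> ?y)"
        unfolding p_def
        by (rule order_trans[OF finite_measure_mono measure_Un_le]) auto
      also have "p (?y / 2) \<le> 2 * (B / 2 ^ Suc j) * (real n * tail M \<xi> z) + exp (- (z / (32 * Y0)))"
        using Suc.IH[of "Suc j"] Suc.prems by (simp add: mult.commute)
      also have "\<P>(\<omega> in M. z \<le> dev {1..n} \<omega> \<and> ?y / 2 < pmax X n \<omega> \<and> pmax X n \<omega> \<le> ?y)
          \<le> real n * (2 * tail M \<xi> (?y / 2) * exp (- (z / (32 * ?y))))"
        using y X0 by (intro prob_jump_le[OF n x y(1) mgf_le var]) auto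
      also have "real n * (2 * tail M \<xi> (?y / 2) * exp (- (z / (32 * ?y)))) \<le> real n * (B / 2 ^ j * tail M \<xi> z)"
      proof (rule mult_left_mono)
        have e: "z / (32 * ?y) = 2 ^ j / 32" using z by simp
        have "tail M \<xi> (?y / 2) = tail M \<xi> (z / 2 ^ Suc j)" by (simp add: mult.commute)
        also have "\<dots> \<le> 2 ^ (d * Suc j) * tail M \<xi> z"
        proof (rule doubling_iterate[where f = "tail M \<xi>" and ?X0.0 = X0 and d = d, OF dbl X0(1)])
          have "X0 \<le> ?y / 2" using y X0 by simp
          then show "X0 \<le> z / 2 ^ Suc j" by (simp add: mult.commute)
        qed
        finally have "2 * tail M \<xi> (?y / 2) * exp (- (2 ^ j / 32)) \<le> 2 * (2 ^ (d * Suc j) * tail M \<xi> z) * exp (- (2 ^ j / 32))"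
          by (intro mult_right_mono mult_left_mono) auto
        also have "\<dots> = (2 * 2 ^ (d * Suc j) * exp (- (2 ^ j / 32))) * tail M \<xi> z" by simp
        also have "\<dots> \<le> B / 2 ^ j * tail M \<xi> z" using B(2) tail_nonneg by (intro mult_right_mono) auto
        finally show "2 * tail M \<xi> (?y / 2) * exp (- (z / (32 * ?y))) \<le> B / 2 ^ j * tail M \<xi> z"
          unfolding e .
      qed simp
      finally show ?thesis by (simp add: field_simps)
    qed
  qed
  moreover obtain k :: nat where "z / 2 ^ j / Y0 < 2 ^ k" using real_arch_pow[of 2] by auto
  ultimately show ?thesis using Y0 unfolding p_def by (simp add: field_simps) (meson less_imp_le)
qed

text \<open>A deviation bound that does not presuppose a finite variance: summands beyond y are
  charged by a union bound, and the rest by exponential moments with s = 1 and s = -1.\<close>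

lemma prob_dev_ge_le:
  assumes J: "finite J" "J \<subseteq> {1..}" and y: "0 < y"
    and tm: "tail_moment y \<le> V y / y"
    and mgf1: "\<And>s. \<bar>s\<bar> = 1 \<Longrightarrow> (LINT \<omega>|M. indicator {..y} \<bar>Y \<omega>\<bar> * exp (s * (Y \<omega> / y))) \<le> exp (2 * (V y / y\<^sup>2))"
  shows "\<P>(\<omega> in M. t \<le> \<bar>dev J \<omega>\<bar>) \<le> real (card J) * (V y / y\<^sup>2) + 2 * exp (- (t / y)) * exp (2 * (real (card J) * (V y / y\<^sup>2)))"
proof -
  have [measurable]: "dev J \<in> borel_measurable M" by (rule measurable_dev[OF J(2)])
  let ?B = "\<lambda>j. {\<omega> \<in> space M. y < \<bar>X j \<omega> - \<mu>\<bar>}"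
  let ?C = "\<lambda>s. {\<omega> \<in> space M. t \<le> s * dev J \<omega> \<and> (\<forall>j\<in>J. \<bar>X j \<omega> - \<mu>\<bar> \<le> y)}"
  have B: "?B j \<in> events" if "j \<in> J" for j
  proof -
    have [measurable]: "X j \<in> borel_measurable M" using that J by (intro measurable_X) auto
    show ?thesis by measurable
  qed
  have C: "?C s \<in> events" for s
  proof -
    have "?C s = {\<omega> \<in> space M. t \<le> s * dev J \<omega>} - (\<Union>j\<in>J. ?B j)" by (auto simp: not_less)
    also have "\<dots> \<in> events" using B J by (intro sets.Diff sets.finite_UN) auto
    finally show ?thesis .
  qed
  have "prob (?B j) \<le> V y / y\<^sup>2" if "j \<in> J" for j
  proof -
    have "prob (?B j) \<le> tail_moment y / y"
      using that J prob_abs_X_gt[of j y] prob_abs_Y_le[OF y] by auto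
    also have "\<dots> \<le> V y / y / y" using tm y by (intro divide_right_mono) auto
    finally show ?thesis by (simp add: power2_eq_square)
  qed
  then have sumB: "(\<Sum>j\<in>J. prob (?B j)) \<le> real (card J) * (V y / y\<^sup>2)"
    using sum_bounded_above[of J "\<lambda>j. prob (?B j)" "V y / y\<^sup>2"] by simp
  have probC: "prob (?C s) \<le> exp (- (t / y)) * exp (2 * (real (card J) * (V y / y\<^sup>2)))" if s: "\<bar>s\<bar> = 1" for s
  proof -
    let ?g = "\<lambda>w. indicator {..y} \<bar>w - \<mu>\<bar> * exp (s * ((w - \<mu>) / y))"
    have "prob (?C s) \<le> exp (- (t / y)) * (\<Prod>j\<in>J. LINT \<omega>|M. ?g (\<xi> \<omega>))"
    proof (rule chernoff_prod[OF J])
      show "integrable M (\<lambda>\<omega>. ?g (\<xi> \<omega>))"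
      proof (rule integrable_const_bound[where B = "exp 1"])
        show "AE \<omega> in M. norm (?g (\<xi> \<omega>)) \<le> exp 1"
        proof (intro AE_I2)
          fix \<omega>
          show "norm (?g (\<xi> \<omega>)) \<le> exp 1"
          proof (cases "\<bar>\<xi> \<omega> - \<mu>\<bar> \<le> y")
            case True
            have "s * ((\<xi> \<omega> - \<mu>) / y) \<le> \<bar>s * ((\<xi> \<omega> - \<mu>) / y)\<bar>" by (rule abs_ge_self)
            also have "\<dots> \<le> 1" using True s y by (simp add: abs_mult)
            finally show ?thesis using True by simp
          qed simp
        qed
      qed simp
      fix \<omega> assume \<omega>: "\<omega> \<in> ?C s"
      then have "(\<Prod>j\<in>J. ?g (X j \<omega>)) = (\<Prod>j\<in>J. exp (s * ((X j \<omega> - \<mu>) / y)))"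
        by (intro prod.cong) auto
      also have "\<dots> = exp (s * (dev J \<omega> / y))" by (rule prod_exp_dev[OF J(1)])
      finally show "exp (t / y) \<le> (\<Prod>j\<in>J. ?g (X j \<omega>))"
        using \<omega> y by (simp add: divide_right_mono)
    qed (use C in auto)
    also have "(\<Prod>j\<in>J. LINT \<omega>|M. ?g (\<xi> \<omega>)) = (LINT \<omega>|M. indicator {..y} \<bar>Y \<omega>\<bar> * exp (s * (Y \<omega> / y))) ^ card J"
      by (simp add: Y_def)
    also have "\<dots> \<le> exp (2 * (V y / y\<^sup>2)) ^ card J"
      by (intro power_mono mgf1 s integral_nonneg_AE AE_I2) auto
    also have "\<dots> = exp (2 * (real (card J) * (V y / y\<^sup>2)))"
      by (simp add: exp_of_nat_mult[symmetric] mult.left_commute)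
    finally show ?thesis by simp
  qed
  have UB: "(\<Union>j\<in>J. ?B j) \<in> events" by (rule sets.finite_UN[OF J(1) B])
  have "\<P>(\<omega> in M. t \<le> \<bar>dev J \<omega>\<bar>) \<le> prob ((\<Union>j\<in>J. ?B j) \<union> (?C 1 \<union> ?C (- 1)))"
  proof (rule finite_measure_mono)
    show "{\<omega> \<in> space M. t \<le> \<bar>dev J \<omega>\<bar>} \<subseteq> (\<Union>j\<in>J. ?B j) \<union> (?C 1 \<union> ?C (- 1))"
    proof
      fix \<omega> assume \<omega>: "\<omega> \<in> {\<omega> \<in> space M. t \<le> \<bar>dev J \<omega>\<bar>}"
      then have "t \<le> 1 * dev J \<omega> \<or> t \<le> (- 1) * dev J \<omega>"
        by (cases "0 \<le> dev J \<omega>") (simp_all only: mem_Collect_eq abs_of_nonneg abs_of_neg not_le mult_1 mult_minus1 simp_thms)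
      with \<omega> show "\<omega> \<in> (\<Union>j\<in>J. ?B j) \<union> (?C 1 \<union> ?C (- 1))"
        by (cases "\<exists>j\<in>J. y < \<bar>X j \<omega> - \<mu>\<bar>") (blast, simp add: not_less)
    qed
    show "(\<Union>j\<in>J. ?B j) \<union> (?C 1 \<union> ?C (- 1)) \<in> events"
      by (rule sets.Un[OF UB sets.Un[OF C C]])
  qed
  also have "\<dots> \<le> prob (\<Union>j\<in>J. ?B j) + prob (?C 1 \<union> ?C (- 1))"
    by (rule measure_Un_le[OF UB sets.Un[OF C C]])
  also have "prob (\<Union>j\<in>J. ?B j) \<le> (\<Sum>j\<in>J. prob (?B j))"
    by (rule finite_measure_subadditive_finite[OF J(1)]) (use B in blast)
  also have "prob (?C 1 \<union> ?C (- 1)) \<le> prob (?C 1) + prob (?C (- 1))"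
    by (rule measure_Un_le[OF C C])
  finally have le: "\<P>(\<omega> in M. t \<le> \<bar>dev J \<omega>\<bar>) \<le> (\<Sum>j\<in>J. prob (?B j)) + (prob (?C 1) + prob (?C (- 1)))"
    by simp
  let ?e = "exp (- (t / y)) * exp (2 * (real (card J) * (V y / y\<^sup>2)))"
  have "prob (?C 1) \<le> ?e" "prob (?C (- 1)) \<le> ?e" by (rule probC; simp)+
  from order_trans[OF le add_mono[OF sumB add_mono[OF this]]] show ?thesis
    by (simp only: mult_2 mult.assoc distrib_right)
qed

end

section \<open>Upper and lower bounds for the probability of a big jump\<close>

context sv_iid
begin

definition big_jump_prob :: "nat \<Rightarrow> real \<Rightarrow> real \<Rightarrow> real" where
  "big_jump_prob n z r = \<P>(\<omega> in M. z \<le> dev {1..n} \<omega> \<and> r < pmax X n \<omega>)"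

text \<open>Either some jump exceeds s, or all are at most e, or some jump lies in (e, s] and the
  remaining sum must supply at least z - s + mean >= g; one g of the slack 2 g absorbs the mean.
  Independence of jump and remainder yields the product \<open>tail M \<xi> e * W\<close>.\<close>

lemma big_jump_prob_upper:
  assumes n: "1 \<le> n" and g: "\<bar>\<mu>\<bar> \<le> g" and s: "s + 2 * g \<le> z" and e: "e \<le> s"
    and W: "\<And>J. J \<subseteq> {1..n} \<Longrightarrow> \<P>(\<omega> in M. g \<le> \<bar>dev J \<omega>\<bar>) \<le> W"
  shows "big_jump_prob n z r \<le> real n * tail M \<xi> s + real n * (tail M \<xi> e * W)
    + \<P>(\<omega> in M. z \<le> dev {1..n} \<omega> \<and> r < pmax X n \<omega> \<and> pmax X n \<omega> \<le> e)"
proof -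
  note [measurable] = measurable_pmax[OF n]
  let ?A = "\<lambda>i. {\<omega> \<in> space M. s < X i \<omega>}"
  let ?B = "\<lambda>i. {\<omega> \<in> space M. e < X i \<omega> \<and> dev ({1..n} - {i}) \<omega> \<in> {w. g \<le> \<bar>w\<bar>}}"
  let ?C = "{\<omega> \<in> space M. z \<le> dev {1..n} \<omega> \<and> r < pmax X n \<omega> \<and> pmax X n \<omega> \<le> e}"
  have meas_dev: "dev ({1..n} - {i}) \<in> borel_measurable M" for i by (rule measurable_dev) auto
  have A: "?A i \<in> events" if "i \<in> {1..n}" for i
    using measurable_X_Icc[OF that] by measurable
  have B: "?B i \<in> events" if "i \<in> {1..n}" for i
    using measurable_X_Icc[OF that] meas_dev[of i] by measurable
  have UA: "(\<Union>i\<in>{1..n}. ?A i) \<in> events" by (rule sets.finite_UN[OF _ A]) simp_all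
  have UB: "(\<Union>i\<in>{1..n}. ?B i) \<in> events" by (rule sets.finite_UN[OF _ B]) simp_all
  have C: "?C \<in> events" by measurable
  have "big_jump_prob n z r \<le> prob (((\<Union>i\<in>{1..n}. ?A i) \<union> (\<Union>i\<in>{1..n}. ?B i)) \<union> ?C)"
    unfolding big_jump_prob_def
  proof (rule finite_measure_mono)
    show "{\<omega> \<in> space M. z \<le> dev {1..n} \<omega> \<and> r < pmax X n \<omega>} \<subseteq> ((\<Union>i\<in>{1..n}. ?A i) \<union> (\<Union>i\<in>{1..n}. ?B i)) \<union> ?C"
    proof
      fix \<omega> assume \<omega>: "\<omega> \<in> {\<omega> \<in> space M. z \<le> dev {1..n} \<omega> \<and> r < pmax X n \<omega>}"
      show "\<omega> \<in> ((\<Union>i\<in>{1..n}. ?A i) \<union> (\<Union>i\<in>{1..n}. ?B i)) \<union> ?C"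
      proof (cases "pmax X n \<omega> \<le> e")
        case True
        then show ?thesis using \<omega> by blast
      next
        case False
        then obtain i where i: "i \<in> {1..n}" "e < X i \<omega>"
          using pmax_le_iff[OF n, of \<omega> e] by (meson linorder_not_le)
        show ?thesis
        proof (cases "X i \<omega> \<le> s")
          case False
          then have "s < X i \<omega>" by simp
          then show ?thesis using i \<omega> by blast
        next
          case True
          have "dev {1..n} \<omega> = (X i \<omega> - \<mu>) + dev ({1..n} - {i}) \<omega>"
            using i by (subst sum.remove[of _ i]) auto
          then have "g \<le> dev ({1..n} - {i}) \<omega>" using True \<omega> g s by auto
          then have "\<omega> \<in> ?B i" using i \<omega> by (simp add: abs_if)
          then show ?thesis using i by blast
        qed
      qed
    qed
  qed (rule sets.Un[OF sets.Un[OF UA UB] C])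
  also have "\<dots> \<le> prob (\<Union>i\<in>{1..n}. ?A i) + prob (\<Union>i\<in>{1..n}. ?B i) + prob ?C"
    by (rule order_trans[OF measure_Un_le[OF sets.Un[OF UA UB] C] add_right_mono[OF measure_Un_le[OF UA UB]]])
  also have "\<dots> \<le> real n * tail M \<xi> s + real n * (tail M \<xi> e * W) + prob ?C"
  proof (intro add_mono order_refl)
    have "prob (\<Union>i\<in>{1..n}. ?A i) \<le> (\<Sum>i\<in>{1..n}. prob (?A i))"
      by (rule finite_measure_subadditive_finite) (use A in auto)
    also have "\<dots> = real n * tail M \<xi> s" by (simp add: prob_X_gt)
    finally show "prob (\<Union>i\<in>{1..n}. ?A i) \<le> real n * tail M \<xi> s" .
    have "prob (\<Union>i\<in>{1..n}. ?B i) \<le> (\<Sum>i\<in>{1..n}. prob (?B i))"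
      by (rule finite_measure_subadditive_finite) (use B in blast)+
    also have "\<dots> \<le> (\<Sum>i\<in>{1..n}. tail M \<xi> e * W)"
    proof (rule sum_mono)
      fix i assume i: "i \<in> {1..n}"
      have "prob (?B i) = tail M \<xi> e * \<P>(\<omega> in M. dev ({1..n} - {i}) \<omega> \<in> {w. g \<le> \<bar>w\<bar>})"
        using i by (intro prob_X_gt_dev) auto
      also have "\<dots> \<le> tail M \<xi> e * W"
        using W[of "{1..n} - {i}"] tail_nonneg by (intro mult_left_mono) auto
      finally show "prob (?B i) \<le> tail M \<xi> e * W" .
    qed
    also have "\<dots> = real n * (tail M \<xi> e * W)" by simp
    finally show "prob (\<Union>i\<in>{1..n}. ?B i) \<le> real n * (tail M \<xi> e * W)" .
  qed
  finally show ?thesis .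
qed

text \<open>Bonferroni's inequality with the square of the cardinality in place of the number of
  pairs. The crude count suffices because n times the tail vanishes where it is applied.\<close>

lemma prob_UN_ge:
  assumes "finite I" "\<And>i. i \<in> I \<Longrightarrow> E i \<in> events"
    and q: "0 \<le> q"
    and pair: "\<And>i j. i \<in> I \<Longrightarrow> j \<in> I \<Longrightarrow> i \<noteq> j \<Longrightarrow> prob (E i \<inter> E j) \<le> q"
  shows "(\<Sum>i\<in>I. prob (E i)) - (real (card I))\<^sup>2 * q \<le> prob (\<Union>i\<in>I. E i)"
  using assms
proof (induction I rule: finite_induct)
  case (insert i I)
  have UI: "(\<Union>j\<in>I. E j) \<in> events" using insert by (intro sets.finite_UN) auto
  have "prob (E i \<inter> (\<Union>j\<in>I. E j)) \<le> real (card I) * q"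
  proof -
    have "prob (E i \<inter> (\<Union>j\<in>I. E j)) \<le> prob (\<Union>j\<in>I. E i \<inter> E j)"
      using insert by (intro finite_measure_mono sets.finite_UN) auto
    also have "\<dots> \<le> (\<Sum>j\<in>I. prob (E i \<inter> E j))"
      using insert by (intro finite_measure_subadditive_finite) auto
    also have "\<dots> \<le> (\<Sum>j\<in>I. q)" using insert by (intro sum_mono insert.prems(3)) auto
    finally show ?thesis by simp
  qed
  moreover have "prob (\<Union>j\<in>insert i I. E j) = prob (E i) + prob (\<Union>j\<in>I. E j) - prob (E i \<inter> (\<Union>j\<in>I. E j))"
    using finite_measure_Union'[of "E i" "\<Union>j\<in>I. E j"] finite_measure_Diff'[of "\<Union>j\<in>I. E j" "E i"] insert.prems(1)[of i] UI
    by (simp add: Int_commute)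
  moreover have "(\<Sum>i\<in>I. prob (E i)) - (real (card I))\<^sup>2 * q \<le> prob (\<Union>j\<in>I. E j)"
    using insert by auto
  moreover have "(real (card (insert i I)))\<^sup>2 * q = (real (card I))\<^sup>2 * q + 2 * (real (card I) * q) + q"
    using insert by (simp add: power2_eq_square algebra_simps)
  moreover have "0 \<le> real (card I) * q" using q by simp
  moreover have "(\<Sum>j\<in>insert i I. prob (E j)) = prob (E i) + (\<Sum>j\<in>I. prob (E j))"
    using insert.hyps by simp
  ultimately show ?case using q by linarith
qed simp

text \<open>A jump above s keeps the sum above z even after the mean and a remaining deviation below
  g are subtracted. Counting double jumps costs the square of n times the tail.\<close>

lemma big_jump_prob_lower:
  assumes n: "1 \<le> n" and g: "\<bar>\<mu>\<bar> \<le> g" and s: "z + 2 * g \<le> s" "r \<le> s"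
    and W: "\<And>J. J \<subseteq> {1..n} \<Longrightarrow> \<P>(\<omega> in M. g \<le> \<bar>dev J \<omega>\<bar>) \<le> W"
  shows "real n * (tail M \<xi> s * (1 - W)) - (real n * tail M \<xi> s)\<^sup>2 \<le> big_jump_prob n z r"
proof -
  note [measurable] = measurable_pmax[OF n]
  let ?E = "\<lambda>i. {\<omega> \<in> space M. s < X i \<omega> \<and> dev ({1..n} - {i}) \<omega> \<in> {w. \<bar>w\<bar> < g}}"
  have meas_dev: "dev ({1..n} - {i}) \<in> borel_measurable M" for i by (rule measurable_dev) auto
  have E: "?E i \<in> events" if "i \<in> {1..n}" for i
    using measurable_X_Icc[OF that] meas_dev[of i] by measurable
  have "prob (?E i) \<ge> tail M \<xi> s * (1 - W)" if i: "i \<in> {1..n}" for i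
  proof -
    have "prob (?E i) = tail M \<xi> s * \<P>(\<omega> in M. dev ({1..n} - {i}) \<omega> \<in> {w. \<bar>w\<bar> < g})"
      using i by (intro prob_X_gt_dev) auto
    moreover have "\<P>(\<omega> in M. dev ({1..n} - {i}) \<omega> \<in> {w. \<bar>w\<bar> < g}) = 1 - \<P>(\<omega> in M. g \<le> \<bar>dev ({1..n} - {i}) \<omega>\<bar>)"
      using prob_neg[of "\<lambda>\<omega>. g \<le> \<bar>dev ({1..n} - {i}) \<omega>\<bar>"] meas_dev[of i] by (simp add: not_le)
    moreover have "\<P>(\<omega> in M. g \<le> \<bar>dev ({1..n} - {i}) \<omega>\<bar>) \<le> W" by (rule W) auto
    ultimately show ?thesis using tail_nonneg[of s] by (simp only:) (intro mult_left_mono; simp)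
  qed
  then have "(\<Sum>i\<in>{1..n}. tail M \<xi> s * (1 - W)) \<le> (\<Sum>i\<in>{1..n}. prob (?E i))" by (intro sum_mono) auto
  then have "real n * (tail M \<xi> s * (1 - W)) \<le> (\<Sum>i\<in>{1..n}. prob (?E i))" by simp
  moreover have "(\<Sum>i\<in>{1..n}. prob (?E i)) - (real (card {1..n}))\<^sup>2 * (tail M \<xi> s)\<^sup>2 \<le> prob (\<Union>i\<in>{1..n}. ?E i)"
  proof (rule prob_UN_ge)
    fix i j assume ij: "i \<in> {1..n}" "j \<in> {1..n}" "i \<noteq> j"
    have [measurable]: "X i \<in> borel_measurable M" "X j \<in> borel_measurable M" using ij by auto
    \<comment> \<open>Only the two jumps are kept; writing the second as a deviation of the
      singleton {j} makes the independence lemma applicable.\<close>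
    have "prob (?E i \<inter> ?E j) \<le> \<P>(\<omega> in M. s < X i \<omega> \<and> dev {j} \<omega> \<in> {s - \<mu><..})"
      by (intro finite_measure_mono) auto
    also have "\<dots> = tail M \<xi> s * \<P>(\<omega> in M. dev {j} \<omega> \<in> {s - \<mu><..})"
      using ij by (intro prob_X_gt_dev) auto
    also have "\<P>(\<omega> in M. dev {j} \<omega> \<in> {s - \<mu><..}) = tail M \<xi> s"
      using ij prob_X_gt[of j s] by simp
    finally show "prob (?E i \<inter> ?E j) \<le> (tail M \<xi> s)\<^sup>2" by (simp add: power2_eq_square)
  qed (use E in auto)
  moreover have "prob (\<Union>i\<in>{1..n}. ?E i) \<le> big_jump_prob n z r"
    unfolding big_jump_prob_def
  proof (rule finite_measure_mono)
    show "(\<Union>i\<in>{1..n}. ?E i) \<subseteq> {\<omega> \<in> space M. z \<le> dev {1..n} \<omega> \<and> r < pmax X n \<omega>}"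
    proof
      fix \<omega> assume "\<omega> \<in> (\<Union>i\<in>{1..n}. ?E i)"
      then obtain i where i: "i \<in> {1..n}" "\<omega> \<in> space M" "s < X i \<omega>" "\<bar>dev ({1..n} - {i}) \<omega>\<bar> < g" by auto
      have "dev {1..n} \<omega> = (X i \<omega> - \<mu>) + dev ({1..n} - {i}) \<omega>"
        using i by (subst sum.remove[of _ i]) auto
      then have "z \<le> dev {1..n} \<omega>" using i g s by linarith
      moreover have "\<not> pmax X n \<omega> \<le> s" using pmax_le_iff[OF n, of \<omega> s] i by (auto simp: not_le)
      ultimately show "\<omega> \<in> {\<omega> \<in> space M. z \<le> dev {1..n} \<omega> \<and> r < pmax X n \<omega>}" using i s by auto
    qed
  qed measurable
  ultimately show ?thesis by (simp add: power_mult_distrib)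
qed

section \<open>Estimates far above the normalising scale\<close>

context
  fixes a z :: "nat \<Rightarrow> real"
  assumes a: "filterlim a at_top sequentially" and an: "(\<lambda>n. real n * (V (a n) / (a n)\<^sup>2)) \<longlonglongrightarrow> 1"
    and za: "filterlim (\<lambda>n. z n / a n) at_top sequentially"
begin

lemma filterlim_above_normalising: "filterlim z at_top sequentially"
proof -
  have "filterlim (\<lambda>n. z n / a n * a n) at_top sequentially"
    by (rule filterlim_at_top_mult_at_top[OF za a])
  moreover have "\<forall>\<^sub>F n in sequentially. z n / a n * a n = z n"
    using a[unfolded filterlim_at_top_dense, rule_format, of 0] by (rule eventually_mono) simp
  ultimately show ?thesis by (simp cong: filterlim_cong)
qed

text \<open>The ratio of \<kappa> z to a is unbounded, hence the quasi-monotonicity of V(y) / y: it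
  gives the bound 2 n V(a) / a^2 times a / (\<kappa> z), whose last quotient vanishes.\<close>

lemma n_q_tendsto_0:
  assumes k: "0 < \<kappa>"
  shows "(\<lambda>n. real n * (V (\<kappa> * z n) / (\<kappa> * z n)\<^sup>2)) \<longlonglongrightarrow> 0"
proof (rule Lim_null_comparison)
  obtain s0 where s0: "0 < s0" "\<And>s y. s0 \<le> s \<Longrightarrow> s \<le> y \<Longrightarrow> V y / y \<le> 2 * (V s / s)"
    using V_over_quasi_decreasing by blast
  have "\<forall>\<^sub>F n in sequentially. max s0 1 \<le> a n" by (rule a[unfolded filterlim_at_top, rule_format])
  moreover have "\<forall>\<^sub>F n in sequentially. 1 / \<kappa> \<le> z n / a n" using za by (simp add: filterlim_at_top)
  ultimately show "\<forall>\<^sub>F n in sequentially. norm (real n * (V (\<kappa> * z n) / (\<kappa> * z n)\<^sup>2))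
      \<le> 2 * (real n * (V (a n) / (a n)\<^sup>2)) * (1 / \<kappa> * (1 / (z n / a n)))"
  proof eventually_elim
    case (elim n)
    have ap: "0 < a n" "s0 \<le> a n" using elim by auto
    have le: "a n \<le> \<kappa> * z n" using elim k ap by (simp add: field_simps)
    then have y: "0 < \<kappa> * z n" using ap by linarith
    then have zp: "0 < z n" using k by (simp add: zero_less_mult_iff)
    have "V (\<kappa> * z n) / (\<kappa> * z n) / (\<kappa> * z n) \<le> 2 * (V (a n) / a n) / (\<kappa> * z n)"
      using s0(2)[OF ap(2) le] y by (intro divide_right_mono) auto
    then have "real n * (V (\<kappa> * z n) / (\<kappa> * z n)\<^sup>2) \<le> real n * (2 * (V (a n) / a n) / (\<kappa> * z n))"
      by (intro mult_left_mono) (auto simp: power2_eq_square)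
    also have "\<dots> = 2 * (real n * (V (a n) / (a n)\<^sup>2)) * (1 / \<kappa> * (1 / (z n / a n)))"
      using ap zp k by (simp add: field_simps power2_eq_square)
    finally show ?case using V_nonneg[of "\<kappa> * z n"] by (simp add: abs_of_nonneg)
  qed
  have "(\<lambda>n. 2 * (real n * (V (a n) / (a n)\<^sup>2)) * (1 / \<kappa> * (1 / (z n / a n)))) \<longlonglongrightarrow> 2 * 1 * (1 / \<kappa> * 0)"
    by (intro tendsto_mult tendsto_const an tendsto_divide_0[OF tendsto_const] filterlim_at_top_imp_at_infinity za)
  then show "(\<lambda>n. 2 * (real n * (V (a n) / (a n)\<^sup>2)) * (1 / \<kappa> * (1 / (z n / a n)))) \<longlonglongrightarrow> 0" by simp
qed

lemma filterlim_scaled: "0 < \<kappa> \<Longrightarrow> filterlim (\<lambda>n. \<kappa> * z n) at_top sequentially"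
  by (rule filterlim_tendsto_pos_mult_at_top[OF tendsto_const _ filterlim_above_normalising])

lemma n_tail_tendsto_0:
  assumes "0 < c"
  shows "(\<lambda>n. real n * tail M \<xi> (c * z n)) \<longlonglongrightarrow> 0"
proof (rule Lim_null_comparison)
  have c2: "0 < c / 2" using assms by simp
  show "\<forall>\<^sub>F n in sequentially. norm (real n * tail M \<xi> (c * z n)) \<le> real n * (V (c / 2 * z n) / (c / 2 * z n)\<^sup>2)"
    using eventually_compose_filterlim[OF tail_le_q filterlim_scaled[OF c2]]
  proof eventually_elim
    case (elim n)
    from mult_left_mono[OF elim, of "real n"] show ?case by (simp add: tail_nonneg)
  qed
  show "(\<lambda>n. real n * (V (c / 2 * z n) / (c / 2 * z n)\<^sup>2)) \<longlonglongrightarrow> 0" by (rule n_q_tendsto_0[OF c2])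
qed

text \<open>The truncation level is \<delta> z / K. Then exp (- K) <= \<epsilon> / 8, and n V(y) /
  y^2 below ln 2 / 2 keeps the other exponential factor below 2, so the parts add up to \<epsilon> /
  2 + 4 \<epsilon> / 8. Bounding card J by n makes the estimate uniform in J.\<close>

lemma prob_dev_uniform:
  assumes d: "0 < \<delta>" and e: "0 < \<epsilon>"
  shows "\<forall>\<^sub>F n in sequentially. \<forall>J. J \<subseteq> {1..n} \<longrightarrow> \<P>(\<omega> in M. \<delta> * z n \<le> \<bar>dev J \<omega>\<bar>) \<le> \<epsilon>"
proof -
  define K where "K = 8 / \<epsilon>"
  have "K \<le> exp K" using exp_ge_add_one_self[of K] by linarith
  then have K: "0 < K" "8 / \<epsilon> \<le> exp K" using e by (auto simp only: K_def intro: divide_pos_pos)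
  define \<kappa> where "\<kappa> = \<delta> / K"
  have k: "0 < \<kappa>" using d K by (simp add: \<kappa>_def)
  have "\<forall>\<^sub>F y in at_top. 0 < y \<and> tail_moment y \<le> V y / y \<and>
      (\<forall>s. \<bar>s\<bar> = 1 \<longrightarrow> (LINT \<omega>|M. indicator {..y} \<bar>Y \<omega>\<bar> * exp (s * (Y \<omega> / y))) \<le> exp (2 * (V y / y\<^sup>2)))"
    using eventually_gt_at_top[of 0] tail_moment_le[OF zero_less_one] two_sided_mgf[of 1, simplified] two_sided_mgf[of "- 1", simplified]
    by eventually_elim (auto simp: abs_if split: if_splits)
  note ev = eventually_compose_filterlim[OF this filterlim_scaled[OF k]]
  have "\<forall>\<^sub>F n in sequentially. real n * (V (\<kappa> * z n) / (\<kappa> * z n)\<^sup>2) < min (\<epsilon> / 2) (ln 2 / 2)"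
    using e by (intro order_tendstoD(2)[OF n_q_tendsto_0[OF k]]) auto
  with ev show ?thesis
  proof eventually_elim
    case (elim n)
    let ?y = "\<kappa> * z n"
    show ?case
    proof (intro allI impI)
      fix J assume J: "J \<subseteq> {1..n}"
      then have fin: "finite J" "J \<subseteq> {1..}" by (auto intro: finite_subset)
      have q: "0 \<le> V ?y / ?y\<^sup>2" using V_nonneg by simp
      have "card J \<le> n" using card_mono[OF _ J] by simp
      then have "real (card J) * (V ?y / ?y\<^sup>2) \<le> real n * (V ?y / ?y\<^sup>2)" using q by (intro mult_right_mono) auto
      moreover have "real n * (V ?y / ?y\<^sup>2) < \<epsilon> / 2" "real n * (V ?y / ?y\<^sup>2) < ln 2 / 2"
        using elim(2) by (simp_all only: min_less_iff_conj)
      ultimately have c: "real (card J) * (V ?y / ?y\<^sup>2) \<le> \<epsilon> / 2" "real (card J) * (V ?y / ?y\<^sup>2) \<le> ln 2 / 2"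
        by linarith+
      have zp: "0 < z n" using elim(1) k by (simp add: zero_less_mult_iff)
      have "\<P>(\<omega> in M. \<delta> * z n \<le> \<bar>dev J \<omega>\<bar>) \<le> real (card J) * (V ?y / ?y\<^sup>2)
          + 2 * exp (- (\<delta> * z n / ?y)) * exp (2 * (real (card J) * (V ?y / ?y\<^sup>2)))"
        using elim(1) by (intro prob_dev_ge_le fin) auto
      also have "\<dots> \<le> \<epsilon> / 2 + 2 * exp (- K) * exp (ln 2)"
      proof (intro add_mono mult_mono c)
        have "\<delta> * z n / ?y = K" using zp d K by (simp add: \<kappa>_def)
        then show "exp (- (\<delta> * z n / ?y)) \<le> exp (- K)" by simp
        show "exp (2 * (real (card J) * (V ?y / ?y\<^sup>2))) \<le> exp (ln 2)"
          using c(2) by (simp only: exp_le_cancel_iff)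
      qed auto
      also have "2 * exp (- K) * exp (ln 2) = 4 / exp K" by (simp add: exp_minus field_simps)
      also have "4 / exp K \<le> 4 / (8 / \<epsilon>)" using K e by (intro divide_left_mono) auto
      also have "\<dots> = \<epsilon> / 2" using e by simp
      finally show "\<P>(\<omega> in M. \<delta> * z n \<le> \<bar>dev J \<omega>\<bar>) \<le> \<epsilon>" by simp
    qed
  qed
qed

end

end

context sv_iid
begin

text \<open>The two bounds each lose a dilation c near 1, which intermediate regular variation makes
  inexpensive. The number j of dyadic levels is fixed before n grows, so the factor 2^(d j) lost in
  the tail can be paid by the weak law. \<open>var\<close> is the variance bound that the Chernoff
  estimates need at all levels simultaneously.\<close>

theorem big_jump_prob_asymp:
  fixes a x z r :: "nat \<Rightarrow> real"
  assumes a: "filterlim a at_top sequentially" and an: "(\<lambda>n. real n * (V (a n) / (a n)\<^sup>2)) \<longlonglongrightarrow> 1"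
    and x_pos: "\<And>n. 0 < x n" and xa: "filterlim (\<lambda>n. x n / a n) at_top sequentially"
    and xz: "\<And>n. x n \<le> z n"
    and r: "\<forall>\<^sub>F n in sequentially. r n \<le> x n"
    and var: "\<exists>Y1. \<forall>\<^sub>F n in sequentially. \<forall>y. max (r n) Y1 \<le> y \<longrightarrow> real n * V y \<le> 4 * x n * y"
    and irv: "inter_reg_varying (tail M \<xi>)"
  shows "(\<lambda>n. big_jump_prob n (z n) (r n) / (real n * tail M \<xi> (z n))) \<longlonglongrightarrow> 1"
proof -
  have za: "filterlim (\<lambda>n. z n / a n) at_top sequentially"
  proof (rule filterlim_at_top_mono[OF xa])
    show "\<forall>\<^sub>F n in sequentially. x n / a n \<le> z n / a n"
      using a[unfolded filterlim_at_top_dense, rule_format, of 0] xz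
      by (auto elim!: eventually_mono intro: divide_right_mono)
  qed
  note z_top = filterlim_above_normalising[OF a an za]
  note ev_scaled = eventually_compose_filterlim[OF _ filterlim_scaled[OF a an za]]
  note dev_small = prob_dev_uniform[OF a an za]
  obtain d X0 where X0: "0 < X0" and dbl: "\<And>w. X0 \<le> w \<Longrightarrow> 0 < tail M \<xi> w \<and> tail M \<xi> w \<le> 2 ^ d * tail M \<xi> (2 * w)"
    using antimono_doubling[OF irv tail_nonneg antimono_tail] by blast
  obtain B :: real where B: "0 < B" "\<And>j::nat. 2 * 2 ^ (d * Suc j) * exp (- (2 ^ j / 32)) \<le> B / 2 ^ j"
    by (rule dyadic_exp_bound[of d]) (rule that)
  obtain Y1 where Y1: "\<forall>\<^sub>F n in sequentially. \<forall>y. max (r n) Y1 \<le> y \<longrightarrow> real n * V y \<le> 4 * x n * y"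
    using var by blast
  obtain Y2 where Y2: "\<And>y. Y2 \<le> y \<Longrightarrow> mgf y \<le> exp (1 / 128 * (V y / y\<^sup>2))"
    using one_sided_mgf unfolding eventually_at_top_linorder mgf_def by blast
  define Y0 where "Y0 = max (max Y1 Y2) (max (2 * X0) (2 * \<bar>\<mu>\<bar> + 1))"
  have Y0: "Y1 \<le> Y0" "Y2 \<le> Y0" "2 * X0 \<le> Y0" "2 * \<bar>\<mu>\<bar> + 1 \<le> Y0" by (auto simp: Y0_def)
  have Y0_pos: "0 < Y0" using Y0(4) by linarith
  have z_ge: "\<forall>\<^sub>F n in sequentially. K \<le> z n" for K
    by (rule z_top[unfolded filterlim_at_top, rule_format])
  have tail_pos: "\<forall>\<^sub>F n in sequentially. 0 < tail M \<xi> (z n)"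
    using z_ge[of X0] by eventually_elim (use dbl in blast)
  have mid: "\<forall>\<^sub>F n in sequentially. \<P>(\<omega> in M. z n \<le> dev {1..n} \<omega> \<and> r n < pmax X n \<omega> \<and> pmax X n \<omega> \<le> z n / 2 ^ j)
      \<le> 2 * (B / 2 ^ j) * (real n * tail M \<xi> (z n)) + exp (- (z n / (32 * Y0)))" for j :: nat
    using Y1 eventually_ge_at_top[of 1]
  proof eventually_elim
    case (elim n)
    show ?case
      by (rule prob_medium_jump_le[OF elim(2) x_pos xz X0 Y0(3,4)])
         (use elim(1) Y0 Y2 dbl B in auto)
  qed
  have upper: "\<forall>\<^sub>F n in sequentially. big_jump_prob n (z n) (r n) / (real n * tail M \<xi> (z n)) \<le> 1 / (1 - \<epsilon>) + 3 * \<epsilon>"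
    if e: "0 < \<epsilon>" "\<epsilon> < 1" for \<epsilon>
  proof -
    obtain c where c: "1 < c" "\<forall>\<^sub>F w in at_top. 0 < tail M \<xi> w \<and> (1 - \<epsilon>) * tail M \<xi> w \<le> tail M \<xi> (c * w)"
      using inter_reg_varying_lower[OF irv tail_nonneg e] by blast
    \<comment> \<open>Half of the relative gap, so that z / c + 2 g z = z.\<close>
    define g where "g = (1 - 1 / c) / 2"
    have g: "0 < g" using c by (simp add: g_def)
    \<comment> \<open>j1 brings 2 B / 2^j below \<epsilon>, and j2 puts the level z / 2^j below z /
      c.\<close>
    obtain j1 :: nat where j1: "2 * B / \<epsilon> < 2 ^ j1" using real_arch_pow[of 2] by auto
    obtain j2 :: nat where j2: "c < 2 ^ j2" using real_arch_pow[of 2] by auto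
    define j where "j = max j1 j2"
    have "(2::real) ^ j1 \<le> 2 ^ j" "(2::real) ^ j2 \<le> 2 ^ j" by (auto simp: j_def intro: power_increasing)
    then have j: "2 * B / \<epsilon> < 2 ^ j" "c < 2 ^ j" using j1 j2 by linarith+
    \<comment> \<open>The divisor 2^(d j) compensates the growth of the tail from z down to z /
      2^j.\<close>
    have "\<forall>\<^sub>F n in sequentially. \<forall>J. J \<subseteq> {1..n} \<longrightarrow> \<P>(\<omega> in M. g * z n \<le> \<bar>dev J \<omega>\<bar>) \<le> \<epsilon> / 2 ^ (d * j)"
      using g e by (intro dev_small) auto
    moreover have "\<forall>\<^sub>F n in sequentially. exp (- (1 / (32 * Y0) * z n)) \<le> \<epsilon> * tail M \<xi> (z n)"
      by (rule eventually_compose_filterlim[OF exp_neg_le_doubling[OF dbl antimono_tail X0] z_top])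
         (use Y0_pos e in auto)
    moreover have "\<forall>\<^sub>F n in sequentially. 0 < tail M \<xi> (1 / c * z n) \<and> (1 - \<epsilon>) * tail M \<xi> (1 / c * z n) \<le> tail M \<xi> (c * (1 / c * z n))"
      using c by (intro ev_scaled[OF c(2)]) auto
    ultimately show ?thesis
      using mid[of j] tail_pos z_ge[of "\<bar>\<mu>\<bar> / g"] z_ge[of "2 ^ j * X0"] z_ge[of 1] eventually_ge_at_top[of 1]
    proof eventually_elim
      case (elim n)
      let ?N = "real n * tail M \<xi> (z n)"
      have zp: "0 < z n" using elim by linarith
      have N: "0 < ?N" using elim by simp
      have "2 * ((1 - k) / 2 * w) = w - k * w" for k w :: real by (simp add: left_diff_distrib)
      from this[of "1 / c" "z n"] have s_eq: "1 / c * z n + 2 * (g * z n) \<le> z n" unfolding g_def by linarith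
      have "big_jump_prob n (z n) (r n) \<le> real n * tail M \<xi> (1 / c * z n) + real n * (tail M \<xi> (z n / 2 ^ j) * (\<epsilon> / 2 ^ (d * j)))
         + \<P>(\<omega> in M. z n \<le> dev {1..n} \<omega> \<and> r n < pmax X n \<omega> \<and> pmax X n \<omega> \<le> z n / 2 ^ j)"
      proof (rule big_jump_prob_upper[OF elim(9) _ s_eq])
        show "\<bar>\<mu>\<bar> \<le> g * z n" using elim(6) g by (simp add: field_simps)
        show "z n / 2 ^ j \<le> 1 / c * z n"
          using zp j(2) c(1) by (simp add: field_simps)
      qed (use elim(1) in blast)
      also have "\<dots> \<le> real n * (tail M \<xi> (z n) / (1 - \<epsilon>)) + \<epsilon> * ?N + (\<epsilon> * ?N + \<epsilon> * ?N)"
      proof (intro add_mono mult_left_mono)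
        have "(1 - \<epsilon>) * tail M \<xi> (1 / c * z n) \<le> tail M \<xi> (z n)" using elim(3) c(1) by simp
        then show "tail M \<xi> (1 / c * z n) \<le> tail M \<xi> (z n) / (1 - \<epsilon>)" using e by (simp add: field_simps)
        have "tail M \<xi> (z n / 2 ^ j) \<le> 2 ^ (d * j) * tail M \<xi> (z n)"
          by (rule doubling_iterate[where f = "tail M \<xi>" and ?X0.0 = X0 and d = d])
             (use dbl X0 elim(7) in \<open>auto simp: field_simps\<close>)
        then have "real n * (tail M \<xi> (z n / 2 ^ j) * (\<epsilon> / 2 ^ (d * j))) \<le> real n * (2 ^ (d * j) * tail M \<xi> (z n) * (\<epsilon> / 2 ^ (d * j)))"
          using e by (intro mult_left_mono mult_right_mono) auto
        then show "real n * (tail M \<xi> (z n / 2 ^ j) * (\<epsilon> / 2 ^ (d * j))) \<le> \<epsilon> * ?N" by (simp add: mult_ac)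
        have "2 * (B / 2 ^ j) * ?N \<le> \<epsilon> * ?N"
          using j(1) e N by (intro mult_right_mono) (auto simp: field_simps)
        moreover have "exp (- (z n / (32 * Y0))) \<le> \<epsilon> * ?N"
        proof -
          have "exp (- (z n / (32 * Y0))) \<le> \<epsilon> * tail M \<xi> (z n)" using elim(2) by simp
          also have "\<epsilon> * tail M \<xi> (z n) * 1 \<le> \<epsilon> * tail M \<xi> (z n) * real n"
            using e tail_nonneg elim(9) by (intro mult_left_mono) auto
          finally show ?thesis by (simp add: mult_ac)
        qed
        ultimately show "\<P>(\<omega> in M. z n \<le> dev {1..n} \<omega> \<and> r n < pmax X n \<omega> \<and> pmax X n \<omega> \<le> z n / 2 ^ j) \<le> \<epsilon> * ?N + \<epsilon> * ?N"
          using elim(4) by linarith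
      qed auto
      also have "\<dots> = (1 / (1 - \<epsilon>) + 3 * \<epsilon>) * ?N" by (simp add: algebra_simps)
      finally show ?case using N by (simp only: divide_le_eq if_True)
    qed
  qed
  \<comment> \<open>In 1 - 2 \<epsilon>, one \<epsilon> is the weak law and the other the Bonferroni
    term, controlled by n times the tail at c z; the factor 1 - \<epsilon> is the dilation.\<close>
  have lower: "\<forall>\<^sub>F n in sequentially. (1 - \<epsilon>) * (1 - 2 * \<epsilon>) \<le> big_jump_prob n (z n) (r n) / (real n * tail M \<xi> (z n))"
    if e: "0 < \<epsilon>" "\<epsilon> < 1 / 2" for \<epsilon>
  proof -
    have e1: "\<epsilon> < 1" using e by simp
    obtain c where c: "1 < c" "\<forall>\<^sub>F w in at_top. 0 < tail M \<xi> w \<and> (1 - \<epsilon>) * tail M \<xi> w \<le> tail M \<xi> (c * w)"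
      using inter_reg_varying_lower[OF irv tail_nonneg e(1) e1] by blast
    define g where "g = (c - 1) / 2"
    have g: "0 < g" using c by (simp add: g_def)
    have c0: "0 < c" using c by simp
    have "\<forall>\<^sub>F n in sequentially. \<forall>J. J \<subseteq> {1..n} \<longrightarrow> \<P>(\<omega> in M. g * z n \<le> \<bar>dev J \<omega>\<bar>) \<le> \<epsilon>"
      using g e by (intro dev_small) auto
    moreover have "\<forall>\<^sub>F n in sequentially. real n * tail M \<xi> (c * z n) < \<epsilon>"
      by (rule order_tendstoD(2)[OF n_tail_tendsto_0[OF a an za c0] e(1)])
    moreover have "\<forall>\<^sub>F n in sequentially. 0 < tail M \<xi> (z n) \<and> (1 - \<epsilon>) * tail M \<xi> (z n) \<le> tail M \<xi> (c * z n)"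
      by (rule eventually_compose_filterlim[OF c(2) z_top])
    ultimately show ?thesis
      using r z_ge[of "\<bar>\<mu>\<bar> / g"] z_ge[of 1] eventually_ge_at_top[of 1]
    proof eventually_elim
      case (elim n)
      let ?N = "real n * tail M \<xi> (z n)"
      let ?T = "real n * tail M \<xi> (c * z n)"
      have zp: "0 < z n" using elim by linarith
      have N: "0 < ?N" using elim by simp
      have T: "0 \<le> ?T" using tail_nonneg by simp
      have "2 * ((k - 1) / 2 * w) = k * w - w" for k w :: real by (simp add: left_diff_distrib)
      from this[of c "z n"] have s_eq: "z n + 2 * (g * z n) \<le> c * z n" unfolding g_def by linarith
      have "1 * z n \<le> c * z n" using c zp by (intro mult_right_mono) auto
      then have rs: "r n \<le> c * z n" using elim(4) xz[of n] by linarith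
      have "real n * (tail M \<xi> (c * z n) * (1 - \<epsilon>)) - ?T\<^sup>2 \<le> big_jump_prob n (z n) (r n)"
      proof (rule big_jump_prob_lower[OF elim(7) _ s_eq rs])
        show "\<bar>\<mu>\<bar> \<le> g * z n" using elim(5) g by (simp add: field_simps)
      qed (use elim(1) in blast)
      moreover have "?T\<^sup>2 \<le> ?T * \<epsilon>"
        unfolding power2_eq_square using elim(2) T by (intro mult_left_mono) auto
      ultimately have "?T * (1 - 2 * \<epsilon>) \<le> big_jump_prob n (z n) (r n)"
        by (simp add: algebra_simps)
      moreover have "(1 - \<epsilon>) * ?N \<le> ?T"
        using mult_left_mono[OF conjunct2[OF elim(3)], of "real n"] by (simp add: mult_ac)
      then have "(1 - \<epsilon>) * ?N * (1 - 2 * \<epsilon>) \<le> ?T * (1 - 2 * \<epsilon>)"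
        using e by (intro mult_right_mono) auto
      ultimately have "(1 - \<epsilon>) * (1 - 2 * \<epsilon>) * ?N \<le> big_jump_prob n (z n) (r n)"
        by (simp add: mult_ac)
      then show ?case using N by (simp only: le_divide_eq if_True)
    qed
  qed
  show ?thesis
  proof (rule tendstoI)
    fix e :: real assume e: "0 < e"
    \<comment> \<open>For \<epsilon> <= 1 / 2 one has 1 / (1 - \<epsilon>) <= 1 + 2 \<epsilon>, so
      the upper error is at most 5 \<epsilon> < e.\<close>
    define \<epsilon> where "\<epsilon> = min (e / 6) (1 / 4)"
    have \<epsilon>: "0 < \<epsilon>" "\<epsilon> < 1 / 2" "\<epsilon> < 1" "6 * \<epsilon> \<le> e" using e by (auto simp: \<epsilon>_def)
    show "\<forall>\<^sub>F n in sequentially. dist (big_jump_prob n (z n) (r n) / (real n * tail M \<xi> (z n))) 1 < e"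
      using upper[OF \<epsilon>(1,3)] lower[OF \<epsilon>(1,2)]
    proof eventually_elim
      case (elim n)
      have "1 \<le> (1 + 2 * \<epsilon>) * (1 - \<epsilon>)" using \<epsilon> mult_left_mono[of "2 * \<epsilon>" 1 \<epsilon>] by (simp add: algebra_simps)
      then have "1 / (1 - \<epsilon>) \<le> 1 + 2 * \<epsilon>" using \<epsilon> by (simp add: divide_le_eq)
      moreover have "1 - 3 * \<epsilon> \<le> (1 - \<epsilon>) * (1 - 2 * \<epsilon>)" using \<epsilon> by (simp add: algebra_simps)
      ultimately show ?case using elim \<epsilon> unfolding dist_real_def by linarith
    qed
  qed
qed

end

section \<open>Threshold estimates and the two conditional laws\<close>

theorem corollary2p12:
  fixes M :: "'a measure"
    and \<xi> :: "'a \<Rightarrow> real" and X :: "nat \<Rightarrow> 'a \<Rightarrow> real"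
    and a b x rn :: "nat \<Rightarrow> real" and r :: "real \<Rightarrow> real"
  assumes "prob_space M"
    and "\<xi> \<in> borel_measurable M"
    and "iid_copies M \<xi> X"
    and "integrable M \<xi>"
    and "slowly_varying (trunc_var M \<xi>)"
    and "normalising_seq M \<xi> a"
    and "\<And>n. b n = real n * mean M \<xi>"
    and "threshold_fun M \<xi> r"
    and "\<And>n. x n > 0"
    and "filterlim (\<lambda>n. x n / a n) at_top sequentially"
    and "\<And>n. rn n = r (real n / x n)"
  shows
    "((\<lambda>n. x n / real n) \<longlonglongrightarrow> 0 \<longrightarrow>
        weak_conv_m
          (\<lambda>n. cond_law M (\<lambda>\<omega>. (psum X n \<omega> - b n - x n) / rn n)
                 (\<lambda>\<omega>. psum X n \<omega> - b n \<ge> x n \<and> pmax X n \<omega> \<le> rn n))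
          (exp_law 1))
     \<and>
     (inter_reg_varying (tail M \<xi>) \<longrightarrow>
      (\<forall>T. bdd_above (rn ` {n. real n / x n \<le> T})) \<longrightarrow>
        (\<forall>x'. (\<forall>n. x' n \<ge> x n) \<longrightarrow>
          (\<lambda>n. \<P>(\<omega> in M. psum X n \<omega> - b n \<ge> x' n \<bar>
                    psum X n \<omega> - b n \<ge> x n \<and> pmax X n \<omega> > rn n))
          \<sim>[sequentially] (\<lambda>n. tail M \<xi> (x' n) / tail M \<xi> (x n))))"
proof -
  interpret sv_iid M \<xi> X
    using assms(1-5) by (simp add: sv_iid_def sv_truncated_variance_def sv_truncated_variance_axioms_def sv_iid_axioms_def)
  have b: "b n = real n * mean M \<xi>" and rn: "rn n = r (real n / x n)" and x_pos: "0 < x n" for n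
    by (rule assms)+
  note xa = assms(10)
  have a: "filterlim a at_top sequentially" using assms(6) by (simp add: normalising_seq_def)
  have r_top: "filterlim r at_top at_top" using assms(8) by (simp add: threshold_fun_def)
  have an: "(\<lambda>n. real n * (V (a n) / (a n)\<^sup>2)) \<longlonglongrightarrow> 1"
  proof -
    have "(\<lambda>n. (V (a n) / (a n)\<^sup>2) / (1 / real n)) \<longlonglongrightarrow> 1"
    proof (rule asymp_equivD_strong)
      show "\<forall>\<^sub>F n in sequentially. V (a n) / (a n)\<^sup>2 \<noteq> 0 \<or> 1 / real n \<noteq> 0"
        by (rule eventually_mono[OF eventually_gt_at_top[of 0]]) simp
    qed (use assms(6) in \<open>simp add: normalising_seq_def\<close>)
    then show ?thesis by (simp add: mult.commute)
  qed
  have rV: "((\<lambda>t. (r t / V (r t)) / t) \<longlongrightarrow> 1) at_top"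
  proof (rule asymp_equivD_strong)
    show "\<forall>\<^sub>F t in at_top. r t / V (r t) \<noteq> 0 \<or> t \<noteq> 0"
      by (rule eventually_mono[OF eventually_gt_at_top[of 0]]) simp
  qed (use assms(8) in \<open>simp add: threshold_fun_def\<close>)
  obtain s0 where s0: "0 < s0" "\<And>s y. s0 \<le> s \<Longrightarrow> s \<le> y \<Longrightarrow> V y / y \<le> 2 * (V s / s)"
    using V_over_quasi_decreasing by blast
  have "\<forall>\<^sub>F t in at_top. s0 \<le> r t \<and> 0 < V (r t) \<and> 1 / 2 < (r t / V (r t)) / t \<and> (r t / V (r t)) / t < 2 \<and> 0 < t"
    using r_top[unfolded filterlim_at_top, rule_format, of s0] eventually_compose_filterlim[OF V_pos r_top]
      order_tendstoD(1)[OF rV, of "1/2", simplified] order_tendstoD(2)[OF rV, of 2, simplified] eventually_gt_at_top[of 0]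
    by eventually_elim simp
  then obtain T0 where T0: "\<And>t. T0 \<le> t \<Longrightarrow> s0 \<le> r t \<and> 0 < V (r t) \<and> 1 / 2 < (r t / V (r t)) / t \<and> (r t / V (r t)) / t < 2 \<and> 0 < t"
    unfolding eventually_at_top_linorder by blast
  \<comment> \<open>Beyond T the threshold relation holds up to a factor 2, and the threshold is
    large enough for the quasi-monotonicity of V(y) / y.\<close>
  define T where "T = max T0 1"
  have T: "s0 \<le> r t" "V (r t) / r t \<le> 2 / t" "1 / (2 * t) \<le> V (r t) / r t" if "T \<le> t" for t
  proof -
    have t: "T0 \<le> t" using that by (simp add: T_def)
    show "s0 \<le> r t" using T0[OF t] by simp
    then have "0 < r t" using s0(1) by linarith
    then show "V (r t) / r t \<le> 2 / t" "1 / (2 * t) \<le> V (r t) / r t"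
      using T0[OF t] by (auto simp: field_simps)
  qed
  \<comment> \<open>If the threshold exceeded a, quasi-monotonicity between the two would give x <=
    4 a (n V(a) / a^2) < 8 a, against x / a tending to infinity.\<close>
  have r_le_a: "\<forall>\<^sub>F n in sequentially. T \<le> real n / x n \<longrightarrow> rn n \<le> a n"
    using a[unfolded filterlim_at_top, rule_format, of s0] order_tendstoD(2)[OF an, of 2, simplified]
      xa[unfolded filterlim_at_top, rule_format, of 8] eventually_gt_at_top[of 0]
  proof eventually_elim
    case (elim n)
    show ?case
    proof (rule impI, rule ccontr)
      assume t: "T \<le> real n / x n" and "\<not> rn n \<le> a n"
      then have le: "a n \<le> rn n" by simp
      have ap: "0 < a n" using elim(1) s0(1) by linarith
      have "1 / (2 * (real n / x n)) \<le> V (rn n) / rn n" using T(3)[OF t] by (simp add: rn)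
      also have "\<dots> \<le> 2 * (V (a n) / a n)" using s0(2)[OF elim(1) le] .
      finally have "x n \<le> 4 * a n * (real n * (V (a n) / (a n)\<^sup>2))"
        using elim(4) ap x_pos[of n] by (simp add: field_simps power2_eq_square)
      also have "\<dots> < 4 * a n * 2" using elim(2) ap by (intro mult_strict_left_mono) auto
      also have "4 * a n * 2 \<le> x n" using elim(3) ap by (simp add: field_simps)
      finally show False by simp
    qed
  qed
  show ?thesis
  proof (intro conjI impI allI)
    assume x_n: "(\<lambda>n. x n / real n) \<longlonglongrightarrow> 0"
    have t_top: "filterlim (\<lambda>n. real n / x n) at_top sequentially"
    proof -
      have "filterlim (\<lambda>n. inverse (x n / real n)) at_top sequentially"
      proof (rule filterlim_inverse_at_top[OF x_n])
        show "\<forall>\<^sub>F n in sequentially. 0 < x n / real n"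
          by (rule eventually_mono[OF eventually_gt_at_top[of 0]]) (simp add: x_pos)
      qed
      then show ?thesis by simp
    qed
    have h: "filterlim rn at_top sequentially"
      unfolding rn[abs_def] by (rule filterlim_compose[OF r_top t_top])
    have tT: "\<forall>\<^sub>F n in sequentially. T \<le> real n / x n" by (rule t_top[unfolded filterlim_at_top, rule_format])
    have ratio: "(\<lambda>n. (x n / rn n) / (real n * (V (rn n) / (rn n)\<^sup>2))) \<longlonglongrightarrow> 1"
    proof (rule Lim_transform_eventually[OF filterlim_compose[OF rV t_top]])
      show "\<forall>\<^sub>F n in sequentially. (r (real n / x n) / V (r (real n / x n))) / (real n / x n) = (x n / rn n) / (real n * (V (rn n) / (rn n)\<^sup>2))"
        using tT eventually_gt_at_top[of 0]
      proof eventually_elim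
        case (elim n)
        have "0 < rn n" using T(1)[OF elim(1)] s0(1) by (simp add: rn)
        then show ?case using x_pos[of n] elim(2) unfolding rn[symmetric] by (simp add: field_simps power2_eq_square)
      qed
    qed
    have xh: "filterlim (\<lambda>n. x n / rn n) at_top sequentially"
    proof (rule filterlim_at_top_mono[OF xa])
      show "\<forall>\<^sub>F n in sequentially. x n / a n \<le> x n / rn n"
        using r_le_a tT h[unfolded filterlim_at_top_dense, rule_format, of 0]
        by eventually_elim (auto intro!: divide_left_mono mult_pos_pos simp: less_imp_le[OF x_pos])
    qed
    show "weak_conv_m
          (\<lambda>n. cond_law M (\<lambda>\<omega>. (psum X n \<omega> - b n - x n) / rn n)
                 (\<lambda>\<omega>. psum X n \<omega> - b n \<ge> x n \<and> pmax X n \<omega> \<le> rn n))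
          (exp_law 1)"
      unfolding b by (rule weak_conv_no_big_jump[OF h ratio xh])
  next
    fix x' :: "nat \<Rightarrow> real"
    assume irv: "inter_reg_varying (tail M \<xi>)" and bdd: "\<forall>T. bdd_above (rn ` {n. real n / x n \<le> T})"
      and x': "\<forall>n. x n \<le> x' n"
    \<comment> \<open>For n / x below T the asymptotic relation says nothing about r; there the
      boundedness assumption gives R, which x eventually exceeds.\<close>
    obtain R where R: "\<And>n. real n / x n \<le> T \<Longrightarrow> rn n \<le> R"
      using bdd[rule_format, of T] by (auto simp: bdd_above_def)
    note x_top = filterlim_above_normalising[OF a an xa]
    have r_le: "\<forall>\<^sub>F n in sequentially. rn n \<le> x n"
      using r_le_a xa[unfolded filterlim_at_top, rule_format, of 1] a[unfolded filterlim_at_top_dense, rule_format, of 0]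
        x_top[unfolded filterlim_at_top, rule_format, of R]
    proof eventually_elim
      case (elim n)
      show ?case
      proof (cases "T \<le> real n / x n")
        case True
        then show ?thesis using elim by (simp add: le_divide_eq)
      next
        case False
        then show ?thesis using R[of n] elim(4) by simp
      qed
    qed
    have var: "\<exists>Y1. \<forall>\<^sub>F n in sequentially. \<forall>y. max (rn n) Y1 \<le> y \<longrightarrow> real n * V y \<le> 4 * x n * y"
    proof -
      have T_pos: "0 < T" by (simp add: T_def)
      obtain Y1 where Y1: "\<And>y. Y1 \<le> y \<Longrightarrow> V y / y < 4 / T"
        using order_tendstoD(2)[OF V_over_tendsto_0, of "4 / T"] T_pos by (auto simp: eventually_at_top_linorder)
      have "real n * V y \<le> 4 * x n * y" if y: "max (rn n) (max Y1 1) \<le> y" for n y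
      proof -
        have yp: "0 < y" using y by simp
        \<comment> \<open>For n / x above T the 4 is the factor 2 of quasi-monotonicity times the
          factor 2 of the threshold relation; below T it comes from V(y) / y tending to zero, with
          \<open>Y1\<close> chosen to match.\<close>
        have "V y / y * (real n / x n) \<le> 4"
        proof (cases "T \<le> real n / x n")
          case True
          have tp: "0 < real n / x n" using True T_pos by linarith
          have "V y / y \<le> 2 * (V (rn n) / rn n)" using T(1)[OF True] y by (intro s0(2)) (auto simp: rn)
          also have "\<dots> \<le> 2 * (2 / (real n / x n))" using T(2)[OF True] by (simp add: rn)
          finally have "V y / y * (real n / x n) \<le> 2 * (2 / (real n / x n)) * (real n / x n)"
            using tp by (intro mult_right_mono) auto
          also have "2 * (2 / w) * w = 4" if "0 < w" for w :: real using that by simp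
          note this[OF tp]
          finally show ?thesis .
        next
          case False
          have "V y / y * (real n / x n) \<le> 4 / T * T"
            using False Y1[of y] y T_pos x_pos[of n] by (intro mult_mono) auto
          then show ?thesis using T_pos by simp
        qed
        then show ?thesis using yp x_pos[of n] by (simp add: field_simps)
      qed
      then show ?thesis by (intro exI[of _ "max Y1 1"] always_eventually) blast
    qed
    have lim: "(\<lambda>n. big_jump_prob n (z n) (rn n) / (real n * tail M \<xi> (z n))) \<longlonglongrightarrow> 1" if "\<And>n. x n \<le> z n" for z
      by (rule big_jump_prob_asymp[OF a an x_pos xa that r_le var irv])
    have tail_pos: "\<forall>\<^sub>F n in sequentially. 0 < tail M \<xi> (x' n)"
    proof -
      obtain d X0 where "\<forall>w\<ge>X0. 0 < tail M \<xi> w \<and> tail M \<xi> w \<le> 2 ^ d * tail M \<xi> (2 * w)"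
        using antimono_doubling[OF irv tail_nonneg antimono_tail] by blast
      then show ?thesis
        using x_top[unfolded filterlim_at_top, rule_format, of X0]
        by (auto elim!: eventually_mono dest: order_trans[OF _ x'[rule_format]])
    qed
    have tail_mono: "tail M \<xi> (x' n) \<le> tail M \<xi> (x n)" for n
      using x' antimono_tail by (auto simp: antimono_def)
    show "(\<lambda>n. \<P>(\<omega> in M. psum X n \<omega> - b n \<ge> x' n \<bar> psum X n \<omega> - b n \<ge> x n \<and> pmax X n \<omega> > rn n))
          \<sim>[sequentially] (\<lambda>n. tail M \<xi> (x' n) / tail M \<xi> (x n))"
    proof (rule asymp_equivI')
      let ?P = "\<lambda>z n. big_jump_prob n (z n) (rn n) / (real n * tail M \<xi> (z n))"
      have "(\<lambda>n. ?P x' n / ?P x n) \<longlonglongrightarrow> 1 / 1"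
        using x' by (intro tendsto_divide lim) auto
      then have "(\<lambda>n. ?P x' n / ?P x n) \<longlonglongrightarrow> 1" by simp
      moreover have "\<forall>\<^sub>F n in sequentially. ?P x' n / ?P x n =
        \<P>(\<omega> in M. psum X n \<omega> - b n \<ge> x' n \<bar> psum X n \<omega> - b n \<ge> x n \<and> pmax X n \<omega> > rn n)
         / (tail M \<xi> (x' n) / tail M \<xi> (x n))"
        using tail_pos eventually_gt_at_top[of 0]
      proof eventually_elim
        case (elim n)
        have tx: "0 < tail M \<xi> (x n)" using elim(1) tail_mono[of n] by linarith
        have "\<P>(\<omega> in M. psum X n \<omega> - b n \<ge> x' n \<bar> psum X n \<omega> - b n \<ge> x n \<and> pmax X n \<omega> > rn n)
            = big_jump_prob n (x' n) (rn n) / big_jump_prob n (x n) (rn n)"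
        proof -
          \<comment> \<open>The event for x' is contained in the one for x, so conditioning yields a
            plain quotient of big-jump probabilities.\<close>
          have "{\<omega> \<in> space M. x' n \<le> dev {1..n} \<omega> \<and> x n \<le> dev {1..n} \<omega> \<and> rn n < pmax X n \<omega>}
              = {\<omega> \<in> space M. x' n \<le> dev {1..n} \<omega> \<and> rn n < pmax X n \<omega>}"
            using x'[rule_format, of n] by auto
          then show ?thesis unfolding cond_prob_def b psum_centred big_jump_prob_def by simp
        qed
        then show ?case using elim tx by simp
      qed
      ultimately show "(\<lambda>n. \<P>(\<omega> in M. psum X n \<omega> - b n \<ge> x' n \<bar> psum X n \<omega> - b n \<ge> x n \<and> pmax X n \<omega> > rn n)
         / (tail M \<xi> (x' n) / tail M \<xi> (x n))) \<longlonglongrightarrow> 1"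
        by (rule Lim_transform_eventually)
    qed
  qed
qed

end
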